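(* Let $k$ be an algebraically closed field of characteristic zero, let $v,w\in\mathcal S_n$, and suppose that $X_v$ is an irreducible component of the singular locus $\mathrm{Sing}(X_w)$ of the Schubert variety $X_w$ in the variety $\mathbb F_n$ of complete flags of $k^n$, such that $v$ is obtained from $w$ through a minimal configuration of one of the types $4231$ (with parameters $l,m>0$), $34{*}12$ (with parameter $l\ge 0$) or $34\emptyset12$ (with parameters $l,m\ge 0$) defined in the context. Then the Kazhdan--Lusztig polynomial $P_{v,w}(q)$ of the pair $(v,w)$ is, respectively: (1) for type $4231$: $P_{v,w}(q)=1+q+\cdots+q^{\min(l,m)}$; (2) for type $34{*}12$: $P_{v,w}(q)=1+q^{l+1}$; (3) for type $34\emptyset12$: $P_{v,w}(q)=1+q$.
   Context: Fix a complete reference flag $V_\bullet$ of $k^n$. For $w\in\mathcal S_n$ put $r_w(p,q)=\#\{i\le p,\ w(i)\le q\}$. The Schubert variety is $X_w=\{W_\bullet\in\mathbb F_n:\ \dim(W_p\cap V_q)\ge r_w(p,q),\ 1\le p,q\le n\}$ (a reduced irreducible closed subvariety), of dimension $\ell(w)$, the number of inversions of $w$. The diagram of $w$ is the set of points $(i,w(i))$, $1\le i\le n$. $P_{v,w}$ denotes the usual Kazhdan--Lusztig polynomial of the Coxeter group $\mathcal S_n$, for $v\le w$ in Bruhat order. Configurations. A configuration consists of $N$ points of the diagram of $w$, with rows $x_1<\dots<x_N$ and columns $y_1<\dots<y_N$, such that $w(x_a)=y_{\omega(a)}$ for $1\le a\le N$, where $\omega\in\mathcal S_N$ is a prescribed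 permutation. The associated permutation $v\in\mathcal S_n$ is defined by $v(x_a)=y_{\nu(a)}$ for $1\le a\le N$, with $\nu\in\mathcal S_N$ prescribed, and $v(i)=w(i)$ for $i\notin\{x_1,\dots,x_N\}$. The three types are, in one-line notation (each "$\dots$" between two listed values denotes a decreasing run of consecutive integers, empty if the number of terms is zero): Type $4231$ ($l>0$, $m>0$, $N=l+m+2$): $\omega=(N,\ l+1,l,\dots,2,\ N-1,N-2,\dots,l+2,\ 1)$ (the middle blocks have $l$ and $m$ entries), $\nu=(l+1,l,\dots,1,\ N,N-1,\dots,l+2)$. Here $\ell(w)-\ell(v)=l+m+1$. Type $34{*}12$ ($l\ge0$, $N=l+4$): $\omega=(N-1,\ N,\ N-2,N-3,\dots,3,\ 1,\ 2)$ (the middle block has $l$ entries), $\nu=(1,\ N-1,N-2,\dots,2,\ N)$. Here $\ell(w)-\ell(v)=2l+3$. Type $34\emptyset12$ ($l\ge0$, $m\ge0$, $N=l+m+4$): $\omega=(l+3,\ l+1,l,\dots,2,\ N,\ 1,\ N-1,N-2,\dots,l+4,\ l+2)$ (the block $l+1,\dots,2$ has $l$ entries and the block $N-1,\dots,l+4$ has $m$ entries), $\nu=(l+1,l,\dots,1,\ l+3,\ l+2,\ N,N-1,\dots,l+4)$. Here $\ell(w)-\ell(v)=l+m+3$. The configuration is minimal if no point of the diagram of $w$ other than the $N$ points of the configuration lies in the region $D=\{(p,q):\ r_v(p,q)>r_w(p,q)\}$. It is known that the irreducible components of $\mathrm{Sing}(X_w)$ are exactly the $X_v$ arising from minimal configurations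 of these three types. *)

theory Defs
  imports
    "HOL-Combinatorics.Permutations"
    "HOL-Computational_Algebra.Polynomial"
    "HOL-Library.Extended_Nat"
    "HOL-Library.Function_Algebras"
    "HOL-Library.Poly_Mapping"
begin

section \<open>The Coxeter group of permutations of \<open>{1..n}\<close>\<close>

text \<open>Permutations of \<open>{1..n}\<close> are functions \<open>w\<close> with \<open>w permutes {1..n}\<close>, so they fix
  every number outside \<open>{1..n}\<close>.\<close>

definition inversions :: "nat \<Rightarrow> (nat \<Rightarrow> nat) \<Rightarrow> nat" where
  "inversions n w = card {(i, j). 1 \<le> i \<and> i < j \<and> j \<le> n \<and> w j < w i}"

text \<open>Bruhat order: generated by \<open>u < u t\<close> for transpositions \<open>t\<close> that raise the length.\<close>

definition bruhat_step :: "nat \<Rightarrow> (nat \<Rightarrow> nat) \<Rightarrow> (nat \<Rightarrow> nat) \<Rightarrow> bool" where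
  "bruhat_step n u u' \<longleftrightarrow>
     (\<exists>i j. 1 \<le> i \<and> i < j \<and> j \<le> n \<and> u' = u \<circ> transpose i j) \<and>
     inversions n u < inversions n u'"

definition bruhat_le :: "nat \<Rightarrow> (nat \<Rightarrow> nat) \<Rightarrow> (nat \<Rightarrow> nat) \<Rightarrow> bool" where
  "bruhat_le n u w \<longleftrightarrow> u permutes {1..n} \<and> w permutes {1..n} \<and> (bruhat_step n)\<^sup>*\<^sup>* u w"

definition right_descent :: "nat \<Rightarrow> (nat \<Rightarrow> nat) \<Rightarrow> nat \<Rightarrow> bool" where
  "right_descent n w i \<longleftrightarrow>
     1 \<le> i \<and> i < n \<and> inversions n (w \<circ> transpose i (Suc i)) < inversions n w"

section \<open>Kazhdan--Lusztig polynomials\<close>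

text \<open>The \<open>R\<close>-polynomials and the Kazhdan--Lusztig polynomials are the unique families of integer
  polynomials in \<open>q\<close> with the properties below (Bjorner and Brenti, Combinatorics of Coxeter
  Groups, Theorems 5.1.1 and 5.1.4). Only the values at pairs of permutations of \<open>{1..n}\<close>
  are constrained.\<close>

definition R_family ::
    "nat \<Rightarrow> ((nat \<Rightarrow> nat) \<Rightarrow> (nat \<Rightarrow> nat) \<Rightarrow> int poly) \<Rightarrow> bool" where
  "R_family n R \<longleftrightarrow> (\<forall>u w. u permutes {1..n} \<longrightarrow> w permutes {1..n} \<longrightarrow>
     (\<not> bruhat_le n u w \<longrightarrow> R u w = 0) \<and>
     (u = w \<longrightarrow> R u w = 1) \<and>
     (\<forall>i. right_descent n w i \<longrightarrow>
        (let s = transpose i (Suc i) in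
         R u w = (if right_descent n u i then R (u \<circ> s) (w \<circ> s)
                  else [:0, 1:] * R (u \<circ> s) (w \<circ> s) + [:-1, 1:] * R u (w \<circ> s)))))"

definition R_poly :: "nat \<Rightarrow> (nat \<Rightarrow> nat) \<Rightarrow> (nat \<Rightarrow> nat) \<Rightarrow> int poly" where
  "R_poly n u w = (THE p. \<exists>R. R_family n R \<and> p = R u w)"

text \<open>In the last condition the left-hand side is \<open>q^d P(1/q)\<close> with
  \<open>d = \<ell>(w) - \<ell>(u)\<close>, because \<open>reflect_poly P\<close> is \<open>q^(degree P) P(1/q)\<close>; the degree bound
  ensures \<open>degree P \<le> d\<close>.\<close>

definition KL_family ::
    "nat \<Rightarrow> ((nat \<Rightarrow> nat) \<Rightarrow> (nat \<Rightarrow> nat) \<Rightarrow> int poly) \<Rightarrow> bool" where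
  "KL_family n P \<longleftrightarrow> (\<forall>u w. u permutes {1..n} \<longrightarrow> w permutes {1..n} \<longrightarrow>
     (\<not> bruhat_le n u w \<longrightarrow> P u w = 0) \<and>
     (u = w \<longrightarrow> P u w = 1) \<and>
     (bruhat_le n u w \<and> u \<noteq> w \<longrightarrow>
        2 * degree (P u w) \<le> inversions n w - inversions n u - 1) \<and>
     (bruhat_le n u w \<longrightarrow>
        monom 1 (inversions n w - inversions n u - degree (P u w)) * reflect_poly (P u w) =
        (\<Sum>a | bruhat_le n u a \<and> bruhat_le n a w. R_poly n u a * P a w)))"

definition KL_poly :: "nat \<Rightarrow> (nat \<Rightarrow> nat) \<Rightarrow> (nat \<Rightarrow> nat) \<Rightarrow> int poly" where
  "KL_poly n u w = (THE p. \<exists>P. KL_family n P \<and> p = P u w)"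

section \<open>Complete flags\<close>

global_interpretation fs: vector_space "\<lambda>(c::'k::field) (f::'i \<Rightarrow> 'k) i. c * f i"
  by unfold_locales (auto simp: fun_eq_iff algebra_simps)

text \<open>\<open>k^n\<close>, with coordinates indexed by \<open>{1..n}\<close>.\<close>

definition kn :: "nat \<Rightarrow> (nat \<Rightarrow> 'k::field) set" where
  "kn n = {f. \<forall>i. i \<notin> {1..n} \<longrightarrow> f i = 0}"

text \<open>A flag is extended beyond \<open>n\<close> by the constant value \<open>k^n\<close>, so that distinct
  flags are distinct functions.\<close>

definition complete_flags :: "nat \<Rightarrow> (nat \<Rightarrow> (nat \<Rightarrow> 'k::field) set) set" where
  "complete_flags n =
     {W. \<forall>p. fs.subspace (W p) \<and> W p \<subseteq> kn n \<and> fs.dim (W p) = min p n \<and> W p \<subseteq> W (Suc p)}"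

definition rank_count :: "(nat \<Rightarrow> nat) \<Rightarrow> nat \<Rightarrow> nat \<Rightarrow> nat" where
  "rank_count w p q = card {i. 1 \<le> i \<and> i \<le> p \<and> w i \<le> q}"

definition schubert ::
    "nat \<Rightarrow> (nat \<Rightarrow> (nat \<Rightarrow> 'k::field) set) \<Rightarrow> (nat \<Rightarrow> nat) \<Rightarrow> (nat \<Rightarrow> (nat \<Rightarrow> 'k) set) set" where
  "schubert n V w =
     {W \<in> complete_flags n.
        \<forall>p\<in>{1..n}. \<forall>q\<in>{1..n}. rank_count w p q \<le> fs.dim (W p \<inter> V q)}"

section \<open>Polynomials in several variables\<close>

type_synonym ('i, 'k) mpol = "('i \<Rightarrow>\<^sub>0 nat) \<Rightarrow>\<^sub>0 'k"

definition monomial_at :: "('i \<Rightarrow>\<^sub>0 nat) \<Rightarrow> ('i \<Rightarrow> 'k::field) \<Rightarrow> 'k" where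
  "monomial_at m a = (\<Prod>i\<in>Poly_Mapping.keys m. a i ^ Poly_Mapping.lookup m i)"

definition mpol_at :: "('i, 'k::field) mpol \<Rightarrow> ('i \<Rightarrow> 'k) \<Rightarrow> 'k" where
  "mpol_at f a = (\<Sum>m\<in>Poly_Mapping.keys f. Poly_Mapping.lookup f m * monomial_at m a)"

text \<open>The formal differential of \<open>f\<close> at \<open>a\<close>, applied to \<open>d\<close>.\<close>

definition mpol_differential :: "('i, 'k::field) mpol \<Rightarrow> ('i \<Rightarrow> 'k) \<Rightarrow> ('i \<Rightarrow> 'k) \<Rightarrow> 'k" where
  "mpol_differential f a d =
     (\<Sum>m\<in>Poly_Mapping.keys f. Poly_Mapping.lookup f m *
        (\<Sum>i\<in>Poly_Mapping.keys m. of_nat (Poly_Mapping.lookup m i) *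
           monomial_at (m - Poly_Mapping.single i 1) a * d i))"

definition zariski_tangent_space ::
    "('i \<Rightarrow> 'k::field) set \<Rightarrow> ('i \<Rightarrow> 'k) \<Rightarrow> ('i \<Rightarrow> 'k) set" where
  "zariski_tangent_space Z a =
     {d. \<forall>f. (\<forall>z\<in>Z. mpol_at f z = 0) \<longrightarrow> mpol_differential f a d = 0}"

section \<open>The flag variety\<close>

text \<open>The flag variety is glued from its big cells. An ordered basis \<open>b\<close> of \<open>k^n\<close> gives the
  chart that sends a strictly lower triangular matrix \<open>a\<close> to the flag of the basis
  \<open>b j + (\<Sum>i>j. a i j * b i)\<close>; the origin goes to the flag of \<open>b\<close>.
  The affine space of strictly lower triangular matrices is a coordinate subspace of
  all functions on \<open>nat \<times> nat\<close>. Hence the ideal of a subset contains all the other coordinate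
  functions, and its tangent vectors are again strictly lower triangular.\<close>

definition lower_space :: "nat \<Rightarrow> (nat \<times> nat \<Rightarrow> 'k::field) set" where
  "lower_space n = {a. \<forall>i j. \<not> (1 \<le> j \<and> j < i \<and> i \<le> n) \<longrightarrow> a (i, j) = 0}"

definition lower_closed :: "nat \<Rightarrow> (nat \<times> nat \<Rightarrow> 'k::field) set \<Rightarrow> bool" where
  "lower_closed n Z \<longleftrightarrow>
     (\<exists>F. Z = {a \<in> lower_space n. \<forall>f\<in>F. mpol_at f a = 0})"

definition basis_of_kn :: "nat \<Rightarrow> (nat \<Rightarrow> nat \<Rightarrow> 'k::field) \<Rightarrow> bool" where
  "basis_of_kn n b \<longleftrightarrow>
     (\<forall>j\<in>{1..n}. b j \<in> kn n) \<and> inj_on b {1..n} \<and> fs.independent (b ` {1..n})"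

definition chart ::
    "nat \<Rightarrow> (nat \<Rightarrow> nat \<Rightarrow> 'k::field) \<Rightarrow> (nat \<times> nat \<Rightarrow> 'k) \<Rightarrow> nat \<Rightarrow> (nat \<Rightarrow> 'k) set" where
  "chart n b a p =
     fs.span ((\<lambda>j r. b j r + (\<Sum>i\<in>{j<..n}. a (i, j) * b i r)) ` {1..min p n})"

definition in_chart ::
    "nat \<Rightarrow> (nat \<Rightarrow> nat \<Rightarrow> 'k::field) \<Rightarrow> (nat \<Rightarrow> (nat \<Rightarrow> 'k) set) set \<Rightarrow> (nat \<times> nat \<Rightarrow> 'k) set" where
  "in_chart n b Z = {a \<in> lower_space n. chart n b a \<in> Z}"

definition flag_closed :: "nat \<Rightarrow> (nat \<Rightarrow> (nat \<Rightarrow> 'k::field) set) set \<Rightarrow> bool" where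
  "flag_closed n Z \<longleftrightarrow>
     Z \<subseteq> complete_flags n \<and> (\<forall>b. basis_of_kn n b \<longrightarrow> lower_closed n (in_chart n b Z))"

definition flag_irreducible :: "nat \<Rightarrow> (nat \<Rightarrow> (nat \<Rightarrow> 'k::field) set) set \<Rightarrow> bool" where
  "flag_irreducible n Z \<longleftrightarrow>
     Z \<noteq> {} \<and> Z \<subseteq> complete_flags n \<and>
     (\<forall>A B. flag_closed n A \<longrightarrow> flag_closed n B \<longrightarrow> Z \<subseteq> A \<union> B \<longrightarrow> Z \<subseteq> A \<or> Z \<subseteq> B)"

definition irreducible_component ::
    "nat \<Rightarrow> (nat \<Rightarrow> (nat \<Rightarrow> 'k::field) set) set \<Rightarrow> (nat \<Rightarrow> (nat \<Rightarrow> 'k) set) set \<Rightarrow> bool" where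
  "irreducible_component n S Z \<longleftrightarrow>
     flag_irreducible n Z \<and> Z \<subseteq> S \<and>
     (\<forall>Z'. flag_irreducible n Z' \<longrightarrow> Z \<subseteq> Z' \<longrightarrow> Z' \<subseteq> S \<longrightarrow> Z' = Z)"

definition krull_dim :: "nat \<Rightarrow> (nat \<Rightarrow> (nat \<Rightarrow> 'k::field) set) set \<Rightarrow> enat" where
  "krull_dim n Z =
     Sup {enat d | d. \<exists>C. (\<forall>i\<le>d. flag_closed n (C i) \<and> flag_irreducible n (C i) \<and> C i \<subseteq> Z) \<and>
                          (\<forall>i<d. C i \<subset> C (Suc i))}"

text \<open>The singular locus of an irreducible closed subvariety (with its reduced structure). For
  reducible \<open>Z\<close> one would need the local dimension instead of \<open>krull_dim n Z\<close>.\<close>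

definition singular_locus ::
    "nat \<Rightarrow> (nat \<Rightarrow> (nat \<Rightarrow> 'k::field) set) set \<Rightarrow> (nat \<Rightarrow> (nat \<Rightarrow> 'k) set) set" where
  "singular_locus n Z =
     {W \<in> Z. \<exists>b. basis_of_kn n b \<and> chart n b (\<lambda>_. 0) = W \<and>
        krull_dim n Z < enat (fs.dim (zariski_tangent_space (in_chart n b Z) (\<lambda>_. 0)))}"

section \<open>Configurations\<close>

text \<open>Permutations \<open>\<omega>\<close>, \<open>\<nu>\<close> of \<open>{1..N}\<close> are lists in one-line notation; the decreasing run
  \<open>b-1, \<dots>, a\<close> is \<open>rev [a..<b]\<close>.\<close>

definition omega4231 :: "nat \<Rightarrow> nat \<Rightarrow> nat list" where
  "omega4231 l m = (let N = l + m + 2 in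
     [N] @ rev [2..<l+2] @ rev [l+2..<N] @ [1])"

definition nu4231 :: "nat \<Rightarrow> nat \<Rightarrow> nat list" where
  "nu4231 l m = (let N = l + m + 2 in
     rev [1..<l+2] @ rev [l+2..<N+1])"

definition omega34star12 :: "nat \<Rightarrow> nat list" where
  "omega34star12 l = (let N = l + 4 in
     [N-1, N] @ rev [3..<N-1] @ [1, 2])"

definition nu34star12 :: "nat \<Rightarrow> nat list" where
  "nu34star12 l = (let N = l + 4 in
     [1] @ rev [2..<N] @ [N])"

definition omega34empty12 :: "nat \<Rightarrow> nat \<Rightarrow> nat list" where
  "omega34empty12 l m = (let N = l + m + 4 in
     [l+3] @ rev [2..<l+2] @ [N, 1] @ rev [l+4..<N] @ [l+2])"

definition nu34empty12 :: "nat \<Rightarrow> nat \<Rightarrow> nat list" where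
  "nu34empty12 l m = (let N = l + m + 4 in
     rev [1..<l+2] @ [l+3, l+2] @ rev [l+4..<N+1])"

text \<open>\<open>v\<close> is obtained from \<open>w\<close> through a minimal configuration with rows \<open>x 1 < \<dots> < x N\<close>
  and columns \<open>y 1 < \<dots> < y N\<close>, where \<open>N = length \<omega>\<close>.\<close>

definition minimal_configuration ::
    "nat \<Rightarrow> nat list \<Rightarrow> nat list \<Rightarrow> (nat \<Rightarrow> nat) \<Rightarrow> (nat \<Rightarrow> nat) \<Rightarrow> bool" where
  "minimal_configuration n \<omega> \<nu> v w \<longleftrightarrow>
     (let N = length \<omega> in
      \<exists>x y. strict_mono_on {1..N} x \<and> strict_mono_on {1..N} y \<and>
            x ` {1..N} \<subseteq> {1..n} \<and> y ` {1..N} \<subseteq> {1..n} \<and>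
            (\<forall>a\<in>{1..N}. w (x a) = y (\<omega> ! (a - 1))) \<and>
            (\<forall>a\<in>{1..N}. v (x a) = y (\<nu> ! (a - 1))) \<and>
            (\<forall>i. i \<notin> x ` {1..N} \<longrightarrow> v i = w i) \<and>
            (\<forall>i\<in>{1..n} - x ` {1..N}. \<not> rank_count w i (w i) < rank_count v i (w i)))"

end

(* Along a minimal configuration every element of the Bruhat interval [v, w] agrees with w at the
   points outside the configuration, so these points can be moved to a corner of the diagram and
   deleted without changing the R-polynomials; this reduces P_{v,w} to P_{nu,omega} in S_N.  There
   omega is maximal in its double coset for a Young subgroup, and P_{a,omega} depends only on the
   double coset of a.  All double cosets below omega other than that of nu have polynomial 1, by a
   second application of the same reduction.  Since sum_a q^l(a) P_{a,omega} is palindromic of degree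
   l(omega), the degree bound determines the remaining polynomial.  *)

theory Submission
  imports Defs "HOL-Combinatorics.Multiset_Permutations"
begin

text \<open>The definitions fix both families of polynomials only by uniqueness, so existence has to
  be shown: the braid relations give the R-polynomials, and their matrix being inverse to its bar
  conjugate gives the Kazhdan-Lusztig polynomials. A point outside the configuration can be moved
  because the values of \<open>nu\<close> are at most those of \<open>om\<close> up to some row and
  at least those of \<open>om\<close> afterwards. Hence r_v - r_w rises and then falls along each
  column, and a point where it vanishes meets only zeros on its way up or on its way down. One such
  move multiplies all of [v, w] by the same simple transposition, which is an ascent of all elements
  or a descent of all, so the R-polynomials stay the same. In the pattern, \<open>nu\<close> is the
  longest element of the Young subgroup, whose Poincare polynomial Q divides that of every double
  coset. The palindromic sum is thus Q * (P + R), where R collects the double cosets other than that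
  of \<open>nu\<close>. Cancelling Q leaves P + R symmetric about d/2, where d is the length
  difference and 2 deg P < d; it then suffices to guess a P of low degree with this
  symmetry.\<close>

abbreviation adj :: "nat \<Rightarrow> nat \<Rightarrow> nat" where
  "adj i \<equiv> transpose i (Suc i)"

section \<open>Lengths and transpositions\<close>

lemma adj_permutes: "1 \<le> i \<Longrightarrow> i < n \<Longrightarrow> adj i permutes {1..n}"
  by (intro permutes_swap_id) auto

lemma permutes_comp_adj: "w permutes {1..n} \<Longrightarrow> 1 \<le> i \<Longrightarrow> i < n \<Longrightarrow> w \<circ> adj i permutes {1..n}"
  by (intro permutes_compose adj_permutes)

lemma comp_adj_adj [simp]: "w \<circ> adj i \<circ> adj i = w"
  by (simp add: comp_assoc)

text \<open>Applying \<open>adj i\<close> to two positions preserves their order except for the pair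
  \<open>(i, Suc i)\<close>, which is no inversion of \<open>w\<close>. So it maps the inversions of
  \<open>w\<close> bijectively to those of \<open>w \<circ> adj i\<close> other than
  \<open>(i, Suc i)\<close>.\<close>

lemma inversions_swap:
  assumes "1 \<le> i" "i < n" "w permutes {1..n}" "w i < w (Suc i)"
  shows "inversions n (w \<circ> adj i) = Suc (inversions n w)"
proof -
  define A where "A = {(a, b). 1 \<le> a \<and> a < b \<and> b \<le> n \<and> w b < w a}"
  let ?f = "\<lambda>(a, b). (adj i a, adj i b)"
  have fin: "finite A"
    by (rule finite_subset[of _ "{1..n} \<times> {1..n}"]) (auto simp: A_def)
  have "inj ?f"
    by (auto simp: inj_def inj_eq[OF inj_transpose])
  have nA: "(i, Suc i) \<notin> ?f ` A"
    by (auto simp: A_def transpose_def split: if_splits)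
  have "{(a, b). 1 \<le> a \<and> a < b \<and> b \<le> n \<and> (w \<circ> adj i) b < (w \<circ> adj i) a} = insert (i, Suc i) (?f ` A)"
    (is "?B = _")
  proof (intro set_eqI iffI)
    fix z assume "z \<in> ?B"
    then obtain a b where z: "z = (a, b)" "1 \<le> a" "a < b" "b \<le> n" "w (adj i b) < w (adj i a)"
      by auto
    show "z \<in> insert (i, Suc i) (?f ` A)"
    proof (cases "a = i \<and> b = Suc i")
      case False
      with z assms have "(adj i a, adj i b) \<in> A"
        by (auto simp: A_def transpose_def split: if_splits)
      then have "?f (adj i a, adj i b) \<in> ?f ` A" by blast
      then show ?thesis using z by simp
    qed (use z in auto)
  next
    fix z assume "z \<in> insert (i, Suc i) (?f ` A)"
    then show "z \<in> ?B"
      using assms by (auto simp: A_def transpose_def split: if_splits)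
  qed
  then have "inversions n (w \<circ> adj i) = card (insert (i, Suc i) (?f ` A))"
    by (simp add: inversions_def)
  also have "\<dots> = Suc (card A)"
    using nA fin \<open>inj ?f\<close> by (simp add: card_image inj_on_subset)
  finally show ?thesis by (simp add: inversions_def A_def)
qed

lemma permutes_neq_Suc: "w permutes {1..n} \<Longrightarrow> w i \<noteq> w (Suc i)"
  by (metis n_not_Suc_n permutes_inv_eq)

lemma inversions_swap_desc:
  assumes "1 \<le> i" "i < n" "w permutes {1..n}" "w (Suc i) < w i"
  shows "inversions n w = Suc (inversions n (w \<circ> adj i))"
  using inversions_swap[of i n "w \<circ> adj i"] assms
  by (simp add: permutes_comp_adj del: One_nat_def)

text \<open>Replaces the length comparison in the definition by a comparison of two adjacent values,
  the form used in all recursions below.\<close>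

lemma right_descent_iff:
  assumes "w permutes {1..n}"
  shows "right_descent n w i \<longleftrightarrow> 1 \<le> i \<and> i < n \<and> w (Suc i) < w i"
  using inversions_swap[of i n w] inversions_swap_desc[of i n w] permutes_neq_Suc[of w n i] assms
  unfolding right_descent_def by (metis lessI less_SucI linorder_neqE_nat not_less_iff_gr_or_eq)

lemma inversions_alt:
  "inversions n w = card {(i, j). i \<in> {1..n} \<and> j \<in> {1..n} \<and> i < j \<and> w j < w i}"
  unfolding inversions_def by (rule arg_cong[of _ _ card]) auto

text \<open>An inversion is a pair of points of the diagram. Reflection in the diagonal exchanges
  positions and values and therefore swaps the two members of the pair.\<close>

lemma inversions_inv:
  assumes "w permutes {1..n}"
  shows "inversions n (inv w) = inversions n w"
proof -
  have iw: "inv w permutes {1..n}" using assms by (rule permutes_inv)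
  have r: "\<And>a. w a \<in> {1..n} \<longleftrightarrow> a \<in> {1..n}" "\<And>a. inv w a \<in> {1..n} \<longleftrightarrow> a \<in> {1..n}"
    using permutes_in_image[OF assms] permutes_in_image[OF iw] by auto
  have e: "w (inv w a) = a" "inv w (w a) = a" for a
    using permutes_inverses[OF assms] by auto
  show ?thesis unfolding inversions_alt
    by (rule bij_betw_same_card[of "\<lambda>(a, b). (inv w b, inv w a)"],
        rule bij_betwI[where g = "\<lambda>(a, b). (w b, w a)"]) (auto simp: e r simp del: atLeastAtMost_iff One_nat_def)
qed

text \<open>Conjugation by \<open>adj i\<close> reduces \<open>transpose i j\<close> to
  \<open>transpose (Suc i) j\<close>. The two outer factors change the length by one each: either
  they cancel, or the first raises the length and the last lowers it by at most one.\<close>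

lemma inversions_transpose:
  assumes "1 \<le> i" "i < j" "j \<le> n" "u permutes {1..n}" "u i < u j"
  shows "inversions n u < inversions n (u \<circ> transpose i j)"
  using assms
proof (induction "j - i" arbitrary: i u rule: less_induct)
  case less
  show ?case
  proof (cases "j = Suc i")
    case True
    then show ?thesis using inversions_swap[of i n u] less.prems by simp
  next
    case False
    then have ij: "Suc i < j" using less.prems by simp
    define u' where "u' = u \<circ> adj i"
    have pu': "u' permutes {1..n}" unfolding u'_def using less.prems by (intro permutes_comp_adj) auto
    have "inversions n u' < inversions n (u' \<circ> transpose (Suc i) j)"
      using less.prems ij pu' by (intro less.hyps) (auto simp: u'_def transpose_def)
    moreover define v where "v = u' \<circ> transpose (Suc i) j"
    moreover have eq: "u \<circ> transpose i j = v \<circ> adj i"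
      using ij by (auto simp: u'_def v_def fun_eq_iff transpose_def)
    moreover have pv: "v permutes {1..n}"
      unfolding v_def using less.prems ij pu' by (intro permutes_compose permutes_swap_id) auto
    moreover have vv: "v i = u (Suc i)" "v (Suc i) = u j"
      using ij by (auto simp: u'_def v_def transpose_def)
    ultimately have lt: "inversions n u' < inversions n v" by simp
    have i: "1 \<le> i" "i < n" using less.prems by auto
    show ?thesis
    proof (cases "u (Suc i) < u i")
      case True
      then have "inversions n u = Suc (inversions n u')"
        unfolding u'_def using i less.prems by (intro inversions_swap_desc) auto
      moreover have "inversions n (v \<circ> adj i) = Suc (inversions n v)"
        using True vv less.prems by (intro inversions_swap i pv) auto
      ultimately show ?thesis using lt eq by simp
    next
      case False
      then have "u i < u (Suc i)" using permutes_neq_Suc[OF less.prems(4), of i] by simp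
      then have "inversions n u' = Suc (inversions n u)"
        unfolding u'_def using i less.prems by (intro inversions_swap) auto
      moreover have "inversions n v \<le> Suc (inversions n (v \<circ> adj i))"
        using inversions_swap[OF i pv] inversions_swap_desc[OF i pv] permutes_neq_Suc[OF pv, of i]
        by (metis le_Suc_eq linorder_neqE_nat order_refl)
      ultimately show ?thesis using lt eq by simp
    qed
  qed
qed

section \<open>Rank functions and Bruhat order\<close>

lemma rank_count_0 [simp]: "rank_count w 0 q = 0"
proof -
  have "{i. 1 \<le> i \<and> i \<le> (0::nat) \<and> w i \<le> q} = {}" by auto
  then show ?thesis unfolding rank_count_def by simp
qed

lemma rank_count_Suc: "rank_count w (Suc p) q = rank_count w p q + of_bool (w (Suc p) \<le> q)"
proof -
  have "{i. 1 \<le> i \<and> i \<le> Suc p \<and> w i \<le> q} =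
        {i. 1 \<le> i \<and> i \<le> p \<and> w i \<le> q} \<union> (if w (Suc p) \<le> q then {Suc p} else {})"
    by (auto simp: le_Suc_eq)
  then show ?thesis unfolding rank_count_def by auto
qed

lemma rank_count_sum: "rank_count w p q = (\<Sum>i=1..p. of_bool (w i \<le> q))"
  by (induction p) (auto simp: rank_count_Suc)

lemma rank_count_cong: "(\<And>i. 1 \<le> i \<Longrightarrow> i \<le> p \<Longrightarrow> w i = w' i) \<Longrightarrow> rank_count w p q = rank_count w' p q"
  by (simp add: rank_count_sum)

lemma rank_count_inv:
  assumes "w permutes {1..n}"
  shows "rank_count (inv w) q p = rank_count w p q"
proof -
  have e: "w (inv w a) = a" "inv w (w a) = a" for a
    using permutes_inverses[OF assms] by auto
  \<comment> \<open>\<open>rank_count\<close> bounds positions below by 1 but not values, so the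
    bijection needs that 0 is fixed.\<close>
  have w0: "w a = 0 \<longleftrightarrow> a = 0" for a
    using permutes_not_in[OF assms, of 0] e by (metis atLeastAtMost_iff not_one_le_zero)
  then have iw0: "inv w a = 0 \<longleftrightarrow> a = 0" for a
    by (metis e(1))
  have g: "1 \<le> w a \<longleftrightarrow> 1 \<le> a" "1 \<le> inv w a \<longleftrightarrow> 1 \<le> a" for a
    using w0[of a] iw0[of a] by linarith+
  show ?thesis unfolding rank_count_def
    by (rule bij_betw_same_card[of "inv w"], rule bij_betwI[where g = w]) (auto simp: e g simp del: One_nat_def)
qed

definition rank_le :: "(nat \<Rightarrow> nat) \<Rightarrow> (nat \<Rightarrow> nat) \<Rightarrow> bool" where
  "rank_le u w \<longleftrightarrow> (\<forall>p q. rank_count w p q \<le> rank_count u p q)"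

lemma rank_le_refl [simp]: "rank_le u u"
  by (simp add: rank_le_def)

lemma rank_le_trans: "rank_le u v \<Longrightarrow> rank_le v w \<Longrightarrow> rank_le u w"
  by (meson rank_le_def le_trans)

lemma rank_count_eq_imp_eq:
  assumes "u permutes {1..n}" "w permutes {1..n}" "\<And>p q. p \<le> n \<Longrightarrow> rank_count u p q = rank_count w p q"
  shows "u = w"
proof
  fix i
  show "u i = w i"
  proof (cases "i \<in> {1..n}")
    case True
    then obtain j where j: "i = Suc j" by (cases i) auto
    have "(u i \<le> q) = (w i \<le> q)" for q
      using assms(3)[of i q] assms(3)[of j q] True j by (auto simp: rank_count_Suc of_bool_def split: if_splits)
    then show ?thesis by (metis order_antisym order_refl)
  next
    case False
    then show ?thesis using assms(1,2) by (simp add: permutes_def)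
  qed
qed

lemma rank_le_antisym:
  "u permutes {1..n} \<Longrightarrow> w permutes {1..n} \<Longrightarrow> rank_le u w \<Longrightarrow> rank_le w u \<Longrightarrow> u = w"
  by (rule rank_count_eq_imp_eq) (auto simp: rank_le_def intro: order_antisym)

lemma rank_le_inv:
  "u permutes {1..n} \<Longrightarrow> w permutes {1..n} \<Longrightarrow> rank_le u w \<Longrightarrow> rank_le (inv u) (inv w)"
  by (simp add: rank_le_def rank_count_inv)

lemma rank_count_transpose:
  assumes "1 \<le> i" "i < j" "u i < u j"
  shows "rank_count u p q = rank_count (u \<circ> transpose i j) p q +
           of_bool (i \<le> p \<and> p < j \<and> u i \<le> q \<and> q < u j)"
proof (induction p)
  case (Suc p)
  then show ?case
    using assms by (auto simp: rank_count_Suc transpose_def of_bool_def not_le not_less split: if_splits)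
qed (use assms in auto)

lemma bruhat_le_imp_rank_le:
  assumes "bruhat_le n u w"
  shows "rank_le u w"
proof -
  have "(bruhat_step n)\<^sup>*\<^sup>* u w" "u permutes {1..n}"
    using assms by (auto simp: bruhat_le_def)
  then have "w permutes {1..n} \<and> rank_le u w"
  proof (induction rule: rtranclp_induct)
    case (step y z)
    then obtain i j where ij: "1 \<le> i" "i < j" "j \<le> n" "z = y \<circ> transpose i j"
        "inversions n y < inversions n z" and y: "y permutes {1..n}" "rank_le u y"
      by (auto simp: bruhat_step_def)
    have z: "z permutes {1..n}"
      unfolding ij using ij y by (intro permutes_compose permutes_swap_id) auto
    \<comment> \<open>A Bruhat step is only known to raise the length. If it lowered the value in
      row \<open>i\<close>, undoing it would raise the length as well.\<close>
    have "y i < y j"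
    proof (rule ccontr)
      assume "\<not> y i < y j"
      moreover have "y i \<noteq> y j" using y(1) ij(2) by (metis less_irrefl permutes_inv_eq)
      ultimately have "z i < z j" using ij by (simp add: transpose_def)
      then have "inversions n z < inversions n (z \<circ> transpose i j)"
        using ij z by (intro inversions_transpose) auto
      also have "z \<circ> transpose i j = y" unfolding ij by (simp add: comp_assoc)
      finally show False using ij(5) by simp
    qed
    then have "rank_le y z"
      unfolding rank_le_def ij using rank_count_transpose[of i j y] ij by (metis le_add1)
    then show ?case using z y rank_le_trans by blast
  qed auto
  then show ?thesis by simp
qed

text \<open>If \<open>u \<noteq> w\<close> then at the first row \<open>i\<close> where they differ \<open>u i < w i\<close>, and exchanging
  \<open>u i\<close> with the next value of \<open>u\<close> in the interval \<open>(u i, w i]\<close> stays below \<open>w\<close>.\<close>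

lemma rank_le_step:
  assumes u: "u permutes {1..n}" and w: "w permutes {1..n}" and le: "rank_le u w" and ne: "u \<noteq> w"
  obtains i j where "1 \<le> i" "i < j" "j \<le> n" "u i < u j" "rank_le (u \<circ> transpose i j) w"
proof -
  define i where "i = (LEAST i. u i \<noteq> w i)"
  obtain k where "u k \<noteq> w k" using ne by blast
  then have ui: "u i \<noteq> w i" unfolding i_def by (rule LeastI)
  have before: "u k = w k" if "k < i" for k
    using that not_less_Least i_def by blast
  have i: "1 \<le> i" "i \<le> n"
  proof -
    have "i \<in> {1..n}" using ui u w by (metis permutes_def)
    then show "1 \<le> i" "i \<le> n" by auto
  qed
  obtain i' where i': "i = Suc i'" using i by (cases i) auto
  have ri': "rank_count u i' q = rank_count w i' q" for q
    using before i' by (intro rank_count_cong) auto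
  have lt: "u i < w i"
  proof -
    have "rank_count w i (w i) \<le> rank_count u i (w i)" using le by (simp add: rank_le_def)
    then have "u i \<le> w i" using ri' i' by (auto simp: rank_count_Suc of_bool_def split: if_splits)
    then show ?thesis using ui by simp
  qed
  define P where "P = (\<lambda>j. i < j \<and> u i < u j \<and> u j \<le> w i)"
  have "\<exists>j. P j"
  proof -
    define k where "k = inv u (w i)"
    have uk: "u k = w i" unfolding k_def using permutes_inverses(1)[OF u] by simp
    have "k \<noteq> i" using uk ui by auto
    moreover have "\<not> k < i"
    proof
      assume "k < i"
      then have "w k = w i" using before uk by simp
      then show False using \<open>k < i\<close> w by (metis less_irrefl permutes_inv_eq)
    qed
    ultimately show ?thesis unfolding P_def using uk lt by (metis linorder_neqE_nat order_refl)
  qed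
  define j where "j = (LEAST j. P j)"
  have j: "i < j" "u i < u j" "u j \<le> w i"
    using LeastI_ex[OF \<open>\<exists>j. P j\<close>] by (auto simp: j_def P_def)
  have jmin: "\<not> (u i < u k \<and> u k \<le> w i)" if "i < k" "k < j" for k
    using not_less_Least[of k P] that by (auto simp: j_def P_def)
  have wi: "w i \<le> n" using permutes_in_image[OF w, of i] i by simp
  have jn: "j \<le> n"
  proof (rule ccontr)
    assume "\<not> j \<le> n"
    then have "u j = j" using u by (auto simp: permutes_def)
    then show False using j wi \<open>\<not> j \<le> n\<close> by simp
  qed
  \<comment> \<open>Values in the interval \<open>(q, w i]\<close> are counted. Up to row
    \<open>p\<close>, \<open>u\<close> has none beyond row \<open>i'\<close> by the choice of
    \<open>j\<close>, while \<open>w\<close> has at least the one in row \<open>i\<close>.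
    Comparison in column \<open>w i\<close> leaves a slack of one on the rectangle where the
    exchange lowers the count.\<close>
  have key: "rank_count w p q + 1 \<le> rank_count u p q"
    if p: "i \<le> p" "p < j" and q: "u i \<le> q" "q < u j" for p q
  proof -
    have qw: "q < w i" using q j by simp
    have A: "rank_count u p (w i) - rank_count u p q = rank_count u i' (w i) - rank_count u i' q"
      using p(1) p(2)
    proof (induction p rule: dec_induct)
      case base
      then show ?case unfolding i' using q lt i' by (simp add: rank_count_Suc)
    next
      case (step k)
      then have "\<not> (u i < u (Suc k) \<and> u (Suc k) \<le> w i)" by (intro jmin) auto
      then have "of_bool (u (Suc k) \<le> w i) = (of_bool (u (Suc k) \<le> q) :: nat)"
        using q qw by auto
      then show ?case using step by (simp add: rank_count_Suc)
    qed
    have mono: "rank_count v p q \<le> rank_count v p (w i)" for v p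
      unfolding rank_count_sum using qw by (intro sum_mono) (auto simp: of_bool_def)
    have B: "rank_count w i' (w i) - rank_count w i' q + 1 \<le> rank_count w p (w i) - rank_count w p q"
      using p(1)
    proof (induction p rule: dec_induct)
      case base
      then show ?case unfolding i' using qw i' mono[of w i'] by (simp add: rank_count_Suc)
    next
      case (step k)
      then show ?case using qw mono[of w k] by (auto simp: rank_count_Suc of_bool_def)
    qed
    have "rank_count w p (w i) \<le> rank_count u p (w i)" using le by (simp add: rank_le_def)
    then show ?thesis using A B mono[of u p] mono[of w p] mono[of u i'] mono[of w i'] ri' by auto
  qed
  have "rank_le (u \<circ> transpose i j) w"
    unfolding rank_le_def
  proof (intro allI)
    fix p q
    have "rank_count w p q \<le> rank_count u p q" using le by (simp add: rank_le_def)
    then show "rank_count w p q \<le> rank_count (u \<circ> transpose i j) p q"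
      using rank_count_transpose[OF i(1) j(1,2), of p q] key[of p q] by (auto simp: of_bool_def split: if_splits)
  qed
  then show ?thesis using that i j jn by blast
qed

lemma rank_le_imp_bruhat_le:
  assumes "u permutes {1..n}" "w permutes {1..n}" "rank_le u w"
  shows "bruhat_le n u w"
  using assms
proof (induction "n * n - inversions n u" arbitrary: u rule: less_induct)
  case less
  show ?case
  proof (cases "u = w")
    case True
    then show ?thesis using less by (simp add: bruhat_le_def)
  next
    case False
    obtain i j where ij: "1 \<le> i" "i < j" "j \<le> n" "u i < u j" "rank_le (u \<circ> transpose i j) w"
      using rank_le_step[OF less.prems False] .
    define u' where "u' = u \<circ> transpose i j"
    \<comment> \<open>A crude bound on the length, which makes the measure of the induction
      decrease.\<close>
    have inv_le: "inversions n v \<le> n * n" for v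
    proof -
      have "inversions n v \<le> card ({1..n} \<times> {1..n})"
        unfolding inversions_def by (rule card_mono) auto
      then show ?thesis by (simp add: card_cartesian_product)
    qed
    have lt: "inversions n u < inversions n u'"
      unfolding u'_def using ij less.prems by (intro inversions_transpose) auto
    have u': "u' permutes {1..n}"
      unfolding u'_def using ij less.prems by (intro permutes_compose permutes_swap_id) auto
    have "bruhat_le n u' w"
      using lt inv_le[of u'] less.prems ij(5) u' by (intro less.hyps) (auto simp: u'_def)
    moreover have "bruhat_step n u u'"
      using ij lt unfolding bruhat_step_def u'_def by blast
    ultimately show ?thesis using less.prems
      by (auto simp: bruhat_le_def intro: converse_rtranclp_into_rtranclp)
  qed
qed

text \<open>The rank-matrix criterion for the Bruhat order. From here on every order statement is an
  inequality between counts.\<close>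

theorem bruhat_le_iff:
  "bruhat_le n u w \<longleftrightarrow> u permutes {1..n} \<and> w permutes {1..n} \<and> rank_le u w"
  using bruhat_le_imp_rank_le rank_le_imp_bruhat_le by (auto simp: bruhat_le_def)

lemma bruhat_le_refl: "w permutes {1..n} \<Longrightarrow> bruhat_le n w w"
  by (simp add: bruhat_le_iff)

lemma bruhat_le_trans: "bruhat_le n u v \<Longrightarrow> bruhat_le n v w \<Longrightarrow> bruhat_le n u w"
  by (auto simp: bruhat_le_iff intro: rank_le_trans)

lemma bruhat_le_permutes: "bruhat_le n u w \<Longrightarrow> u permutes {1..n}" "bruhat_le n u w \<Longrightarrow> w permutes {1..n}"
  by (auto simp: bruhat_le_iff)

lemma bruhat_le_inv: "bruhat_le n u w \<Longrightarrow> bruhat_le n (inv u) (inv w)"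
  by (auto simp: bruhat_le_iff intro: permutes_inv rank_le_inv)

lemma bruhat_le_inversions:
  assumes "bruhat_le n u w"
  shows "inversions n u \<le> inversions n w" and "u \<noteq> w \<Longrightarrow> inversions n u < inversions n w"
proof -
  have "(bruhat_step n)\<^sup>*\<^sup>* u w" using assms by (simp add: bruhat_le_def)
  then have "u = w \<or> inversions n u < inversions n w"
    by (induction rule: rtranclp_induct) (auto simp: bruhat_step_def)
  then show "inversions n u \<le> inversions n w" and "u \<noteq> w \<Longrightarrow> inversions n u < inversions n w" by auto
qed

section \<open>The lifting property of the Bruhat order\<close>

lemma rank_count_comp_adj:
  assumes "p \<noteq> i" "1 \<le> i"
  shows "rank_count (w \<circ> adj i) p q = rank_count w p q"
proof (cases "p < i")
  case True
  then show ?thesis by (intro rank_count_cong) (auto simp: transpose_def)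
next
  case False
  then have "Suc i \<le> p" using assms by simp
  then show ?thesis
  proof (induction p rule: dec_induct)
    case base
    have "rank_count (w \<circ> adj i) (i - 1) q = rank_count w (i - 1) q"
      by (intro rank_count_cong) (auto simp: transpose_def)
    then have "rank_count (w \<circ> adj i) (Suc (Suc (i - 1))) q = rank_count w (Suc (Suc (i - 1))) q"
      using assms(2) unfolding rank_count_Suc by simp
    then show ?case using assms(2) by (simp del: comp_apply add: comp_def)
  next
    case (step k)
    then show ?case by (simp add: rank_count_Suc transpose_def)
  qed
qed


text \<open>This and the next lemma express row \<open>i\<close> by its two neighbours, which
  multiplication by \<open>adj i\<close> leaves alone; an ascent selects the minimum, a descent the
  maximum.\<close>

lemma rank_count_row_asc:
  assumes "1 \<le> i" "w i < w (Suc i)"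
  shows "rank_count w i q = min (Suc (rank_count w (i - 1) q)) (rank_count w (Suc i) q)"
  using assms rank_count_Suc[of w "i - 1" q] by (auto simp: rank_count_Suc)

lemma rank_count_row_desc:
  assumes "1 \<le> i" "w (Suc i) < w i"
  shows "rank_count w i q = max (rank_count w (i - 1) q) (rank_count w (Suc i) q - 1)"
  using assms rank_count_Suc[of w "i - 1" q] by (auto simp: rank_count_Suc)

lemma rank_le_rowI:
  assumes "rank_le u w" "\<And>p q. p \<noteq> i \<Longrightarrow> rank_count u' p q = rank_count u p q"
    "\<And>p q. p \<noteq> i \<Longrightarrow> rank_count w' p q = rank_count w p q"
    "\<And>q. rank_count w' i q \<le> rank_count u' i q"
  shows "rank_le u' w'"
  using assms unfolding rank_le_def by metis

text \<open>One half of the lifting property. If \<open>adj i\<close> turns an ascent of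
  \<open>u\<close> into a descent, row \<open>i\<close> is given for both permutations by the
  maximum formula, which is monotone in the neighbouring rows. Otherwise the count for
  \<open>u\<close> in row \<open>i\<close> can only grow.\<close>

lemma rank_le_comp_left:
  assumes "rank_le u w" "1 \<le> i" "w (Suc i) < w i" "inj u"
  shows "rank_le (u \<circ> adj i) w"
proof (rule rank_le_rowI[OF assms(1)])
  fix q
  have "u i \<noteq> u (Suc i)" using assms(4) by (metis injD n_not_Suc_n)
  then consider "u i < u (Suc i)" | "u (Suc i) < u i" by linarith
  then show "rank_count w i q \<le> rank_count (u \<circ> adj i) i q"
  proof cases
    case 1
    have "rank_count (u \<circ> adj i) i q = max (rank_count u (i - 1) q) (rank_count u (Suc i) q - 1)"
      using rank_count_row_desc[of i "u \<circ> adj i" q] 1 assms(2) by (simp add: rank_count_comp_adj)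
    moreover have "rank_count w i q = max (rank_count w (i - 1) q) (rank_count w (Suc i) q - 1)"
      using rank_count_row_desc assms by simp
    moreover have "rank_count w p q \<le> rank_count u p q" for p using assms(1) by (simp add: rank_le_def)
    ultimately show ?thesis by (metis max.mono diff_le_mono)
  next
    case 2
    have "rank_count w i q \<le> rank_count u i q" using assms(1) by (simp add: rank_le_def)
    also have "\<dots> \<le> rank_count (u \<circ> adj i) i q"
      using rank_count_Suc[of u "i - 1" q] rank_count_Suc[of "u \<circ> adj i" "i - 1" q]
        rank_count_comp_adj[of "i - 1" i u q] 2 assms(2) by auto
    finally show ?thesis .
  qed
qed (use assms in \<open>simp_all add: rank_count_comp_adj\<close>)

text \<open>The dual half, with the minimum formula if \<open>adj i\<close> turns a descent of
  \<open>w\<close> into an ascent; otherwise the count for \<open>w\<close> in row \<open>i\<close>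
  can only drop.\<close>

lemma rank_le_comp_right:
  assumes "rank_le u w" "1 \<le> i" "u i < u (Suc i)" "inj w"
  shows "rank_le u (w \<circ> adj i)"
proof (rule rank_le_rowI[OF assms(1)])
  fix q
  have "w i \<noteq> w (Suc i)" using assms(4) by (metis injD n_not_Suc_n)
  then consider "w (Suc i) < w i" | "w i < w (Suc i)" by linarith
  then show "rank_count (w \<circ> adj i) i q \<le> rank_count u i q"
  proof cases
    case 1
    have "rank_count (w \<circ> adj i) i q = min (Suc (rank_count w (i - 1) q)) (rank_count w (Suc i) q)"
      using rank_count_row_asc[of i "w \<circ> adj i" q] 1 assms(2) by (simp add: rank_count_comp_adj)
    moreover have "rank_count u i q = min (Suc (rank_count u (i - 1) q)) (rank_count u (Suc i) q)"
      using rank_count_row_asc assms by simp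
    moreover have "rank_count w p q \<le> rank_count u p q" for p using assms(1) by (simp add: rank_le_def)
    ultimately show ?thesis by (metis min.mono Suc_le_mono)
  next
    case 2
    have "rank_count (w \<circ> adj i) i q \<le> rank_count w i q"
      using rank_count_Suc[of w "i - 1" q] rank_count_Suc[of "w \<circ> adj i" "i - 1" q]
        rank_count_comp_adj[of "i - 1" i w q] 2 assms(2) by auto
    also have "\<dots> \<le> rank_count u i q" using assms(1) by (simp add: rank_le_def)
    finally show ?thesis .
  qed
qed (use assms in \<open>simp_all add: rank_count_comp_adj\<close>)

lemma rank_le_comp_adj:
  assumes "1 \<le> i" "w i < w (Suc i)"
  shows "rank_le w (w \<circ> adj i)"
  using assms rank_count_transpose[of i "Suc i" w] by (simp add: rank_le_def)

declare One_nat_def [simp del]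

section \<open>\<open>R\<close>-polynomials\<close>

text \<open>The recursion of the \<open>R\<close>-polynomials in \<open>w\<close>, as an operator on functions of \<open>u\<close>. It
  satisfies the braid relations, so the choice of the descents in \<open>R_rec\<close> does not matter.\<close>

definition hecke_op :: "'a::comm_ring_1 \<Rightarrow> 'a \<Rightarrow> nat \<Rightarrow> ((nat \<Rightarrow> nat) \<Rightarrow> 'a) \<Rightarrow> (nat \<Rightarrow> nat) \<Rightarrow> 'a" where
  "hecke_op x y i f u = (if u (Suc i) < u i then f (u \<circ> adj i) else x * f (u \<circ> adj i) + y * f u)"

lemma hecke_op_cong:
  assumes "\<And>u. inj u \<Longrightarrow> f u = g u" "inj u"
  shows "hecke_op x y i f u = hecke_op x y i g u"
  using assms by (simp add: hecke_op_def inj_compose)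

lemma adj_braid: "u \<circ> adj (Suc i) \<circ> adj i \<circ> adj (Suc i) = u \<circ> adj i \<circ> adj (Suc i) \<circ> adj i"
  by (auto simp: fun_eq_iff transpose_def)

lemma adj_commute: "Suc i < j \<Longrightarrow> u \<circ> adj j \<circ> adj i = u \<circ> adj i \<circ> adj j"
  by (auto simp: fun_eq_iff transpose_def)

text \<open>The branches taken depend only on the relative order of three values of
  \<open>u\<close>. In each of the six orders the claim is an identity between polynomials in
  \<open>x\<close>, \<open>y\<close> and the values of \<open>f\<close> on the six
  rearrangements.\<close>

lemma hecke_op_braid:
  assumes "inj u"
  shows "hecke_op x y i (hecke_op x y (Suc i) (hecke_op x y i f)) u =
         hecke_op x y (Suc i) (hecke_op x y i (hecke_op x y (Suc i) f)) u"
proof -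
  have ne: "u i \<noteq> u (Suc i)" "u i \<noteq> u (Suc (Suc i))" "u (Suc i) \<noteq> u (Suc (Suc i))"
    using assms by (auto simp: inj_eq)
  have v: "(v \<circ> adj i) i = v (Suc i)" "(v \<circ> adj i) (Suc i) = v i"
    "(v \<circ> adj i) (Suc (Suc i)) = v (Suc (Suc i))"
    "(v \<circ> adj (Suc i)) i = v i" "(v \<circ> adj (Suc i)) (Suc i) = v (Suc (Suc i))"
    "(v \<circ> adj (Suc i)) (Suc (Suc i)) = v (Suc i)" for v :: "nat \<Rightarrow> nat"
    by (auto simp: transpose_def)
  have e: "hecke_op x y j g u = (if u (Suc j) < u j then g (u \<circ> adj j) else x * g (u \<circ> adj j) + y * g u)"
    for g u j by (rule hecke_op_def)
  consider "u i < u (Suc i)" "u (Suc i) < u (Suc (Suc i))" "u i < u (Suc (Suc i))"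
    | "u i < u (Suc i)" "u (Suc (Suc i)) < u (Suc i)" "u i < u (Suc (Suc i))"
    | "u i < u (Suc i)" "u (Suc (Suc i)) < u (Suc i)" "u (Suc (Suc i)) < u i"
    | "u (Suc i) < u i" "u (Suc i) < u (Suc (Suc i))" "u i < u (Suc (Suc i))"
    | "u (Suc i) < u i" "u (Suc i) < u (Suc (Suc i))" "u (Suc (Suc i)) < u i"
    | "u (Suc i) < u i" "u (Suc (Suc i)) < u (Suc i)" "u (Suc (Suc i)) < u i"
    using ne by linarith
  then show ?thesis
    by cases (simp_all only: e v comp_adj_adj adj_braid less_asym' not_less_iff_gr_or_eq if_True if_False simp_thms less_not_sym not_False_eq_True,
        simp_all add: algebra_simps)
qed

lemma hecke_op_commute:
  assumes "Suc i < j"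
  shows "hecke_op x y i (hecke_op x y j f) u = hecke_op x y j (hecke_op x y i f) u"
proof -
  have v: "(v \<circ> adj i) j = v j" "(v \<circ> adj i) (Suc j) = v (Suc j)"
    "(v \<circ> adj j) i = v i" "(v \<circ> adj j) (Suc i) = v (Suc i)" for v :: "nat \<Rightarrow> nat"
    using assms by (auto simp: transpose_def)
  show ?thesis
    unfolding hecke_op_def v adj_commute[OF assms] by (simp add: algebra_simps)
qed

definition desc :: "nat \<Rightarrow> (nat \<Rightarrow> nat) \<Rightarrow> nat \<Rightarrow> bool" where
  "desc n w i \<longleftrightarrow> 1 \<le> i \<and> i < n \<and> w (Suc i) < w i"

abbreviation R_op :: "nat \<Rightarrow> ((nat \<Rightarrow> nat) \<Rightarrow> int poly) \<Rightarrow> (nat \<Rightarrow> nat) \<Rightarrow> int poly" where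
  "R_op \<equiv> hecke_op [:0, 1:] [:-1, 1:]"

text \<open>The counter stands for the length of \<open>w\<close>, which makes the recursion
  primitive and lets the base case be reached at \<open>w = id\<close>.\<close>

primrec R_rec :: "nat \<Rightarrow> nat \<Rightarrow> (nat \<Rightarrow> nat) \<Rightarrow> (nat \<Rightarrow> nat) \<Rightarrow> int poly" where
  "R_rec n 0 w = (\<lambda>u. of_bool (u = id))"
| "R_rec n (Suc k) w = R_op (LEAST i. desc n w i) (R_rec n k (w \<circ> adj (LEAST i. desc n w i)))"

lemma desc_permutes: "w permutes {1..n} \<Longrightarrow> desc n w i \<Longrightarrow> w \<circ> adj i permutes {1..n}"
  by (intro permutes_comp_adj) (auto simp: desc_def)

lemma inversions_desc:
  "w permutes {1..n} \<Longrightarrow> desc n w i \<Longrightarrow> inversions n w = Suc (inversions n (w \<circ> adj i))"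
  by (intro inversions_swap_desc) (auto simp: desc_def)

definition R_c :: "nat \<Rightarrow> (nat \<Rightarrow> nat) \<Rightarrow> (nat \<Rightarrow> nat) \<Rightarrow> int poly" where
  "R_c n w = R_rec n (inversions n w) w"

text \<open>A diamond argument between \<open>i\<close> and the least descent \<open>i0\<close>. If
  they are far apart, both routes meet after two steps. If they are adjacent, \<open>w\<close>
  decreases on three consecutive positions and both routes meet after three steps. The operators
  agree by commutation or by the braid relation.\<close>

lemma R_c_desc:
  assumes "w permutes {1..n}" "desc n w i" "inj u"
  shows "R_c n w u = R_op i (R_c n (w \<circ> adj i)) u"
  using assms
proof (induction "inversions n w" arbitrary: w i u rule: less_induct)
  case less
  note w = less.prems(1)
  define i0 where "i0 = (LEAST i. desc n w i)"
  have d0: "desc n w i0" unfolding i0_def using less.prems(2) by (rule LeastI)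
  have R0: "R_c n w = R_op i0 (R_c n (w \<circ> adj i0))"
    unfolding R_c_def inversions_desc[OF w d0] by (simp add: i0_def)
  have IH: "R_c n (w \<circ> adj a) u = R_op b (R_c n (w \<circ> adj a \<circ> adj b)) u"
    if "desc n w a" "desc n (w \<circ> adj a) b" "inj u" for a b u
    using that less.hyps[of "w \<circ> adj a" b u] desc_permutes[OF w] inversions_desc[OF w] by simp
  have IH2: "R_c n (w \<circ> adj a \<circ> adj b) u = R_op c (R_c n (w \<circ> adj a \<circ> adj b \<circ> adj c)) u"
    if "desc n w a" "desc n (w \<circ> adj a) b" "desc n (w \<circ> adj a \<circ> adj b) c" "inj u" for a b c u
    using that less.hyps[of "w \<circ> adj a \<circ> adj b" c u] desc_permutes inversions_desc w
    by (metis lessI less_SucI)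
  have far: "R_op a (R_c n (w \<circ> adj a)) u = R_op b (R_c n (w \<circ> adj b)) u"
    if ab: "Suc a < b" and da: "desc n w a" and db: "desc n w b" and u: "inj u" for a b u
  proof -
    have 1: "desc n (w \<circ> adj a) b" "desc n (w \<circ> adj b) a"
      using ab da db by (auto simp: desc_def transpose_def)
    have "R_op a (R_c n (w \<circ> adj a)) u = R_op a (R_op b (R_c n (w \<circ> adj a \<circ> adj b))) u"
      using IH[OF da 1(1)] u by (rule hecke_op_cong)
    also have "\<dots> = R_op b (R_op a (R_c n (w \<circ> adj b \<circ> adj a))) u"
      by (subst hecke_op_commute[OF ab]) (simp only: adj_commute[OF ab])
    also have "\<dots> = R_op b (R_c n (w \<circ> adj b)) u"
      using IH[OF db 1(2), symmetric] u by (rule hecke_op_cong)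
    finally show ?thesis .
  qed
  have near: "R_op a (R_c n (w \<circ> adj a)) u = R_op (Suc a) (R_c n (w \<circ> adj (Suc a))) u"
    if da: "desc n w a" and db: "desc n w (Suc a)" and u: "inj u" for a u
  proof -
    let ?b = "Suc a"
    have 1: "desc n (w \<circ> adj a) ?b" "desc n (w \<circ> adj ?b) a"
      "desc n (w \<circ> adj a \<circ> adj ?b) a" "desc n (w \<circ> adj ?b \<circ> adj a) ?b"
      using da db by (auto simp: desc_def transpose_def)
    have "R_op a (R_c n (w \<circ> adj a)) u = R_op a (R_op ?b (R_c n (w \<circ> adj a \<circ> adj ?b))) u"
      using IH[OF da 1(1)] u by (rule hecke_op_cong)
    also have "\<dots> = R_op a (R_op ?b (R_op a (R_c n (w \<circ> adj a \<circ> adj ?b \<circ> adj a)))) u"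
      by (intro hecke_op_cong[OF _ u] hecke_op_cong IH2 da 1)
    also have "\<dots> = R_op ?b (R_op a (R_op ?b (R_c n (w \<circ> adj ?b \<circ> adj a \<circ> adj ?b)))) u"
      by (simp only: hecke_op_braid[OF u] adj_braid)
    also have "\<dots> = R_op ?b (R_op a (R_c n (w \<circ> adj ?b \<circ> adj a))) u"
      by (intro hecke_op_cong[OF _ u] hecke_op_cong IH2[symmetric] db 1)
    also have "\<dots> = R_op ?b (R_c n (w \<circ> adj ?b)) u"
      using IH[OF db 1(2), symmetric] u by (rule hecke_op_cong)
    finally show ?thesis .
  qed
  consider "i = i0" | "Suc i < i0" | "Suc i0 < i" | "i0 = Suc i" | "i = Suc i0" by linarith
  then show ?case
    by cases (use R0 far near less.prems d0 in \<open>metis+\<close>)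
qed

lemma no_desc_imp_id:
  assumes w: "w permutes {1..n}" and "\<And>i. \<not> desc n w i"
  shows "w = id"
proof
  have asc: "w i < w (Suc i)" if "1 \<le> i" "i < n" for i
    using assms(2)[of i] permutes_neq_Suc[OF w, of i] that by (auto simp: desc_def)
  have rng: "w i \<in> {1..n}" if "i \<in> {1..n}" for i using permutes_in_image[OF w] that by blast
  have ge: "i \<le> w i" if "1 \<le> i" "i \<le> n" for i
    using that
  proof (induction i rule: dec_induct)
    case base
    then show ?case using rng[of 1] by simp
  next
    case (step k)
    then show ?case using asc[of k] by simp
  qed
  have le: "w i \<le> i" if "i \<le> n" "1 \<le> i" for i
    using that
  proof (induction i rule: inc_induct)
    case base
    then show ?case using rng[of n] by simp
  next
    case (step k)
    then show ?case using asc[of k] by simp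
  qed
  fix i show "w i = id i"
    using ge[of i] le[of i] w by (cases "i \<in> {1..n}") (auto simp: permutes_def)
qed

lemma permutes_desc_induct [consumes 1, case_names id desc]:
  assumes "w permutes {1..n}"
    and "P id"
    and "\<And>w i. w permutes {1..n} \<Longrightarrow> desc n w i \<Longrightarrow> w \<circ> adj i permutes {1..n} \<Longrightarrow> P (w \<circ> adj i) \<Longrightarrow> P w"
  shows "P w"
  using assms(1)
proof (induction "inversions n w" arbitrary: w rule: less_induct)
  case less
  show ?case
  proof (cases "\<exists>i. desc n w i")
    case True
    then obtain i where i: "desc n w i" by blast
    with less show ?thesis
      by (intro assms(3)[of w i] less.hyps) (simp_all add: desc_permutes inversions_desc)
  next
    case False
    then show ?thesis using no_desc_imp_id[OF less.prems] assms(2) by simp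
  qed
qed

lemma inversions_id [simp]: "inversions n id = 0"
proof -
  have "{(i, j). 1 \<le> i \<and> i < j \<and> j \<le> n \<and> id j < id i} = {}" by auto
  then show ?thesis unfolding inversions_def by (simp only: card.empty)
qed

lemma bruhat_le_desc_cases:
  assumes "desc n w i" "w permutes {1..n}" "u permutes {1..n}"
  shows "bruhat_le n (u \<circ> adj i) (w \<circ> adj i) \<Longrightarrow> bruhat_le n u w"
    and "bruhat_le n u (w \<circ> adj i) \<Longrightarrow> bruhat_le n u w"
proof -
  note ws = desc_permutes[OF assms(2,1)]
  have "rank_le (w \<circ> adj i) w"
    using rank_le_comp_adj[of i "w \<circ> adj i"] assms(1) by (simp add: desc_def)
  then have le: "bruhat_le n (w \<circ> adj i) w" by (simp add: bruhat_le_iff ws assms del: One_nat_def)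
  then show "bruhat_le n u (w \<circ> adj i) \<Longrightarrow> bruhat_le n u w" by (rule bruhat_le_trans[rotated])
  assume "bruhat_le n (u \<circ> adj i) (w \<circ> adj i)"
  then have "bruhat_le n (u \<circ> adj i) w" using le bruhat_le_trans by blast
  then have "rank_le (u \<circ> adj i \<circ> adj i) w"
    using assms permutes_inj by - (rule rank_le_comp_left, auto simp: bruhat_le_iff desc_def)
  then show "bruhat_le n u w" using assms unfolding comp_adj_adj by (simp add: bruhat_le_iff)
qed

lemma R_c_zero:
  assumes "w permutes {1..n}" "u permutes {1..n}" "\<not> bruhat_le n u w"
  shows "R_c n w u = 0"
  using assms
proof (induction arbitrary: u rule: permutes_desc_induct)
  case id
  then have "u \<noteq> id" using bruhat_le_refl by blast
  then show ?case by (simp add: R_c_def del: id_apply)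
next
  case (desc w i)
  have "u \<circ> adj i permutes {1..n}"
    using desc by (intro permutes_comp_adj) (auto simp: desc_def)
  moreover have IH: "R_c n (w \<circ> adj i) x = 0" if "x permutes {1..n}" "\<not> bruhat_le n x (w \<circ> adj i)" for x
    using that by (rule desc.IH)
  ultimately have "R_c n (w \<circ> adj i) (u \<circ> adj i) = 0" "R_c n (w \<circ> adj i) u = 0"
    using desc.hyps desc.prems bruhat_le_desc_cases[OF desc(2,1) desc.prems(1)] by blast+
  then show ?case using desc.hyps desc.prems permutes_inj[of u] by (simp add: R_c_desc hecke_op_def)
qed

lemma R_c_one: "w permutes {1..n} \<Longrightarrow> R_c n w w = 1"
proof (induction rule: permutes_desc_induct)
  case (desc w i)
  have "R_c n (w \<circ> adj i) (w \<circ> adj i) = 1" by (rule desc.IH)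
  then show ?case using desc.hyps permutes_inj[of w] by (simp add: R_c_desc[of w n i] hecke_op_def desc_def)
qed (simp add: R_c_def del: id_apply)

text \<open>Together with \<open>R_family_unique\<close> this shows that the definite description in
  \<open>R_poly\<close> denotes \<open>R_c\<close>.\<close>

lemma R_family_R_c: "R_family n (\<lambda>u w. R_c n w u)"
  unfolding R_family_def Let_def
  by (auto simp: R_c_zero R_c_one right_descent_iff R_c_desc desc_def hecke_op_def permutes_inj simp del: One_nat_def)

lemma R_family_unique:
  assumes "R_family n R" "R_family n R'" "w permutes {1..n}" "u permutes {1..n}"
  shows "R u w = R' u w"
  using assms(3,4)
proof (induction arbitrary: u rule: permutes_desc_induct)
  case id
  show ?case
  proof (cases "u = id")
    case False
    then have "\<not> bruhat_le n u id" using bruhat_le_inversions(2)[of n u id] by auto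
    then show ?thesis using assms(1,2) id permutes_id[of "{1..n}"] unfolding R_family_def by metis
  next
    case True
    have "R id id = 1" "R' id id = 1"
      using assms(1,2) permutes_id[of "{1..n}"] unfolding R_family_def by blast+
    then show ?thesis using True by metis
  qed
next
  case (desc w i)
  have us: "u \<circ> adj i permutes {1..n}"
    using desc by (intro permutes_comp_adj) (auto simp: desc_def)
  have "right_descent n w i" using desc by (simp add: right_descent_iff desc_def del: One_nat_def)
  then show ?case using assms(1,2) desc(1) desc.prems us desc.IH
    unfolding R_family_def Let_def by metis
qed

lemma R_poly_eq: "w permutes {1..n} \<Longrightarrow> u permutes {1..n} \<Longrightarrow> R_poly n u w = R_c n w u"
  unfolding R_poly_def
  using R_family_R_c R_family_unique by (intro the_equality) blast+

lemma R_poly_unique: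
  "R_family n R \<Longrightarrow> w permutes {1..n} \<Longrightarrow> u permutes {1..n} \<Longrightarrow> R_poly n u w = R u w"
  using R_family_R_c R_family_unique by (metis R_poly_eq)

lemma R_poly_zero: "w permutes {1..n} \<Longrightarrow> u permutes {1..n} \<Longrightarrow> \<not> bruhat_le n u w \<Longrightarrow> R_poly n u w = 0"
  by (simp add: R_poly_eq R_c_zero del: One_nat_def)

lemma R_poly_refl [simp]: "w permutes {1..n} \<Longrightarrow> R_poly n w w = 1"
  by (simp add: R_poly_eq R_c_one del: One_nat_def)

lemma R_poly_desc:
  assumes "w permutes {1..n}" "u permutes {1..n}" "desc n w i"
  shows "R_poly n u w = (if u (Suc i) < u i then R_poly n (u \<circ> adj i) (w \<circ> adj i)
           else [:0, 1:] * R_poly n (u \<circ> adj i) (w \<circ> adj i) + [:-1, 1:] * R_poly n u (w \<circ> adj i))"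
proof -
  have "u \<circ> adj i permutes {1..n}" "w \<circ> adj i permutes {1..n}"
    using assms by (auto intro!: permutes_comp_adj simp: desc_def)
  then show ?thesis
    using assms permutes_inj[OF assms(2)]
    by (simp add: R_poly_eq R_c_desc[OF assms(1,3)] hecke_op_def del: One_nat_def)
qed

text \<open>The mirror image of \<open>hecke_op\<close> under inversion: \<open>adj j\<close> acts
  on values instead of positions.\<close>

definition left_op :: "'a::comm_ring_1 \<Rightarrow> 'a \<Rightarrow> nat \<Rightarrow> ((nat \<Rightarrow> nat) \<Rightarrow> 'a) \<Rightarrow> (nat \<Rightarrow> nat) \<Rightarrow> 'a" where
  "left_op x y j f u =
     (if inv u (Suc j) < inv u j then f (adj j \<circ> u) else x * f (adj j \<circ> u) + y * f u)"

lemma inv_comp_adj: "bij u \<Longrightarrow> inv (u \<circ> adj i) = adj i \<circ> inv u"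
  by (simp add: o_inv_distrib)

lemma inv_adj_comp: "bij u \<Longrightarrow> inv (adj i \<circ> u) = inv u \<circ> adj i"
  by (simp add: o_inv_distrib)

lemma adj_less_iff: "a \<noteq> b \<Longrightarrow> {a, b} \<noteq> {i, Suc i} \<Longrightarrow> adj i a < adj i b \<longleftrightarrow> a < b"
  by (auto simp: transpose_def)

text \<open>Right multiplication by \<open>adj i\<close> is left multiplication by the transposition
  of the values in rows \<open>i\<close> and \<open>Suc i\<close>.\<close>

lemma adj_comp_eq_iff':
  assumes "bij u"
  shows "adj j \<circ> u = u \<circ> adj i \<longleftrightarrow> {u i, u (Suc i)} = {j, Suc j}"
proof -
  have "u \<circ> adj i = transpose (u i) (u (Suc i)) \<circ> u"
    using bij_is_inj[OF assms] by (auto simp: fun_eq_iff transpose_def inj_eq)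
  then have "adj j \<circ> u = u \<circ> adj i \<longleftrightarrow> adj j = transpose (u i) (u (Suc i))"
    using bij_is_surj[OF assms] by (metis surj_fun_eq)
  also have "\<dots> \<longleftrightarrow> {u i, u (Suc i)} = {j, Suc j}"
  proof
    assume *: "adj j = transpose (u i) (u (Suc i))"
    have "adj j j \<noteq> j" "adj j (Suc j) \<noteq> Suc j" by auto
    then show "{u i, u (Suc i)} = {j, Suc j}" unfolding *
      by (auto simp: transpose_def split: if_splits)
  next
    assume "{u i, u (Suc i)} = {j, Suc j}"
    then show "adj j = transpose (u i) (u (Suc i))"
      by (auto simp: doubleton_eq_iff transpose_commute)
  qed
  finally show ?thesis .
qed

lemma adj_comp_eq_iff:
  assumes "bij u"
  shows "adj j \<circ> u = u \<circ> adj i \<longleftrightarrow> {inv u j, inv u (Suc j)} = {i, Suc i}"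
proof -
  have "inv u a = b \<longleftrightarrow> u b = a" for a b
    using assms by (metis bij_inv_eq_iff)
  then show ?thesis unfolding adj_comp_eq_iff'[OF assms] doubleton_eq_iff by blast
qed

text \<open>If \<open>adj j \<circ> u = u \<circ> adj i\<close>, both operators involve only
  \<open>u\<close> and this one element and act alike on them. Otherwise neither multiplication
  affects the comparison made by the other operator, so both sides expand to the same terms.\<close>

lemma hecke_op_left_op_commute:
  assumes "bij u"
  shows "hecke_op x y i (left_op x y j f) u = left_op x y j (hecke_op x y i f) u"
proof -
  have e: "inv u (u k) = k" "u (inv u k) = k" for k
    using assms by (simp_all add: bij_is_inj bij_is_surj surj_f_inv_f)
  note i1 = inv_comp_adj[OF assms, of i] and i2 = inv_adj_comp[OF assms, of j]
  have ne: "inv u j \<noteq> inv u (Suc j)" "u i \<noteq> u (Suc i)" by (metis e n_not_Suc_n)+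
  show ?thesis
  proof (cases "adj j \<circ> u = u \<circ> adj i")
    case True
    then have "{inv u j, inv u (Suc j)} = {i, Suc i}" using adj_comp_eq_iff[OF assms] by blast
    then consider "inv u j = i" "inv u (Suc j) = Suc i" "u i = j" "u (Suc i) = Suc j"
      | "inv u j = Suc i" "inv u (Suc j) = i" "u i = Suc j" "u (Suc i) = j"
      by (auto simp: doubleton_eq_iff) (metis e)+
    moreover have "adj j \<circ> (u \<circ> adj i) = u" "u \<circ> adj i \<circ> adj i = u"
      using True by (metis comp_assoc comp_adj_adj)+
    ultimately show ?thesis
      by cases (simp_all add: hecke_op_def left_op_def True i1 algebra_simps)
  next
    case False
    then have ne2: "{inv u j, inv u (Suc j)} \<noteq> {i, Suc i}" using adj_comp_eq_iff[OF assms] by blast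
    have "{u i, u (Suc i)} \<noteq> {j, Suc j}"
      using False adj_comp_eq_iff'[OF assms] by blast
    then have 1: "adj j (u (Suc i)) < adj j (u i) \<longleftrightarrow> u (Suc i) < u i"
      using ne \<open>{u i, u (Suc i)} \<noteq> {j, Suc j}\<close> by (intro adj_less_iff) (simp_all add: insert_commute)
    have 2: "adj i (inv u (Suc j)) < adj i (inv u j) \<longleftrightarrow> inv u (Suc j) < inv u j"
      using ne ne2 by (intro adj_less_iff) (simp_all add: insert_commute)
    show ?thesis
      unfolding hecke_op_def left_op_def i1 comp_apply 1 2
      by (simp add: comp_assoc algebra_simps)
  qed
qed

lemma R_poly_hecke_op:
  "w permutes {1..n} \<Longrightarrow> u permutes {1..n} \<Longrightarrow> desc n w i \<Longrightarrow>
    R_poly n u w = R_op i (\<lambda>x. R_poly n x (w \<circ> adj i)) u"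
  unfolding hecke_op_def by (rule R_poly_desc)

lemma R_poly_id: "u permutes {1..n} \<Longrightarrow> R_poly n u id = of_bool (u = id)"
  by (simp add: R_poly_eq permutes_id R_c_def del: id_apply)

lemma adj_comp_permutes: "w permutes {1..n} \<Longrightarrow> 1 \<le> i \<Longrightarrow> i < n \<Longrightarrow> adj i \<circ> w permutes {1..n}"
  by (intro permutes_compose adj_permutes)

lemma inversions_adj_comp_le:
  assumes "w permutes {1..n}" "1 \<le> j" "j < n"
  shows "inversions n (adj j \<circ> w) \<le> Suc (inversions n w)"
proof -
  have iw: "inv w permutes {1..n}" by (rule permutes_inv[OF assms(1)])
  have "adj j \<circ> w permutes {1..n}" using assms by (intro adj_comp_permutes)
  then have "inversions n (adj j \<circ> w) = inversions n (inv w \<circ> adj j)"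
    using inversions_inv[of "adj j \<circ> w" n] inv_adj_comp[OF permutes_bij[OF assms(1)]] by simp
  also have "\<dots> \<le> Suc (inversions n (inv w))"
    using inversions_swap[OF assms(2,3) iw] inversions_swap_desc[OF assms(2,3) iw] permutes_neq_Suc[OF iw, of j]
    by linarith
  finally show ?thesis by (simp add: inversions_inv assms)
qed

text \<open>Left and right operators commute, so the left recursion follows by induction from the right
  one unless \<open>s\<^sub>j w = w s\<^sub>i\<close> for all right descents \<open>i\<close> of \<open>w\<close>, which forces \<open>w\<close> to be a
  simple transposition.\<close>

lemma R_poly_left_desc:
  assumes "w permutes {1..n}" "u permutes {1..n}" "desc n (inv w) j"
  shows "R_poly n u w = left_op [:0, 1:] [:-1, 1:] j (\<lambda>x. R_poly n x (adj j \<circ> w)) u"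
  using assms
proof (induction "inversions n w" arbitrary: w u rule: less_induct)
  case less
  note w = less.prems(1) and u = less.prems(2) and dj = less.prems(3)
  have j: "1 \<le> j" "j < n" using dj by (auto simp: desc_def)
  have bw: "bij w" and bu: "bij u" using permutes_bij w u by blast+
  have tw: "adj j \<circ> w permutes {1..n}" using j w by (intro adj_comp_permutes)
  have tu: "adj j \<circ> u permutes {1..n}" using j u by (intro adj_comp_permutes)
  have wne: "w \<noteq> id" using dj by (auto simp: desc_def)
  show ?case
  proof (cases "\<exists>i. desc n w i \<and> adj j \<circ> w \<noteq> w \<circ> adj i")
    case True
    then obtain i where i: "desc n w i" "adj j \<circ> w \<noteq> w \<circ> adj i" by blast
    then have i1: "1 \<le> i" "i < n" by (auto simp: desc_def)
    have ws: "w \<circ> adj i permutes {1..n}" using desc_permutes w i by blast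
    have us: "u \<circ> adj i permutes {1..n}" using i1 u by (intro permutes_comp_adj)
    have ne2: "{inv w j, inv w (Suc j)} \<noteq> {i, Suc i}" using i(2) adj_comp_eq_iff[OF bw] by blast
    have e: "inv w (w k) = k" "w (inv w k) = k" for k
      using permutes_inverses[OF w] by auto
    have ne: "inv w j \<noteq> inv w (Suc j)" "w i \<noteq> w (Suc i)" by (metis e n_not_Suc_n)+
    have "{w (Suc i), w i} \<noteq> {j, Suc j}"
      using i(2) adj_comp_eq_iff'[OF bw] by (simp add: insert_commute)
    then have d1: "desc n (adj j \<circ> w) i"
      using i(1) ne(2)[symmetric] adj_less_iff[of "w (Suc i)" "w i" j] by (simp add: desc_def)
    have d2: "desc n (inv (w \<circ> adj i)) j"
      using dj ne(1)[symmetric] ne2 adj_less_iff[of "inv w (Suc j)" "inv w j" i]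
      by (simp add: desc_def inv_comp_adj[OF bw] insert_commute[of "inv w (Suc j)"])
    have IH: "R_poly n x (w \<circ> adj i) = left_op [:0, 1:] [:-1, 1:] j (\<lambda>x. R_poly n x (adj j \<circ> (w \<circ> adj i))) x"
      if "x permutes {1..n}" for x
      using that ws d2 inversions_desc[OF w i(1)] by (intro less.hyps) auto
    have IH2: "R_poly n x (adj j \<circ> w) = R_op i (\<lambda>x. R_poly n x (adj j \<circ> w \<circ> adj i)) x"
      if "x permutes {1..n}" for x
      using that tw d1 by (intro R_poly_hecke_op)
    have "R_poly n u w = R_op i (\<lambda>x. R_poly n x (w \<circ> adj i)) u"
      using w u i by (intro R_poly_hecke_op)
    also have "\<dots> = R_op i (left_op [:0, 1:] [:-1, 1:] j (\<lambda>x. R_poly n x (adj j \<circ> (w \<circ> adj i)))) u"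
      unfolding hecke_op_def using IH[OF u] IH[OF us] by simp
    also have "\<dots> = left_op [:0, 1:] [:-1, 1:] j (R_op i (\<lambda>x. R_poly n x (adj j \<circ> (w \<circ> adj i)))) u"
      by (rule hecke_op_left_op_commute[OF bu])
    also have "\<dots> = left_op [:0, 1:] [:-1, 1:] j (\<lambda>x. R_poly n x (adj j \<circ> w)) u"
      unfolding left_op_def using IH2[OF u] IH2[OF tu] by (simp add: comp_assoc)
    finally show ?thesis .
  next
    case False
    then have all: "adj j \<circ> w = w \<circ> adj i" if "desc n w i" for i using that by blast
    obtain i where i: "desc n w i" using no_desc_imp_id[OF w] wne by blast
    then have i1: "1 \<le> i" "i < n" by (auto simp: desc_def)
    define x where "x = w \<circ> adj i"
    have x: "x permutes {1..n}" unfolding x_def using desc_permutes w i by blast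
    have wx: "w = x \<circ> adj i" by (simp add: x_def)
    have xi: "adj j \<circ> x = w" using all[OF i] unfolding x_def by (metis comp_assoc comp_adj_adj)
    \<comment> \<open>A further descent \<open>i'\<close> of \<open>x\<close> gives \<open>y\<close>
      two steps below \<open>w\<close>. Then \<open>w \<circ> adj i' = adj j \<circ> y\<close> is
      shorter than \<open>w\<close>, so \<open>i'\<close> is a descent of \<open>w\<close> as well,
      and \<open>adj j \<circ> w\<close> would equal both \<open>w \<circ> adj i\<close> and
      \<open>w \<circ> adj i'\<close>.\<close>
    have "x = id"
    proof (rule ccontr)
      assume "x \<noteq> id"
      then obtain i' where i': "desc n x i'" using no_desc_imp_id[OF x] by blast
      then have i'1: "1 \<le> i'" "i' < n" by (auto simp: desc_def)
      have "i' \<noteq> i" using i i' by (auto simp: desc_def x_def)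
      define y where "y = x \<circ> adj i'"
      have y: "y permutes {1..n}" unfolding y_def using desc_permutes x i' by blast
      have "adj j \<circ> y = w \<circ> adj i'" unfolding y_def using xi by (simp add: comp_assoc[symmetric])
      then have "inversions n (w \<circ> adj i') \<le> Suc (inversions n y)"
        using inversions_adj_comp_le[OF y j] by simp
      moreover have "inversions n w = Suc (Suc (inversions n y))"
        unfolding y_def using inversions_desc[OF w i] inversions_desc[OF x i'] by (simp add: x_def)
      ultimately have "inversions n (w \<circ> adj i') < inversions n w" by simp
      then have "right_descent n w i'" using i'1 by (simp add: right_descent_def)
      then have "desc n w i'" using w by (simp add: right_descent_iff desc_def)
      then have "w \<circ> adj i = w \<circ> adj i'" using all[OF i] all by simp
      then have "adj i i = adj i' i" "adj i i' = adj i' i'"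
        using permutes_inj[OF w] by (metis comp_apply injD)+
      then show False using \<open>i' \<noteq> i\<close> by (auto simp: transpose_def split: if_splits)
    qed
    then have ij: "w = adj i" "adj j = adj i" using wx xi by auto
    then have "j = i" by (metis Suc_n_not_le_n nat_le_linear transpose_apply_first transpose_apply_second transpose_eq_iff)
    have tw_id: "adj j \<circ> w = id" using ij by simp
    have f: "R_poly n y id = of_bool (y = id)" if "y permutes {1..n}" for y
      using R_poly_id that .
    have us: "u \<circ> adj i permutes {1..n}" using i1 u by (intro permutes_comp_adj)
    have "R_poly n u w = R_op i (\<lambda>x. R_poly n x id) u"
      using R_poly_hecke_op[OF w u i] \<open>x = id\<close> by (simp add: x_def)
    also have "\<dots> = left_op [:0, 1:] [:-1, 1:] j (\<lambda>x. R_poly n x id) u"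
    proof -
      have 1: "u \<circ> adj i = id \<longleftrightarrow> u = adj i" "adj i \<circ> u = id \<longleftrightarrow> u = adj i"
        by (metis comp_adj_adj id_comp transpose_comp_involutory comp_assoc comp_id)+
      have fs: "R_poly n (u \<circ> adj i) id = of_bool (u = adj i)"
          "R_poly n (adj i \<circ> u) id = of_bool (u = adj i)" "R_poly n u id = of_bool (u = id)"
        using f[OF us] f[OF tu] f[OF u] 1 \<open>j = i\<close> by simp_all
      have "inv id = id" "inv (adj i) = adj i" by (intro inv_unique_comp; simp)+
      then consider "inv u = u" | "u \<noteq> id" "u \<noteq> adj i" by blast
      then show ?thesis
        unfolding hecke_op_def left_op_def fs \<open>j = i\<close>
        by cases simp_all
    qed
    finally show ?thesis unfolding tw_id .
  qed
qed

text \<open>The left recursion says that the inverted family satisfies the right recursion, so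
  uniqueness applies.\<close>

lemma R_poly_inv:
  assumes "u permutes {1..n}" "w permutes {1..n}"
  shows "R_poly n (inv u) (inv w) = R_poly n u w"
proof -
  have "R_family n (\<lambda>u w. R_poly n (inv u) (inv w))"
    unfolding R_family_def Let_def
  proof (intro allI impI conjI)
    fix u w assume u: "u permutes {1..n}" and w: "w permutes {1..n}"
    note iu = permutes_inv[OF u] and iw = permutes_inv[OF w]
    note ii = permutes_inv_inv[OF u] permutes_inv_inv[OF w]
    {
      assume "\<not> bruhat_le n u w"
      then have "\<not> bruhat_le n (inv u) (inv w)" using bruhat_le_inv ii by metis
      then show "R_poly n (inv u) (inv w) = 0" using R_poly_zero iu iw by blast
    next
      assume "u = w"
      then show "R_poly n (inv u) (inv w) = 1" using iw by simp
    next
      fix i assume "right_descent n w i"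
      then have d: "desc n w i" using w by (simp add: right_descent_iff desc_def)
      then have "right_descent n u i \<longleftrightarrow> u (Suc i) < u i"
        using u by (auto simp: right_descent_iff desc_def)
      then show "R_poly n (inv u) (inv w) = (if right_descent n u i then R_poly n (inv (u \<circ> adj i)) (inv (w \<circ> adj i))
            else [:0, 1:] * R_poly n (inv (u \<circ> adj i)) (inv (w \<circ> adj i)) + [:- 1, 1:] * R_poly n (inv u) (inv (w \<circ> adj i)))"
        using R_poly_left_desc[OF iw iu, of i] d
        unfolding ii left_op_def inv_comp_adj[OF permutes_bij[OF u]] inv_comp_adj[OF permutes_bij[OF w]] by simp
    }
  qed
  from R_poly_unique[OF this assms(2,1)] show ?thesis by simp
qed

section \<open>The bar involution on polynomials\<close>

text \<open>\<open>rv d p\<close> is \<open>q^d p(1/q)\<close> if \<open>degree p \<le> d\<close>.\<close>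

definition rv :: "nat \<Rightarrow> 'a::comm_ring_1 poly \<Rightarrow> 'a poly" where
  "rv d p = (\<Sum>k\<le>d. monom (coeff p (d - k)) k)"

lemma coeff_rv: "coeff (rv d p) k = (if k \<le> d then coeff p (d - k) else 0)"
  by (simp add: rv_def coeff_sum)

lemma rv_0 [simp]: "rv d 0 = 0"
  by (simp add: rv_def)

lemma rv_add: "rv d (p + q) = rv d p + rv d q"
  by (simp add: poly_eq_iff coeff_rv)

lemma rv_diff: "rv d (p - q) = rv d p - rv d q"
  by (simp add: poly_eq_iff coeff_rv)

lemma rv_sum: "rv d (sum f A) = (\<Sum>x\<in>A. rv d (f x))"
  by (simp add: poly_eq_iff coeff_rv coeff_sum)

lemma rv_reflect: "degree p \<le> d \<Longrightarrow> rv d p = monom 1 (d - degree p) * reflect_poly p"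
  by (auto simp: poly_eq_iff coeff_rv coeff_monom_mult coeff_reflect_poly coeff_eq_0 intro!: arg_cong[of _ _ "coeff p"])

lemma rv_mult:
  fixes p q :: "'a::idom poly"
  assumes "degree p \<le> d" "degree q \<le> e"
  shows "rv (d + e) (p * q) = rv d p * rv e q"
proof (cases "p = 0 \<or> q = 0")
  case False
  then have "degree (p * q) = degree p + degree q" by (simp add: degree_mult_eq)
  moreover from this have "rv (d + e) (p * q) = monom 1 (d + e - degree (p * q)) * reflect_poly (p * q)"
    using assms by (intro rv_reflect) auto
  moreover have "d + e - (degree p + degree q) = (d - degree p) + (e - degree q)" using assms by simp
  ultimately show ?thesis
    using rv_reflect[OF assms(1)] rv_reflect[OF assms(2)]
    by (simp add: reflect_poly_mult mult_monom[symmetric] algebra_simps)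
       (metis mult_monom mult_1 mult.left_commute mult.assoc)
qed auto


abbreviation qX :: "int poly" where "qX \<equiv> [:0, 1:]"

lemma rv_R_poly:
  assumes "w permutes {1..n}" "u permutes {1..n}" "d + inversions n u = inversions n w"
  shows "degree (R_poly n u w) \<le> d \<and> rv d (R_poly n u w) = (-1) ^ d * R_poly n u w"
  using assms
proof (induction arbitrary: u d rule: permutes_desc_induct)
  case id
  then show ?case by (auto simp: R_poly_id rv_def simp del: id_apply)
next
  case (desc w i u D)
  note w = desc.hyps(1) and d = desc.hyps(2) and ws = desc.hyps(3) and u = desc.prems(1)
  have IH: "degree (R_poly n u (w \<circ> adj i)) \<le> d \<and>
      rv d (R_poly n u (w \<circ> adj i)) = (-1) ^ d * R_poly n u (w \<circ> adj i)"
    if "u permutes {1..n}" "d + inversions n u = inversions n (w \<circ> adj i)" for u d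
    using that by (rule desc.IH)
  have i: "1 \<le> i" "i < n" using d by (auto simp: desc_def)
  have us: "u \<circ> adj i permutes {1..n}" using i u by (intro permutes_comp_adj)
  have lw: "inversions n w = Suc (inversions n (w \<circ> adj i))" using inversions_desc w d by blast
  have zero: "R_poly n x y = 0" if "x permutes {1..n}" "y permutes {1..n}" "inversions n y < inversions n x" for x y
    using R_poly_zero[OF that(2,1)] bruhat_le_inversions(1)[of n x y] that(3) by linarith
  show ?case
  proof (cases "u (Suc i) < u i")
    case True
    then have "inversions n u = Suc (inversions n (u \<circ> adj i))"
      using i u by (intro inversions_swap_desc)
    then show ?thesis
      using R_poly_desc[OF w u d] True IH[OF us, of D] lw desc.prems(2) by auto
  next
    case False
    then have "u i < u (Suc i)" using permutes_neq_Suc[OF u, of i] by simp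
    then have lu: "inversions n (u \<circ> adj i) = Suc (inversions n u)"
      using i u by (intro inversions_swap)
    define p where "p = R_poly n (u \<circ> adj i) (w \<circ> adj i)"
    define r where "r = R_poly n u (w \<circ> adj i)"
    have R: "R_poly n u w = [:0, 1:] * p + [:-1, 1:] * r"
      using R_poly_desc[OF w u d] False by (simp add: p_def r_def)
    \<comment> \<open>The term \<open>p\<close> belongs to a pair with length difference
      \<open>D - 2\<close> and \<open>r\<close> to one with difference \<open>D - 1\<close>. So
      \<open>qX\<close> is reversed at degree 2, where it is fixed, and \<open>[:-1, 1:]\<close> at
      degree 1, where it changes sign.\<close>
    have rv1: "rv 1 [:-1, 1:] = - [:-1, 1 :: int:]" "rv 2 qX = qX"
      by (auto simp: rv_def monom_altdef numeral_2_eq_2 power2_eq_square One_nat_def)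
    \<comment> \<open>The small cases are separate because \<open>D - 2\<close> would be negative:
      for \<open>D = 1\<close> the term \<open>p\<close> vanishes, and for \<open>D = 0\<close> the
      whole polynomial does.\<close>
    consider "D = 0" | "D = 1" | e where "D = Suc (Suc e)" by (metis One_nat_def not0_implies_Suc)
    then show ?thesis
    proof cases
      case 1
      then have "u \<noteq> w" "inversions n u = inversions n w" using False d desc.prems(2) by (auto simp: desc_def)
      then have "R_poly n u w = 0" using R_poly_zero[OF w u] bruhat_le_inversions(2) by fastforce
      then show ?thesis by simp
    next
      case 2
      then have "p = 0" unfolding p_def using us ws lu lw desc.prems(2) by (intro zero) auto
      moreover have "degree r \<le> 0" "rv 0 r = r" using IH[OF u, of 0] lw desc.prems(2) 2 by (auto simp: r_def)
      moreover have "rv (1 + 0) ([:-1, 1:] * r) = rv 1 [:-1, 1:] * rv 0 r"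
        using \<open>degree r \<le> 0\<close> by (intro rv_mult) auto
      ultimately show ?thesis unfolding R 2 rv1
        using degree_mult_le[of "[:-1, 1:]" r] by simp
    next
      case 3
      define X Y :: "int poly" where "X = [:0, 1:]" and "Y = [:-1, 1:]"
      have p: "degree p \<le> e" "rv e p = (-1) ^ e * p"
        using IH[OF us, of e] lu lw desc.prems(2) 3 by (auto simp: p_def)
      have r: "degree r \<le> Suc e" "rv (Suc e) r = (-1) ^ Suc e * r"
        using IH[OF u, of "Suc e"] lu lw desc.prems(2) 3 by (auto simp: r_def)
      have "rv (2 + e) ([:0, 1:] * p) = rv 2 [:0, 1:] * rv e p"
        using p by (intro rv_mult) auto
      then have A: "rv D ([:0, 1:] * p) = [:0, 1:] * ((-1) ^ e * p)"
        by (simp add: 3 rv1 p del: mult_pCons_left)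
      have "rv (1 + Suc e) ([:-1, 1:] * r) = rv 1 [:-1, 1:] * rv (Suc e) r"
        using r by (intro rv_mult) auto
      then have B: "rv D ([:-1, 1:] * r) = - [:-1, 1:] * ((-1) ^ Suc e * r)"
        unfolding rv1 r(2) by (simp add: 3 One_nat_def del: mult_pCons_left)
      have "rv D (R_poly n u w) = (-1) ^ D * R_poly n u w"
        unfolding R rv_add A B unfolding X_def[symmetric] Y_def[symmetric] by (simp add: 3 algebra_simps)
      moreover have "degree ([:0, 1:] * p) \<le> D" "degree ([:-1, 1:] * r) \<le> D"
        using degree_mult_le[of "[:0, 1:]" p] degree_mult_le[of "[:-1, 1:]" r] p r 3 by auto
      ultimately show ?thesis unfolding R by (intro conjI degree_add_le)
    qed
  qed
qed


section \<open>Sums of R-polynomials over the symmetric group\<close>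

lemma finite_perms: "finite {a. a permutes {1..n::nat}}"
  by (rule finite_permutations) simp

text \<open>Each coset of \<open>adj i\<close> is represented by its shorter element. The recursions
  mix only the two members of a coset, so later identities are checked coset by coset.\<close>

lemma sum_perms_pairs:
  fixes g :: "(nat \<Rightarrow> nat) \<Rightarrow> 'a::comm_monoid_add"
  assumes "1 \<le> i" "i < n"
  shows "sum g {a. a permutes {1..n}} =
    (\<Sum>a | a permutes {1..n} \<and> a i < a (Suc i). g a + g (a \<circ> adj i))"
proof -
  let ?A = "{a. a permutes {1..n} \<and> a i < a (Suc i)}" and ?B = "{a. a permutes {1..n} \<and> a (Suc i) < a i}"
  have "{a. a permutes {1..n}} = ?A \<union> ?B"
  proof -
    have "a i < a (Suc i) \<or> a (Suc i) < a i" if "a permutes {1..n}" for a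
      using permutes_neq_Suc[OF that, of i] by linarith
    then show ?thesis by blast
  qed
  moreover have "finite ?A" "finite ?B" using finite_perms[of n] by (auto intro: finite_subset)
  moreover have "?A \<inter> ?B = {}" by auto
  ultimately have "sum g {a. a permutes {1..n}} = sum g ?A + sum g ?B"
    by (metis (no_types, lifting) sum.union_disjoint)
  also have "sum g ?B = (\<Sum>a\<in>?A. g (a \<circ> adj i))"
    by (rule sum.reindex_bij_witness[of _ "\<lambda>a. a \<circ> adj i" "\<lambda>a. a \<circ> adj i"])
      (use assms in \<open>auto simp: comp_assoc permutes_comp_adj simp del: comp_apply, auto simp: comp_assoc permutes_comp_adj\<close>)
  finally show ?thesis by (simp add: sum.distrib)
qed

lemma R_poly_asc_comp:
  assumes "u permutes {1..n}" "a permutes {1..n}" "1 \<le> i" "i < n" "a i < a (Suc i)"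
  shows "R_poly n u (a \<circ> adj i) = (if u (Suc i) < u i then R_poly n (u \<circ> adj i) a
           else [:0, 1:] * R_poly n (u \<circ> adj i) a + [:-1, 1:] * R_poly n u a)"
  using R_poly_desc[of "a \<circ> adj i" n u i] assms permutes_comp_adj[of a n i]
  by (simp add: desc_def)

text \<open>Let f be the column of \<open>w \<circ> adj i\<close>, s = \<open>adj i\<close>, and a
  the shorter element of a coset. The recursion gives (q f(as) + (q - 1) f(a)) + f(a) = q (f(a) +
  f(as)).\<close>

lemma R_poly_column_sum:
  assumes "w permutes {1..n}"
  shows "(\<Sum>u | u permutes {1..n}. R_poly n u w) = qX ^ inversions n w"
  using assms
proof (induction rule: permutes_desc_induct)
  case id
  have "(\<Sum>u | u permutes {1..n}. R_poly n u id) = (\<Sum>u | u permutes {1..n}. of_bool (u = id))"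
    by (intro sum.cong) (auto simp: R_poly_id simp del: id_apply)
  also have "\<dots> = 1" using finite_perms[of n] permutes_id[of "{1..n}"] by (simp add: of_bool_def del: id_apply)
  finally show ?case by (simp del: id_apply)
next
  case (desc w i)
  have i: "1 \<le> i" "i < n" using desc by (auto simp: desc_def)
  have IH: "(\<Sum>u | u permutes {1..n}. R_poly n u (w \<circ> adj i)) = qX ^ inversions n (w \<circ> adj i)"
    by (rule desc.IH)
  have "(\<Sum>u | u permutes {1..n}. R_poly n u w) =
      (\<Sum>a | a permutes {1..n} \<and> a i < a (Suc i). R_poly n a w + R_poly n (a \<circ> adj i) w)"
    by (rule sum_perms_pairs[OF i])
  also have "\<dots> = (\<Sum>a | a permutes {1..n} \<and> a i < a (Suc i).
      qX * (R_poly n a (w \<circ> adj i) + R_poly n (a \<circ> adj i) (w \<circ> adj i)))"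
    using desc.hyps i
    by (intro sum.cong) (auto simp: R_poly_desc[where i = i] permutes_comp_adj algebra_simps)
  also have "\<dots> = qX * (\<Sum>u | u permutes {1..n}. R_poly n u (w \<circ> adj i))"
    unfolding sum_distrib_left[symmetric] by (simp only: sum_perms_pairs[OF i])
  also have "\<dots> = qX ^ inversions n w"
    unfolding IH inversions_desc[OF desc.hyps(1,2)] by simp
  finally show ?case .
qed

text \<open>Up to signs, the matrix of the R-polynomials is its own inverse. On each coset of
  \<open>adj i\<close> the recursion in \<open>w\<close> can be traded for the recursion in
  \<open>u\<close>, which expresses the sum through the sums \<open>G\<close> at \<open>u\<close>
  and \<open>u \<circ> adj i\<close> for the shorter \<open>w \<circ> adj i\<close>.\<close>

lemma R_poly_orthogonal:
  assumes "w permutes {1..n}" "u permutes {1..n}"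
  shows "(\<Sum>a | a permutes {1..n}. (-1) ^ inversions n a * R_poly n u a * R_poly n a w) =
         (if u = w then (-1) ^ inversions n w else 0)"
  using assms
proof (induction arbitrary: u rule: permutes_desc_induct)
  case id
  have "(\<Sum>a | a permutes {1..n}. (-1) ^ inversions n a * R_poly n u a * R_poly n a id) =
        (\<Sum>a | a permutes {1..n}. if a = id then R_poly n u id else 0)"
    by (intro sum.cong) (auto simp: R_poly_id simp del: id_apply)
  also have "\<dots> = R_poly n u id" using finite_perms[of n] permutes_id[of "{1..n}"] by (simp del: id_apply)
  finally show ?case using id by (simp add: R_poly_id del: id_apply)
next
  case (desc w i)
  note w = desc.hyps(1) and u = desc.prems(1)
  have i: "1 \<le> i" "i < n" using desc.hyps(2) by (auto simp: desc_def)
  have us: "u \<circ> adj i permutes {1..n}" using i u by (intro permutes_comp_adj)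
  define f where "f a = R_poly n a (w \<circ> adj i)" for a
  define G where "G u = (\<Sum>a | a permutes {1..n}. (-1) ^ inversions n a * R_poly n u a * f a)" for u
  have IH: "G u = (if u = w \<circ> adj i then (-1) ^ inversions n (w \<circ> adj i) else 0)"
    if "u permutes {1..n}" for u
    unfolding G_def f_def using that by (rule desc.IH)
  let ?P = "{a. a permutes {1..n} \<and> a i < a (Suc i)}"
  have Gp: "G u = (\<Sum>a\<in>?P. (-1) ^ inversions n a * (R_poly n u a * f a - R_poly n u (a \<circ> adj i) * f (a \<circ> adj i)))" for u
    unfolding G_def sum_perms_pairs[OF i]
    by (intro sum.cong) (auto simp: inversions_swap[OF i] algebra_simps)
  define Y :: "int poly" where "Y = [:-1, 1:]"
  define X :: "int poly" where "X = qX"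
  have "(\<Sum>a | a permutes {1..n}. (-1) ^ inversions n a * R_poly n u a * R_poly n a w) =
      (\<Sum>a\<in>?P. (-1) ^ inversions n a * (R_poly n u a * R_poly n a w - R_poly n u (a \<circ> adj i) * R_poly n (a \<circ> adj i) w))"
    unfolding sum_perms_pairs[OF i]
    by (intro sum.cong) (auto simp: inversions_swap[OF i] algebra_simps)
  also have "\<dots> = (\<Sum>a\<in>?P. (-1) ^ inversions n a *
      (R_poly n u a * (X * f (a \<circ> adj i) + Y * f a) - R_poly n u (a \<circ> adj i) * f a))"
  proof (intro sum.cong refl)
    fix a assume "a \<in> ?P"
    then have a: "a permutes {1..n}" "\<not> a (Suc i) < a i" "a \<circ> adj i permutes {1..n}" "a i < a (Suc i)"
      using i by (auto intro: permutes_comp_adj)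
    have "R_poly n a w = X * f (a \<circ> adj i) + Y * f a"
      using R_poly_desc[OF w a(1) desc.hyps(2)] a by (simp add: f_def X_def Y_def del: mult_pCons_left)
    moreover have "R_poly n (a \<circ> adj i) w = f a"
      using R_poly_desc[OF w a(3) desc.hyps(2)] a by (simp add: f_def)
    ultimately show "(-1) ^ inversions n a * (R_poly n u a * R_poly n a w - R_poly n u (a \<circ> adj i) * R_poly n (a \<circ> adj i) w) =
      (-1) ^ inversions n a *
      (R_poly n u a * (X * f (a \<circ> adj i) + Y * f a) - R_poly n u (a \<circ> adj i) * f a)" by simp
  qed
  also have "\<dots> = (if u (Suc i) < u i then Y * G u - G (u \<circ> adj i) else - X * G (u \<circ> adj i))"
  proof (cases "u (Suc i) < u i")
    case True
    have "Y * G u - G (u \<circ> adj i) = (\<Sum>a\<in>?P. (-1) ^ inversions n a *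
      (Y * (R_poly n u a * f a - R_poly n u (a \<circ> adj i) * f (a \<circ> adj i)) -
       (R_poly n (u \<circ> adj i) a * f a - R_poly n (u \<circ> adj i) (a \<circ> adj i) * f (a \<circ> adj i))))"
      unfolding Gp sum_distrib_left sum_subtractf[symmetric] by (intro sum.cong) (auto simp: algebra_simps)
    also have "\<dots> = (\<Sum>a\<in>?P. (-1) ^ inversions n a *
      (R_poly n u a * (X * f (a \<circ> adj i) + Y * f a) - R_poly n u (a \<circ> adj i) * f a))"
      using True i
      by (intro sum.cong refl)
        (auto simp: R_poly_asc_comp[OF u] R_poly_asc_comp[OF us] X_def[symmetric] Y_def[symmetric] simp del: mult_pCons_left, simp add: algebra_simps)
    finally show ?thesis using True by simp
  next
    case False
    have "- X * G (u \<circ> adj i) = (\<Sum>a\<in>?P. (-1) ^ inversions n a *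
      (- X * (R_poly n (u \<circ> adj i) a * f a - R_poly n (u \<circ> adj i) (a \<circ> adj i) * f (a \<circ> adj i))))"
      unfolding Gp sum_distrib_left by (intro sum.cong) (auto simp: algebra_simps)
    also have "\<dots> = (\<Sum>a\<in>?P. (-1) ^ inversions n a *
      (R_poly n u a * (X * f (a \<circ> adj i) + Y * f a) - R_poly n u (a \<circ> adj i) * f a))"
    proof (intro sum.cong refl)
      fix a assume "a \<in> ?P"
      moreover have "u i < u (Suc i)" using False permutes_neq_Suc[OF u, of i] by simp
      ultimately show "(-1) ^ inversions n a *
      (- X * (R_poly n (u \<circ> adj i) a * f a - R_poly n (u \<circ> adj i) (a \<circ> adj i) * f (a \<circ> adj i))) =
        (-1) ^ inversions n a *
      (R_poly n u a * (X * f (a \<circ> adj i) + Y * f a) - R_poly n u (a \<circ> adj i) * f a)"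
        using False i
        by (auto simp: R_poly_asc_comp[OF u] R_poly_asc_comp[OF us] X_def[symmetric] Y_def[symmetric] simp del: mult_pCons_left, simp add: algebra_simps)
    qed
    finally show ?thesis using False by simp
  qed
  \<comment> \<open>Since \<open>w\<close> has a descent at \<open>i\<close> and
    \<open>w \<circ> adj i\<close> an ascent, only \<open>G (u \<circ> adj i)\<close> with
    \<open>u = w\<close> can survive; its sign changes with the length.\<close>
  also have "\<dots> = (if u = w then (-1) ^ inversions n w else 0)"
  proof -
    have "w (Suc i) < w i" using desc.hyps(2) by (simp add: desc_def)
    then have "u \<noteq> w \<circ> adj i" if "u (Suc i) < u i" using that by auto
    moreover have "u \<noteq> w" if "\<not> u (Suc i) < u i" using that \<open>w (Suc i) < w i\<close> by auto
    moreover have "u \<circ> adj i = w \<circ> adj i \<longleftrightarrow> u = w" by (metis comp_adj_adj)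
    ultimately show ?thesis
      using IH[OF u] IH[OF us] inversions_desc[OF desc.hyps(1,2)] by auto
  qed
  finally show ?case .
qed

section \<open>Kazhdan--Lusztig polynomials\<close>

text \<open>The symmetry about \<open>d / 2\<close> carries every coefficient in the lower half to
  the upper half, where the degree bound leaves nothing. All uniqueness arguments for
  Kazhdan-Lusztig polynomials reduce to this.\<close>

lemma rv_fix_low_degree:
  assumes "1 \<le> d" "2 * degree p \<le> d - 1" "rv d p = p"
  shows "p = 0"
proof (rule poly_eqI)
  fix k
  show "coeff p k = coeff 0 k"
  proof (cases "degree p < k")
    case False
    then have "degree p < d - k" "k \<le> d" using assms(1,2) by auto
    then have "coeff (rv d p) k = 0" by (simp add: coeff_rv coeff_eq_0)
    then show ?thesis using assms(3) by simp
  qed (simp add: coeff_eq_0)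
qed

lemma rv_low_degree_unique:
  assumes "1 \<le> d" "2 * degree p \<le> d - 1" "2 * degree q \<le> d - 1" "rv d p - p = rv d q - q"
  shows "p = q"
proof -
  have "degree (p - q) \<le> max (degree p) (degree q)" by (rule degree_diff_le_max)
  then have "2 * degree (p - q) \<le> d - 1" using assms by auto
  moreover have "rv d (p - q) = p - q" using assms(4) by (simp add: rv_diff algebra_simps)
  ultimately have "p - q = 0" using assms(1) by (intro rv_fix_low_degree)
  then show ?thesis by simp
qed

text \<open>The conditions of \<open>KL_family\<close> for one column, so that columns can be built
  and compared separately. The sum runs over all permutations because terms outside the interval
  vanish.\<close>

definition KL_cond :: "nat \<Rightarrow> ((nat \<Rightarrow> nat) \<Rightarrow> int poly) \<Rightarrow> (nat \<Rightarrow> nat) \<Rightarrow> (nat \<Rightarrow> nat) \<Rightarrow> bool" where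
  "KL_cond n P u w \<longleftrightarrow>
     (\<not> bruhat_le n u w \<longrightarrow> P u = 0) \<and> (u = w \<longrightarrow> P u = 1) \<and>
     (bruhat_le n u w \<and> u \<noteq> w \<longrightarrow> 2 * degree (P u) \<le> inversions n w - inversions n u - 1) \<and>
     (bruhat_le n u w \<longrightarrow>
        rv (inversions n w - inversions n u) (P u) = (\<Sum>a | a permutes {1..n}. R_poly n u a * P a))"

lemma KL_family_iff:
  "KL_family n P \<longleftrightarrow> (\<forall>u w. u permutes {1..n} \<longrightarrow> w permutes {1..n} \<longrightarrow> KL_cond n (\<lambda>a. P a w) u w)"
proof -
  have iff: "(monom 1 (inversions n w - inversions n u - degree (P u w)) * reflect_poly (P u w) =
        (\<Sum>a | bruhat_le n u a \<and> bruhat_le n a w. R_poly n u a * P a w)) \<longleftrightarrow>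
      (rv (inversions n w - inversions n u) (P u w) = (\<Sum>a | a permutes {1..n}. R_poly n u a * P a w))"
    if "u permutes {1..n}" "w permutes {1..n}"
      and z: "\<forall>a. a permutes {1..n} \<longrightarrow> \<not> bruhat_le n a w \<longrightarrow> P a w = 0"
      and o: "u = w \<longrightarrow> P u w = 1"
      and d: "u \<noteq> w \<longrightarrow> 2 * degree (P u w) \<le> inversions n w - inversions n u - 1" for u w
  proof -
    have "degree (P u w) \<le> inversions n w - inversions n u" using o d by (cases "u = w") auto
    then have "rv (inversions n w - inversions n u) (P u w) =
        monom 1 (inversions n w - inversions n u - degree (P u w)) * reflect_poly (P u w)"
      by (rule rv_reflect)
    moreover have "(\<Sum>a | bruhat_le n u a \<and> bruhat_le n a w. R_poly n u a * P a w) =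
        (\<Sum>a | a permutes {1..n}. R_poly n u a * P a w)"
      using that R_poly_zero finite_perms[of n]
      by (intro sum.mono_neutral_left) (auto simp: bruhat_le_permutes)
    ultimately show ?thesis by simp
  qed
  show ?thesis
  proof
    assume P: "KL_family n P"
    show "\<forall>u w. u permutes {1..n} \<longrightarrow> w permutes {1..n} \<longrightarrow> KL_cond n (\<lambda>a. P a w) u w"
    proof (intro allI impI)
      fix u w assume uw: "u permutes {1..n}" "w permutes {1..n}"
      have z: "\<forall>a. a permutes {1..n} \<longrightarrow> \<not> bruhat_le n a w \<longrightarrow> P a w = 0"
        using P uw by (simp add: KL_family_def)
      show "KL_cond n (\<lambda>a. P a w) u w"
      proof -
        have f: "\<not> bruhat_le n u w \<longrightarrow> P u w = 0" and o: "u = w \<longrightarrow> P u w = 1"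
          and d: "bruhat_le n u w \<and> u \<noteq> w \<longrightarrow> 2 * degree (P u w) \<le> inversions n w - inversions n u - 1"
          and e: "bruhat_le n u w \<longrightarrow>
            monom 1 (inversions n w - inversions n u - degree (P u w)) * reflect_poly (P u w) =
            (\<Sum>a | bruhat_le n u a \<and> bruhat_le n a w. R_poly n u a * P a w)"
          using P uw unfolding KL_family_def by blast+
        have d': "u \<noteq> w \<longrightarrow> 2 * degree (P u w) \<le> inversions n w - inversions n u - 1"
          using d f by (cases "bruhat_le n u w") simp_all
        show ?thesis
          using f o d e unfolding iff[OF uw z o d'] KL_cond_def by blast
      qed
    qed
  next
    assume P: "\<forall>u w. u permutes {1..n} \<longrightarrow> w permutes {1..n} \<longrightarrow> KL_cond n (\<lambda>a. P a w) u w"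
    show "KL_family n P"
      unfolding KL_family_def
    proof (intro allI impI)
      fix u w assume uw: "u permutes {1..n}" "w permutes {1..n}"
      have z: "\<forall>a. a permutes {1..n} \<longrightarrow> \<not> bruhat_le n a w \<longrightarrow> P a w = 0"
        using P uw by (simp add: KL_cond_def)
      show "(\<not> bruhat_le n u w \<longrightarrow> P u w = 0) \<and> (u = w \<longrightarrow> P u w = 1) \<and>
         (bruhat_le n u w \<and> u \<noteq> w \<longrightarrow> 2 * degree (P u w) \<le> inversions n w - inversions n u - 1) \<and>
         (bruhat_le n u w \<longrightarrow>
           monom 1 (inversions n w - inversions n u - degree (P u w)) * reflect_poly (P u w) =
           (\<Sum>a | bruhat_le n u a \<and> bruhat_le n a w. R_poly n u a * P a w))"
      proof -
        have f: "\<not> bruhat_le n u w \<longrightarrow> P u w = 0" and o: "u = w \<longrightarrow> P u w = 1"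
          and d: "bruhat_le n u w \<and> u \<noteq> w \<longrightarrow> 2 * degree (P u w) \<le> inversions n w - inversions n u - 1"
          and e: "bruhat_le n u w \<longrightarrow> rv (inversions n w - inversions n u) (P u w) =
            (\<Sum>a | a permutes {1..n}. R_poly n u a * P a w)"
          using P uw unfolding KL_cond_def by blast+
        have d': "u \<noteq> w \<longrightarrow> 2 * degree (P u w) \<le> inversions n w - inversions n u - 1"
          using d f by (cases "bruhat_le n u w") simp_all
        show ?thesis
          using f o d e unfolding iff[OF uw z o d'] by blast
      qed
    qed
  qed
qed

lemma sum_R_poly_split:
  assumes "u permutes {1..n}"
  shows "(\<Sum>a | a permutes {1..n}. R_poly n u a * f a) =
         f u + (\<Sum>a\<in>{a. a permutes {1..n}} - {u}. R_poly n u a * f a)"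
  using assms finite_perms[of n] by (subst sum.remove[where x = u]) auto

text \<open>Induction downwards from \<open>w\<close>. The other summands are known, and the summand
  at \<open>u\<close> has coefficient 1, so the equation determines \<open>rv d (P u) - P u\<close>;
  the degree bound then determines \<open>P u\<close>.\<close>

lemma KL_cond_unique:
  assumes P: "\<And>u. u permutes {1..n} \<Longrightarrow> KL_cond n P u w" and Q: "\<And>u. u permutes {1..n} \<Longrightarrow> KL_cond n Q u w"
    and "w permutes {1..n}" "u permutes {1..n}"
  shows "P u = Q u"
  using assms(4)
proof (induction "inversions n w - inversions n u" arbitrary: u rule: less_induct)
  case less
  note u = less.prems
  show ?case
  proof (cases "bruhat_le n u w \<and> u \<noteq> w")
    case True
    let ?d = "inversions n w - inversions n u"
    have lt: "inversions n u < inversions n w" using True bruhat_le_inversions by blast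
    have "(\<Sum>a\<in>{a. a permutes {1..n}} - {u}. R_poly n u a * P a) =
          (\<Sum>a\<in>{a. a permutes {1..n}} - {u}. R_poly n u a * Q a)"
    proof (intro sum.cong refl)
      fix a assume a: "a \<in> {a. a permutes {1..n}} - {u}"
      show "R_poly n u a * P a = R_poly n u a * Q a"
      proof (cases "bruhat_le n u a")
        case True
        then have "inversions n u < inversions n a" using a bruhat_le_inversions by blast
        then show ?thesis using a lt less.hyps[of a] by auto
      next
        case False
        then show ?thesis using R_poly_zero u a by auto
      qed
    qed
    moreover have "rv ?d (P u) = (\<Sum>a | a permutes {1..n}. R_poly n u a * P a)"
      "rv ?d (Q u) = (\<Sum>a | a permutes {1..n}. R_poly n u a * Q a)"
      using P[OF u] Q[OF u] True unfolding KL_cond_def by blast+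
    ultimately have 1: "rv ?d (P u) - P u = rv ?d (Q u) - Q u"
      unfolding sum_R_poly_split[OF u] by simp
    have 2: "2 * degree (P u) \<le> ?d - 1" "2 * degree (Q u) \<le> ?d - 1"
      using P[OF u] Q[OF u] True unfolding KL_cond_def by blast+
    have "1 \<le> ?d" using lt by simp
    then show ?thesis using 2 1 by (rule rv_low_degree_unique)
  next
    case False
    then consider "\<not> bruhat_le n u w" | "u = w" by blast
    then have "P u = Q u \<or> (P u = 0 \<and> Q u = 0) \<or> (P u = 1 \<and> Q u = 1)"
      using P[OF u] Q[OF u] unfolding KL_cond_def by cases blast+
    then show ?thesis by auto
  qed
qed

lemma rv_antisym_solve:
  fixes Q :: "int poly"
  assumes "1 \<le> d" "degree Q \<le> d" "rv d Q = - Q"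
  obtains X where "2 * degree X \<le> d - 1" "rv d X = X + Q"
proof
  \<comment> \<open>Minus the lower half of \<open>Q\<close>: reversal supplies the upper half by
    antisymmetry. A middle coefficient equals its own negative and is 0.\<close>
  define X where "X = (\<Sum>k\<in>{k. 2 * k < d}. monom (- coeff Q k) k)"
  have fin: "finite {k. 2 * k < d}" by (rule finite_subset[of _ "{..d}"]) auto
  have cX: "coeff X k = (if 2 * k < d then - coeff Q k else 0)" for k
    using fin by (simp add: X_def coeff_sum)
  have cQ: "coeff Q (d - k) = - coeff Q k" if "k \<le> d" for k
    using arg_cong[OF assms(3), of "\<lambda>p. coeff p k"] that by (simp add: coeff_rv)
  show "2 * degree X \<le> d - 1"
  proof -
    have "degree X \<le> (d - 1) div 2" using assms(1) by (intro degree_le) (auto simp: cX)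
    then show ?thesis by linarith
  qed
  show "rv d X = X + Q"
  proof (rule poly_eqI)
    fix k
    show "coeff (rv d X) k = coeff (X + Q) k"
    proof (cases "k \<le> d")
      case True
      moreover have "coeff Q k = 0" if "2 * k = d"
      proof -
        have "d - k = k" using that by simp
        then show ?thesis using cQ[OF True] by simp
      qed
      ultimately show ?thesis using cQ[OF True] by (auto simp: coeff_rv cX)
    next
      case False
      then show ?thesis using assms(2) by (simp add: coeff_rv cX coeff_eq_0)
    qed
  qed
qed

text \<open>The right-hand side of the defining equation at \<open>u\<close> without the term of \<open>u\<close> itself is
  antisymmetric, because the matrix of the \<open>R\<close>-polynomials is inverse to its bar conjugate.\<close>

lemma KL_antisym:
  assumes w: "w permutes {1..n}" and u: "u permutes {1..n}" and uw: "bruhat_le n u w" "u \<noteq> w"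
    and d: "d = inversions n w - inversions n u"
    and Pu: "P u = 0"
    and P: "\<And>a. a permutes {1..n} \<Longrightarrow> a \<noteq> u \<Longrightarrow> bruhat_le n u a \<Longrightarrow> KL_cond n P a w"
    and P0: "\<And>a. a permutes {1..n} \<Longrightarrow> \<not> bruhat_le n a w \<Longrightarrow> P a = 0"
    and Q: "Q = (\<Sum>a | a permutes {1..n}. R_poly n u a * P a)"
  shows "degree Q \<le> d \<and> rv d Q = - Q"
proof -
  let ?S = "{a. a permutes {1..n}}"
  let ?e = "\<lambda>a. (-1 :: int poly) ^ inversions n a"
  \<comment> \<open>Reversal acts factor by factor: it multiplies \<open>R_poly n u a\<close> by a
    sign and turns \<open>P a\<close> into the right-hand side of the equation that already holds at
    \<open>a\<close>.\<close>
  have main: "degree (R_poly n u a * P a) \<le> d \<and>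
      rv d (R_poly n u a * P a) = (if a = u then 0 else ?e u * ?e a * R_poly n u a * (\<Sum>b\<in>?S. R_poly n a b * P b))"
    if "a \<in> ?S" for a
  proof (cases "a = u \<or> \<not> bruhat_le n u a")
    case True
    then show ?thesis using Pu R_poly_zero u that by auto
  next
    case False
    then have a: "a permutes {1..n}" "a \<noteq> u" "bruhat_le n u a" using that by auto
    show ?thesis
    proof (cases "bruhat_le n a w")
      case True
      define e1 where "e1 = inversions n a - inversions n u"
      define e2 where "e2 = inversions n w - inversions n a"
      have le: "inversions n u \<le> inversions n a" "inversions n a \<le> inversions n w"
        using a True bruhat_le_inversions by blast+
      then have de: "d = e1 + e2" by (simp add: d e1_def e2_def)
      have R: "degree (R_poly n u a) \<le> e1" "rv e1 (R_poly n u a) = (-1) ^ e1 * R_poly n u a"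
        using rv_R_poly[OF a(1) u, of e1] le by (auto simp: e1_def)
      have "degree (P a) \<le> e2"
        using P[OF a] True by (cases "a = w") (auto simp: KL_cond_def e2_def)
      moreover have "rv e2 (P a) = (\<Sum>b\<in>?S. R_poly n a b * P b)"
        using P[OF a] True by (auto simp: KL_cond_def e2_def)
      moreover have "(-1 :: int poly) ^ e1 = ?e u * ?e a"
        using le by (simp add: e1_def power_add[symmetric] minus_one_power_iff even_diff_nat)
      ultimately show ?thesis
        using R a(2) rv_mult[of "R_poly n u a" e1 "P a" e2] degree_mult_le[of "R_poly n u a" "P a"]
        by (auto simp: de algebra_simps)
    next
      case False
      then have "R_poly n a b * P b = 0" if "b \<in> ?S" for b
        using P0[of b] R_poly_zero[of b n a] that a bruhat_le_trans by auto
      then have "(\<Sum>b\<in>?S. R_poly n a b * P b) = 0" by (intro sum.neutral) auto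
      then show ?thesis using P0[OF a(1) False] by simp
    qed
  qed
  have "degree Q \<le> d" unfolding Q using main by (intro degree_sum_le finite_perms) auto
  \<comment> \<open>Adding the missing term \<open>F u\<close>, which equals \<open>Q\<close>,
    completes the sum over \<open>a\<close>. After exchanging the sums, orthogonality leaves only
    \<open>b = u\<close>, where \<open>P u = 0\<close>.\<close>
  moreover have "rv d Q = - Q"
  proof -
    define F where "F a = ?e u * ?e a * R_poly n u a * (\<Sum>b\<in>?S. R_poly n a b * P b)" for a
    have "rv d Q = (\<Sum>a\<in>?S. if a = u then 0 else F a)"
      unfolding Q rv_sum F_def using main by (intro sum.cong) auto
    also have "\<dots> = (\<Sum>a\<in>?S - {u}. F a)"
      using finite_perms[of n] u by (subst sum.remove[where x = u]) (auto intro: sum.cong)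
    also have "\<dots> = (\<Sum>a\<in>?S. F a) - F u"
      using finite_perms[of n] u by (subst (2) sum.remove[where x = u]) auto
    also have "F u = Q" using u by (simp add: F_def Q power_add[symmetric])
    also have "(\<Sum>a\<in>?S. F a) = (\<Sum>b\<in>?S. ?e u * P b * (\<Sum>a\<in>?S. ?e a * R_poly n u a * R_poly n a b))"
      unfolding F_def sum_distrib_left by (subst sum.swap) (simp add: algebra_simps)
    also have "\<dots> = (\<Sum>b\<in>?S. 0)"
      by (intro sum.cong) (auto simp: R_poly_orthogonal u Pu)
    finally show ?thesis by simp
  qed
  ultimately show ?thesis ..
qed

lemma KL_exists:
  assumes w: "w permutes {1..n}"
  shows "\<exists>P. \<forall>u. u permutes {1..n} \<longrightarrow> KL_cond n P u w"
proof -
  let ?S = "{a. a permutes {1..n}}"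
  \<comment> \<open>Partial columns: \<open>k\<close> is the number of length levels below
    \<open>w\<close> that are already solved, and \<open>P\<close> is 0 on the remaining
    levels.\<close>
  have "\<exists>P. (\<forall>u\<in>?S. \<not> bruhat_le n u w \<or> inversions n u + k < inversions n w \<longrightarrow> P u = 0) \<and>
            (\<forall>u\<in>?S. inversions n w \<le> inversions n u + k \<longrightarrow> KL_cond n P u w)" for k
  proof (induction k)
    case 0
    let ?P = "\<lambda>u. of_bool (u = w) :: int poly"
    have "KL_cond n ?P u w" if "u \<in> ?S" "inversions n w \<le> inversions n u" for u
    proof -
      have "bruhat_le n u w \<longleftrightarrow> u = w"
        using bruhat_le_inversions(2)[of n u w] bruhat_le_refl w that(2) by auto
      moreover have "(\<Sum>a\<in>?S. R_poly n w a * ?P a) = 1"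
        using sum_R_poly_split[OF w, of ?P] by (simp add: sum.neutral)
      moreover have "rv 0 1 = (1 :: int poly)" by (simp add: rv_def)
      ultimately show ?thesis by (simp add: KL_cond_def)
    qed
    moreover have "\<forall>u\<in>?S. \<not> bruhat_le n u w \<or> inversions n u < inversions n w \<longrightarrow> ?P u = 0"
      using bruhat_le_refl[OF w] by auto
    ultimately show ?case by (intro exI[of _ ?P]) auto
  next
    case (Suc k)
    then obtain P where P0: "\<And>u. u permutes {1..n} \<Longrightarrow> \<not> bruhat_le n u w \<or> inversions n u + k < inversions n w \<Longrightarrow> P u = 0"
      and P: "\<And>u. u permutes {1..n} \<Longrightarrow> inversions n w \<le> inversions n u + k \<Longrightarrow> KL_cond n P u w" by auto
    define new where "new u \<longleftrightarrow> u permutes {1..n} \<and> bruhat_le n u w \<and> inversions n w = inversions n u + Suc k" for u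
    define Q where "Q u = (\<Sum>a\<in>?S. R_poly n u a * P a)" for u
    have ex: "\<exists>X. 2 * degree X \<le> Suc k - 1 \<and> rv (Suc k) X = X + Q u" if "new u" for u
    proof -
      have "P a = 0" if "a permutes {1..n}" "\<not> bruhat_le n a w" for a using P0 that by blast
      moreover have "KL_cond n P a w" if "a permutes {1..n}" "a \<noteq> u" "bruhat_le n u a" for a
        using that \<open>new u\<close> bruhat_le_inversions(2)[of n u a] by (intro P) (auto simp: new_def)
      ultimately have "degree (Q u) \<le> Suc k \<and> rv (Suc k) (Q u) = - Q u"
        using that P0[of u] w by (intro KL_antisym[where u = u and w = w and P = P]) (auto simp: new_def Q_def)
      then show ?thesis using rv_antisym_solve[of "Suc k" "Q u"] by fastforce
    qed
    define P' where "P' u = (if new u then (SOME X. 2 * degree X \<le> Suc k - 1 \<and> rv (Suc k) X = X + Q u) else P u)" for u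
    have P': "2 * degree (P' u) \<le> Suc k - 1 \<and> rv (Suc k) (P' u) = P' u + Q u" if "new u" for u
      using someI_ex[OF ex[OF that]] that by (simp add: P'_def)
    \<comment> \<open>The new values do not disturb equations already solved: an element of the new
      lowest level lies above no other element considered, so its R-polynomial is 0.\<close>
    have same: "R_poly n u a * P' a = R_poly n u a * P a"
      if "u permutes {1..n}" "a permutes {1..n}" "inversions n w \<le> inversions n u + Suc k" "a \<noteq> u" for u a
    proof (cases "new a")
      case True
      then have "\<not> bruhat_le n u a" using that bruhat_le_inversions(2)[of n u a] by (auto simp: new_def)
      then show ?thesis using R_poly_zero that by simp
    qed (simp add: P'_def)
    have "KL_cond n P' u w" if u: "u permutes {1..n}" and le: "inversions n w \<le> inversions n u + Suc k" for u
    proof (cases "new u")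
      case True
      have "(\<Sum>a\<in>?S. R_poly n u a * P' a) = P' u + (\<Sum>a\<in>?S - {u}. R_poly n u a * P a)"
        unfolding sum_R_poly_split[OF u, of P'] using same[OF u _ le]
        by (intro arg_cong2[where f = "(+)"] sum.cong) auto
      also have "P u = 0" using P0[OF u] True by (simp add: new_def)
      then have "(\<Sum>a\<in>?S - {u}. R_poly n u a * P a) = Q u"
        unfolding Q_def sum_R_poly_split[OF u] by simp
      finally show ?thesis using P'[OF True] True by (auto simp: KL_cond_def new_def)
    next
      case False
      then have u': "P' u = P u" by (simp add: P'_def)
      have "(\<Sum>a\<in>?S. R_poly n u a * P' a) = (\<Sum>a\<in>?S. R_poly n u a * P a)"
        using same[OF u _ le] u' by (intro sum.cong) auto
      moreover have "KL_cond n P u w \<or> (\<not> bruhat_le n u w \<and> P u = 0)"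
        using P[OF u] P0[OF u] False le u unfolding new_def by linarith
      moreover have "bruhat_le n w w" using w by (rule bruhat_le_refl)
      ultimately show ?thesis using u' by (auto simp: KL_cond_def)
    qed
    moreover have "P' u = 0" if "u permutes {1..n}" "\<not> bruhat_le n u w \<or> inversions n u + Suc k < inversions n w" for u
      using that P0[of u] by (auto simp: P'_def new_def)
    ultimately show ?case by (intro exI[of _ P']) auto
  qed
  from this[of "inversions n w"] show ?thesis by auto
qed

text \<open>Columns chosen separately for each \<open>w\<close> form a Kazhdan-Lusztig family, and
  uniqueness of columns makes the definite description in \<open>KL_poly\<close> return it.\<close>

lemma KL_poly_cond:
  assumes "w permutes {1..n}" "u permutes {1..n}"
  shows "KL_cond n (\<lambda>a. KL_poly n a w) u w"
proof -
  define P where "P w = (SOME P. \<forall>u. u permutes {1..n} \<longrightarrow> KL_cond n P u w)" for w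
  have P: "KL_cond n (P w) u w" if "w permutes {1..n}" "u permutes {1..n}" for u w
    using someI_ex[OF KL_exists[OF that(1)]] that(2) unfolding P_def by blast
  have fam: "KL_family n (\<lambda>u w. P w u)" unfolding KL_family_iff using P by blast
  have eq: "KL_poly n u w = P w u" if "w permutes {1..n}" "u permutes {1..n}" for u w
    unfolding KL_poly_def
  proof (rule the_equality)
    show "\<exists>F. KL_family n F \<and> P w u = F u w" using fam by blast
  next
    fix p assume "\<exists>F. KL_family n F \<and> p = F u w"
    then obtain F where "KL_family n F" "p = F u w" by blast
    then show "p = P w u"
      using KL_cond_unique[of n "\<lambda>a. F a w" w "P w" u] P that unfolding KL_family_iff by blast
  qed
  have "(\<Sum>a | a permutes {1..n}. R_poly n u a * KL_poly n a w) = (\<Sum>a | a permutes {1..n}. R_poly n u a * P w a)"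
    using eq assms by (intro sum.cong) auto
  then show ?thesis using P[OF assms] eq[OF assms] by (auto simp: KL_cond_def)
qed

section \<open>Properties of Kazhdan-Lusztig polynomials\<close>

lemma KL_poly_zero:
  "u permutes {1..n} \<Longrightarrow> w permutes {1..n} \<Longrightarrow> \<not> bruhat_le n u w \<Longrightarrow> KL_poly n u w = 0"
  using KL_poly_cond[of w n u] by (simp add: KL_cond_def)

lemma KL_poly_refl: "w permutes {1..n} \<Longrightarrow> KL_poly n w w = 1"
  using KL_poly_cond[of w n w] by (simp add: KL_cond_def)

lemma KL_poly_degree:
  "bruhat_le n u w \<Longrightarrow> u \<noteq> w \<Longrightarrow> 2 * degree (KL_poly n u w) \<le> inversions n w - inversions n u - 1"
  using KL_poly_cond[of w n u] bruhat_le_permutes[of n u w] by (simp add: KL_cond_def)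

lemma KL_poly_degree_le:
  "bruhat_le n u w \<Longrightarrow> degree (KL_poly n u w) \<le> inversions n w - inversions n u"
  using KL_poly_degree[of n u w] KL_poly_refl[of w n] bruhat_le_permutes[of n u w] by (cases "u = w") auto

lemma KL_poly_rv:
  "bruhat_le n u w \<Longrightarrow> rv (inversions n w - inversions n u) (KL_poly n u w) =
     (\<Sum>a | a permutes {1..n}. R_poly n u a * KL_poly n a w)"
  using KL_poly_cond[of w n u] bruhat_le_permutes[of n u w] by (simp add: KL_cond_def)

lemma KL_poly_eqI:
  assumes uw: "bruhat_le n u w" "u \<noteq> w" and deg: "2 * degree X \<le> inversions n w - inversions n u - 1"
    and rv: "rv (inversions n w - inversions n u) X =
       X + (\<Sum>a\<in>{a. a permutes {1..n}} - {u}. R_poly n u a * KL_poly n a w)"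
  shows "KL_poly n u w = X"
proof (rule rv_low_degree_unique[of "inversions n w - inversions n u"])
  have "inversions n u < inversions n w" using uw bruhat_le_inversions by blast
  then show "1 \<le> inversions n w - inversions n u" by simp
  show "rv (inversions n w - inversions n u) (KL_poly n u w) - KL_poly n u w =
    rv (inversions n w - inversions n u) X - X"
    using KL_poly_rv[OF uw(1)] rv sum_R_poly_split[of u n] bruhat_le_permutes[OF uw(1)] by simp
qed (use KL_poly_degree uw deg in auto)

text \<open>The equation at \<open>a\<close> sees only the R-polynomials and the length differences
  inside \<open>[a, w]\<close>. Order relations enter through the vanishing of R-polynomials. All
  later reductions are instances.\<close>

lemma KL_poly_transfer:
  assumes w: "w permutes {1..n}" and w': "f w permutes {1..m}"
    and bij: "bij_betw f {a. bruhat_le n u a \<and> bruhat_le n a w} {a. bruhat_le m u' a \<and> bruhat_le m a (f w)}"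
    and R: "\<And>a b. a \<in> {a. bruhat_le n u a \<and> bruhat_le n a w} \<Longrightarrow> b \<in> {a. bruhat_le n u a \<and> bruhat_le n a w} \<Longrightarrow> R_poly m (f a) (f b) = R_poly n a b"
    and l: "\<And>a. a \<in> {a. bruhat_le n u a \<and> bruhat_le n a w} \<Longrightarrow> inversions m (f w) + inversions n a = inversions m (f a) + inversions n w"
    and a: "a \<in> {a. bruhat_le n u a \<and> bruhat_le n a w}"
  shows "KL_poly m (f a) (f w) = KL_poly n a w"
  using a
proof (induction "inversions n w - inversions n a" arbitrary: a rule: less_induct)
  case less
  let ?I = "{a. bruhat_le n u a \<and> bruhat_le n a w}"
  let ?J = "{a. bruhat_le m u' a \<and> bruhat_le m a (f w)}"
  note a = less.prems
  have fa: "f a \<in> ?J" using bij a by (rule bij_betw_apply)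
  have a1: "bruhat_le n u a" "bruhat_le n a w" using a by simp_all
  have fa1: "bruhat_le m u' (f a)" "bruhat_le m (f a) (f w)" using fa by simp_all
  have pa: "a permutes {1..n}" "f a permutes {1..m}"
    using bruhat_le_permutes(2)[OF a1(1)] bruhat_le_permutes(2)[OF fa1(1)] .
  have wI: "w \<in> ?I" using bruhat_le_trans[OF a1] bruhat_le_refl[OF w] by simp
  show ?case
  proof (cases "a = w")
    case True
    then show ?thesis using KL_poly_refl w w' by simp
  next
    case False
    then have fne: "f a \<noteq> f w" using bij a wI by (auto simp: bij_betw_def inj_on_def)
    have eq: "inversions m (f w) - inversions m (f a) = inversions n w - inversions n a"
      using l[OF a] by linarith
    have ltw: "inversions n a < inversions n w" using a False bruhat_le_inversions by blast
    have "(\<Sum>b\<in>{b. b permutes {1..m}} - {f a}. R_poly m (f a) b * KL_poly m b (f w)) =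
        (\<Sum>b\<in>?J - {f a}. R_poly m (f a) b * KL_poly m b (f w))"
    proof (rule sum.mono_neutral_right)
      show "\<forall>b\<in>({b. b permutes {1..m}} - {f a}) - (?J - {f a}). R_poly m (f a) b * KL_poly m b (f w) = 0"
      proof
        fix b assume "b \<in> ({b. b permutes {1..m}} - {f a}) - (?J - {f a})"
        then have b: "b permutes {1..m}" "\<not> bruhat_le m u' b \<or> \<not> bruhat_le m b (f w)" by auto
        then have "\<not> bruhat_le m (f a) b \<or> \<not> bruhat_le m b (f w)" using fa1 bruhat_le_trans by blast
        then show "R_poly m (f a) b * KL_poly m b (f w) = 0"
          using R_poly_zero[OF b(1) pa(2)] KL_poly_zero[OF b(1) w'] by auto
      qed
    qed (use finite_perms[of m] bruhat_le_permutes in auto)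
    also have "\<dots> = (\<Sum>b\<in>?I - {a}. R_poly m (f a) (f b) * KL_poly m (f b) (f w))"
    proof (rule sum.reindex_bij_betw[symmetric])
      show "bij_betw f (?I - {a}) (?J - {f a})"
        using bij a by (auto simp: bij_betw_def inj_on_def)
    qed
    also have "\<dots> = (\<Sum>b\<in>?I - {a}. R_poly n a b * KL_poly n b w)"
    proof (intro sum.cong refl)
      fix b assume b: "b \<in> ?I - {a}"
      show "R_poly m (f a) (f b) * KL_poly m (f b) (f w) = R_poly n a b * KL_poly n b w"
      proof (cases "bruhat_le n a b")
        case True
        then have "inversions n a < inversions n b" using b bruhat_le_inversions by blast
        then have "KL_poly m (f b) (f w) = KL_poly n b w" using b ltw by (intro less.hyps) auto
        then show ?thesis using R a b by simp
      next
        case False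
        have "R_poly n a b = 0" using False b pa bruhat_le_permutes by (intro R_poly_zero) auto
        then show ?thesis using R[of a b] a b by simp
      qed
    qed
    also have "\<dots> = (\<Sum>b\<in>{b. b permutes {1..n}} - {a}. R_poly n a b * KL_poly n b w)"
    proof (rule sum.mono_neutral_left)
      show "\<forall>b\<in>({b. b permutes {1..n}} - {a}) - (?I - {a}). R_poly n a b * KL_poly n b w = 0"
      proof
        fix b assume "b \<in> ({b. b permutes {1..n}} - {a}) - (?I - {a})"
        then have b: "b permutes {1..n}" "\<not> bruhat_le n u b \<or> \<not> bruhat_le n b w" by auto
        then have "\<not> bruhat_le n a b \<or> \<not> bruhat_le n b w" using a1 bruhat_le_trans by blast
        then show "R_poly n a b * KL_poly n b w = 0"
          using R_poly_zero[OF b(1) pa(1)] KL_poly_zero[OF b(1) w] by auto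
      qed
    qed (use finite_perms[of n] bruhat_le_permutes in auto)
    finally have sum: "(\<Sum>b\<in>{b. b permutes {1..m}} - {f a}. R_poly m (f a) b * KL_poly m b (f w)) =
      (\<Sum>b\<in>{b. b permutes {1..n}} - {a}. R_poly n a b * KL_poly n b w)" .
    show ?thesis
    proof (rule KL_poly_eqI)
      show "bruhat_le m (f a) (f w)" "f a \<noteq> f w" using fa fne by auto
      show "2 * degree (KL_poly n a w) \<le> inversions m (f w) - inversions m (f a) - 1"
        unfolding eq using a False by (intro KL_poly_degree) auto
      show "rv (inversions m (f w) - inversions m (f a)) (KL_poly n a w) = KL_poly n a w +
        (\<Sum>b\<in>{b. b permutes {1..m}} - {f a}. R_poly m (f a) b * KL_poly m b (f w))"
        unfolding eq sum using a by (simp add: KL_poly_rv sum_R_poly_split[OF pa(1)])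
    qed
  qed
qed

lemma KL_poly_inv:
  assumes "u permutes {1..n}" "w permutes {1..n}"
  shows "KL_poly n (inv u) (inv w) = KL_poly n u w"
proof (cases "bruhat_le n u w")
  case True
  have ii: "inv (inv a) = a" if "a permutes {1..n}" for a using permutes_inv_inv that .
  show ?thesis
  proof (rule KL_poly_transfer[where u = u and u' = "inv u"])
    show "bij_betw inv {a. bruhat_le n u a \<and> bruhat_le n a w} {a. bruhat_le n (inv u) a \<and> bruhat_le n a (inv w)}"
    proof (rule bij_betwI[where g = inv])
      show "inv \<in> {a. bruhat_le n (inv u) a \<and> bruhat_le n a (inv w)} \<rightarrow> {a. bruhat_le n u a \<and> bruhat_le n a w}"
      proof
        fix a assume "a \<in> {a. bruhat_le n (inv u) a \<and> bruhat_le n a (inv w)}"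
        then have "bruhat_le n (inv (inv u)) (inv a)" "bruhat_le n (inv a) (inv (inv w))"
          using bruhat_le_inv by simp_all
        then show "inv a \<in> {a. bruhat_le n u a \<and> bruhat_le n a w}"
          using ii[OF assms(1)] ii[OF assms(2)] by simp
      qed
    qed (use bruhat_le_inv ii bruhat_le_permutes in blast)+
  next
    show "R_poly n (inv a) (inv b) = R_poly n a b"
      if "a \<in> {a. bruhat_le n u a \<and> bruhat_le n a w}" "b \<in> {a. bruhat_le n u a \<and> bruhat_le n a w}" for a b
      using that bruhat_le_permutes(1)[of n a w] bruhat_le_permutes(1)[of n b w] by (simp add: R_poly_inv)
  qed (use True assms bruhat_le_refl in \<open>auto simp: permutes_inv inversions_inv dest: bruhat_le_permutes\<close>)
next
  case False
  then have "\<not> bruhat_le n (inv u) (inv w)" 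
    using bruhat_le_inv[of n "inv u" "inv w"] permutes_inv_inv[OF assms(1)] permutes_inv_inv[OF assms(2)] by auto
  then show ?thesis using False assms by (simp add: KL_poly_zero permutes_inv)
qed

text \<open>The polynomial of \<open>v = u \<circ> adj i\<close> is shown to satisfy the defining
  equation at \<open>u\<close>. On each coset the sum of the R-polynomials from \<open>u\<close> is
  q times that from \<open>v\<close>, and the other polynomials above \<open>u\<close> are constant
  on cosets by induction. So the right-hand side is q times that at \<open>v\<close>, which matches
  a length difference larger by one.\<close>

lemma KL_poly_asc:
  assumes w: "w permutes {1..n}" and dw: "desc n w i" and "u permutes {1..n}" "u i < u (Suc i)"
  shows "KL_poly n u w = KL_poly n (u \<circ> adj i) w"
  using assms(3,4)
proof (induction "inversions n w - inversions n u" arbitrary: u rule: less_induct)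
  case less
  note u = less.prems
  have i: "1 \<le> i" "i < n" and wd: "w (Suc i) < w i" using dw by (auto simp: desc_def)
  define v where "v = u \<circ> adj i"
  have v: "v permutes {1..n}" unfolding v_def using i u by (intro permutes_comp_adj)
  have uv: "bruhat_le n u v"
    using rank_le_comp_adj[OF i(1) u(2)] u v by (simp add: bruhat_le_iff v_def)
  have lv: "inversions n v = Suc (inversions n u)" unfolding v_def using i u by (intro inversions_swap)
  have lift: "bruhat_le n u w \<longleftrightarrow> bruhat_le n v w"
  proof
    assume "bruhat_le n u w"
    then have "rank_le (u \<circ> adj i) w"
      using wd i permutes_inj[OF u(1)] by (intro rank_le_comp_left) (simp_all add: bruhat_le_iff)
    then show "bruhat_le n v w" using v w by (simp add: bruhat_le_iff v_def)
  qed (rule bruhat_le_trans[OF uv])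
  show ?case
  proof (cases "bruhat_le n v w")
    case False
    then show ?thesis using lift KL_poly_zero u v w by (simp add: v_def)
  next
    case True
    then have uw: "bruhat_le n u w" using lift by simp
    define X where "X = KL_poly n v w"
    \<comment> \<open>A trial column: the candidate \<open>X\<close> replaces the entry at
      \<open>u\<close>.\<close>
    define P where "P a = (if a = u then X else KL_poly n a w)" for a
    let ?A = "{a. a permutes {1..n} \<and> a i < a (Suc i)}"
    define d where "d = inversions n w - inversions n v"
    have dw': "inversions n w - inversions n u = Suc d"
      using bruhat_le_inversions(1)[OF True] lv by (simp add: d_def)
    have pair: "P a = P (a \<circ> adj i)" if "a \<in> ?A" "bruhat_le n u (a \<circ> adj i)" for a
    proof (cases "a = u")
      case False
      have a: "a permutes {1..n}" "a i < a (Suc i)" using that by auto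
      have as: "a \<circ> adj i permutes {1..n}" using a i by (intro permutes_comp_adj)
      have "rank_le u (a \<circ> adj i \<circ> adj i)"
        using that as u i permutes_inj by - (rule rank_le_comp_right, auto simp: bruhat_le_iff)
      then have "bruhat_le n u a" using u a by (simp add: bruhat_le_iff)
      then have "inversions n u < inversions n a" using False bruhat_le_inversions(2) by blast
      moreover have "inversions n u < inversions n w" using dw' by linarith
      ultimately have "KL_poly n a w = KL_poly n (a \<circ> adj i) w" using a by (intro less.hyps) auto
      moreover have "a \<circ> adj i \<noteq> u" using a u(2) by auto
      ultimately show ?thesis using False by (simp add: P_def)
    qed (use u in \<open>auto simp: P_def X_def v_def\<close>)
    have pairsum: "(\<Sum>a | a permutes {1..n}. R_poly n x a * P a) =
        (\<Sum>a\<in>?A. (R_poly n x a + R_poly n x (a \<circ> adj i)) * P (a \<circ> adj i))"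
      if x: "x permutes {1..n}" "bruhat_le n u x" for x
      unfolding sum_perms_pairs[OF i]
    proof (intro sum.cong refl)
      fix a assume a: "a \<in> ?A"
      have as: "a \<circ> adj i permutes {1..n}" using a i by (intro permutes_comp_adj) auto
      have "bruhat_le n a (a \<circ> adj i)"
        using rank_le_comp_adj[OF i(1)] a as by (simp add: bruhat_le_iff)
      show "R_poly n x a * P a + R_poly n x (a \<circ> adj i) * P (a \<circ> adj i) =
        (R_poly n x a + R_poly n x (a \<circ> adj i)) * P (a \<circ> adj i)"
      proof (cases "bruhat_le n u (a \<circ> adj i)")
        case True
        then show ?thesis using pair[OF a] by (simp add: algebra_simps)
      next
        case False
        then have "\<not> bruhat_le n x a" "\<not> bruhat_le n x (a \<circ> adj i)"
          using x \<open>bruhat_le n a (a \<circ> adj i)\<close> bruhat_le_trans by blast+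
        then show ?thesis using R_poly_zero x a as by simp
      qed
    qed
    have "KL_poly n u w = X"
    proof (rule KL_poly_eqI[OF uw])
      show "u \<noteq> w" using u wd by auto
      show "2 * degree X \<le> inversions n w - inversions n u - 1"
        using KL_poly_degree[OF True] KL_poly_refl[OF w] dw' by (cases "v = w") (auto simp: X_def d_def)
      have Fv: "(\<Sum>a | a permutes {1..n}. R_poly n v a * P a) = rv d X"
      proof -
        have "\<not> bruhat_le n v u" using bruhat_le_inversions(1)[of n v u] lv by linarith
        then have "R_poly n v u = 0" using R_poly_zero u v by simp
        then have "(\<Sum>a | a permutes {1..n}. R_poly n v a * P a) = (\<Sum>a | a permutes {1..n}. R_poly n v a * KL_poly n a w)"
          by (intro sum.cong) (auto simp: P_def)
        then show ?thesis using KL_poly_rv[OF True] by (simp add: X_def d_def)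
      qed
      have "(\<Sum>a | a permutes {1..n}. R_poly n u a * P a) = qX * (\<Sum>a | a permutes {1..n}. R_poly n v a * P a)"
      proof -
        have "R_poly n u a + R_poly n u (a \<circ> adj i) = qX * (R_poly n v a + R_poly n v (a \<circ> adj i))"
          if "a \<in> ?A" for a
        proof -
          have "R_poly n v (a \<circ> adj i) = R_poly n u a"
            using R_poly_asc_comp[OF v, of a i] that i u by (simp add: v_def)
          moreover have "R_poly n u (a \<circ> adj i) = qX * R_poly n v a + [:-1, 1:] * R_poly n u a"
            using R_poly_asc_comp[OF u(1), of a i] that i u by (simp add: v_def)
          ultimately show ?thesis by (simp add: algebra_simps)
        qed
        then show ?thesis
          unfolding pairsum[OF u(1) bruhat_le_refl[OF u(1)]] pairsum[OF v uv] sum_distrib_left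
          by (intro sum.cong) (auto simp: algebra_simps)
      qed
      also have "\<dots> = rv (Suc d) X"
      proof -
        have "degree X \<le> d" unfolding X_def d_def by (rule KL_poly_degree_le[OF True])
        then have "rv (1 + d) (1 * X) = rv 1 1 * rv d X" by (intro rv_mult) auto
        moreover have "rv 1 1 = qX" by (simp add: rv_def One_nat_def monom_altdef)
        ultimately show ?thesis unfolding Fv by (simp add: One_nat_def)
      qed
      finally have "rv (Suc d) X = (\<Sum>a | a permutes {1..n}. R_poly n u a * P a)" by simp
      also have "\<dots> = X + (\<Sum>a\<in>{a. a permutes {1..n}} - {u}. R_poly n u a * KL_poly n a w)"
        unfolding sum_R_poly_split[OF u(1), of P] by (auto simp: P_def intro!: sum.cong)
      finally show "rv (inversions n w - inversions n u) X =
          X + (\<Sum>a\<in>{a. a permutes {1..n}} - {u}. R_poly n u a * KL_poly n a w)"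
        unfolding dw' .
    qed
    then show ?thesis by (simp add: X_def v_def)
  qed
qed

lemma KL_poly_comp_desc:
  assumes "w permutes {1..n}" "desc n w i" "u permutes {1..n}"
  shows "KL_poly n (u \<circ> adj i) w = KL_poly n u w"
proof -
  consider "u i < u (Suc i)" | "u (Suc i) < u i"
    using permutes_neq_Suc[OF assms(3), of i] by linarith
  then show ?thesis
  proof cases
    case 2
    have "u \<circ> adj i permutes {1..n}" using assms by (intro permutes_comp_adj) (auto simp: desc_def)
    then show ?thesis using KL_poly_asc[OF assms(1,2), of "u \<circ> adj i"] 2 by simp
  qed (use KL_poly_asc[OF assms] in simp)
qed

lemma KL_poly_left_comp_desc:
  assumes "w permutes {1..n}" "desc n (inv w) i" "u permutes {1..n}"
  shows "KL_poly n (adj i \<circ> u) w = KL_poly n u w"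
proof -
  have p: "adj i \<circ> u permutes {1..n}" using assms by (intro adj_comp_permutes) (auto simp: desc_def)
  have "KL_poly n (adj i \<circ> u) w = KL_poly n (inv u \<circ> adj i) (inv w)"
    using KL_poly_inv[OF p assms(1)] inv_adj_comp[OF permutes_bij[OF assms(3)]] by simp
  also have "\<dots> = KL_poly n (inv u) (inv w)"
    using assms by (intro KL_poly_comp_desc permutes_inv)
  finally show ?thesis using KL_poly_inv assms by simp
qed

text \<open>Poincare duality for the intersection cohomology of a Schubert variety. Reversing a
  summand leaves the right-hand side of the defining equation at \<open>a\<close>; summing over
  \<open>a\<close> first produces the column sums of the R-polynomials.\<close>

lemma KL_poly_sum_palindromic:
  assumes w: "w permutes {1..n}"
  shows "rv (inversions n w) (\<Sum>a | a permutes {1..n}. qX ^ inversions n a * KL_poly n a w) =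
    (\<Sum>a | a permutes {1..n}. qX ^ inversions n a * KL_poly n a w)"
proof -
  let ?S = "{a. a permutes {1..n}}"
  have rvX: "rv k (qX ^ k) = 1" for k
  proof -
    have "qX ^ k = monom 1 k" by (simp add: monom_altdef)
    then show ?thesis by (auto simp: poly_eq_iff coeff_rv coeff_1)
  qed
  have t: "rv (inversions n w) (qX ^ inversions n a * KL_poly n a w) = (\<Sum>b\<in>?S. R_poly n a b * KL_poly n b w)"
    if a: "a \<in> ?S" for a
  proof (cases "bruhat_le n a w")
    case True
    let ?d = "inversions n w - inversions n a"
    have "rv (inversions n a + ?d) (qX ^ inversions n a * KL_poly n a w) =
      rv (inversions n a) (qX ^ inversions n a) * rv ?d (KL_poly n a w)"
      using KL_poly_degree_le[OF True] by (intro rv_mult) (auto simp: degree_power_eq)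
    then show ?thesis using bruhat_le_inversions(1)[OF True] by (simp add: rvX KL_poly_rv[OF True])
  next
    case False
    then have "R_poly n a b * KL_poly n b w = 0" if "b \<in> ?S" for b
      
    proof -
      have "\<not> bruhat_le n a b \<or> \<not> bruhat_le n b w" using False bruhat_le_trans by blast
      then show ?thesis using KL_poly_zero[of b n w] R_poly_zero[of b n a] that a w by auto
    qed
    then have "(\<Sum>b\<in>?S. R_poly n a b * KL_poly n b w) = 0" by (intro sum.neutral) auto
    then show ?thesis using KL_poly_zero[OF _ w False] a by simp
  qed
  have "rv (inversions n w) (\<Sum>a\<in>?S. qX ^ inversions n a * KL_poly n a w) =
      (\<Sum>a\<in>?S. \<Sum>b\<in>?S. R_poly n a b * KL_poly n b w)"
    unfolding rv_sum using t by (intro sum.cong) auto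
  also have "\<dots> = (\<Sum>b\<in>?S. (\<Sum>a\<in>?S. R_poly n a b) * KL_poly n b w)"
    unfolding sum_distrib_right by (rule sum.swap)
  also have "\<dots> = (\<Sum>b\<in>?S. qX ^ inversions n b * KL_poly n b w)"
    by (intro sum.cong) (auto simp: R_poly_column_sum)
  finally show ?thesis .
qed

section \<open>Reduction to the pattern\<close>

lemma rank_le_both_asc:
  assumes "rank_le x y" "1 \<le> i" "y i < y (Suc i)" "inj x"
  shows "rank_le (x \<circ> adj i) (y \<circ> adj i)"
proof -
  have "rank_le x (y \<circ> adj i)"
    using assms(1) rank_le_comp_adj[of i y] assms(2,3) rank_le_trans by blast
  then show ?thesis using assms by (intro rank_le_comp_left) auto
qed

lemma rank_le_both_desc:
  assumes "rank_le x y" "1 \<le> i" "x (Suc i) < x i" "inj y"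
  shows "rank_le (x \<circ> adj i) (y \<circ> adj i)"
proof -
  have "rank_le (x \<circ> adj i) y"
    using assms(1) rank_le_comp_adj[of i "x \<circ> adj i"] assms(2,3) by (auto intro: rank_le_trans)
  then show ?thesis using assms by (intro rank_le_comp_right) auto
qed

lemma rank_count_Suc_col:
  assumes "inj w"
  shows "rank_count w p (Suc q) = rank_count w p q + of_bool (\<exists>k. 1 \<le> k \<and> k \<le> p \<and> w k = Suc q)"
proof (induction p)
  case (Suc p)
  have "(\<exists>k. 1 \<le> k \<and> k \<le> Suc p \<and> w k = Suc q) \<longleftrightarrow>
      (\<exists>k. 1 \<le> k \<and> k \<le> p \<and> w k = Suc q) \<or> w (Suc p) = Suc q"
    by (auto simp: le_Suc_eq One_nat_def)
  moreover have "\<not> ((\<exists>k. 1 \<le> k \<and> k \<le> p \<and> w k = Suc q) \<and> w (Suc p) = Suc q)"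
    using assms by (metis Suc_n_not_le_n injD)
  ultimately show ?case using Suc by (auto simp: rank_count_Suc of_bool_def)
qed auto

text \<open>If \<open>r\<^sub>v = r\<^sub>w\<close> in column \<open>c\<close> around the rows \<open>j\<close> and \<open>j + 1\<close>, then all elements of the
  interval have the common point of \<open>v\<close> and \<open>w\<close> in the same row and their other point of these
  two rows on the same side of it.\<close>

lemma interval_uniform:
  assumes v: "v permutes {1..n}" and w: "w permutes {1..n}"
    and j: "1 \<le> j" and i: "i = j \<or> i = Suc j" and vi: "v i = c" and wi: "w i = c"
    and f1: "rank_count v (j - 1) c = rank_count w (j - 1) c"
    and f2: "rank_count v (Suc j) c = rank_count w (Suc j) c"
    and a: "bruhat_le n v a" "bruhat_le n a w"
  shows "a j < a (Suc j) \<longleftrightarrow> w j < w (Suc j)"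
proof -
  obtain k where k: "j = Suc k" using j by (cases j) auto
  have "c \<noteq> 0" using w wi i j permutes_not_in[OF w, of 0] permutes_inj[OF w]
    by (metis One_nat_def atLeastAtMost_iff injD le_zero_eq nat.distinct(1) not_one_le_zero)
  then obtain c' where c': "c = Suc c'" by (cases c) auto
  have eqc: "rank_count v p c = rank_count w p c" if "p \<in> {k, Suc k, Suc (Suc k)}" for p
    using f1 f2 that i vi wi k by (auto simp: rank_count_Suc)
  \<comment> \<open>Since \<open>v\<close> and \<open>w\<close> share their point in column
    \<open>c\<close>, equality of ranks in that column carries over to the column before it. The
    whole interval is then squeezed in both columns on three consecutive rows.\<close>
  have one: "rank_count v p c - rank_count v p c' = rank_count w p c - rank_count w p c'" for p
  proof -
    have "(\<exists>k. 1 \<le> k \<and> k \<le> p \<and> u k = Suc c') \<longleftrightarrow> 1 \<le> i \<and> i \<le> p" if "inj u" "u i = Suc c'" for u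
      using that by (metis injD)
    then show ?thesis
      using vi wi permutes_inj[OF v] permutes_inj[OF w]
      unfolding c' by (simp add: rank_count_Suc_col)
  qed
  have ge: "rank_count u p c' \<le> rank_count u p c" for u p
    unfolding rank_count_sum c' by (intro sum_mono) (auto simp: of_bool_def)
  have eqc': "rank_count v p c' = rank_count w p c'" if "p \<in> {k, Suc k, Suc (Suc k)}" for p
    using eqc[OF that] one[of p] ge[of v p] ge[of w p] by linarith
  have le: "rank_count w p q \<le> rank_count a p q" "rank_count a p q \<le> rank_count v p q" for p q
    using a by (auto simp: bruhat_le_iff rank_le_def)
  have A: "rank_count a p q = rank_count w p q" if "p \<in> {k, Suc k, Suc (Suc k)}" "q \<in> {c, c'}" for p q
    using le[of p q] eqc[OF that(1)] eqc'[OF that(1)] that(2) by auto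
  have B: "(a r \<le> q) = (w r \<le> q)" if "r \<in> {Suc k, Suc (Suc k)}" "q \<in> {c, c'}" for r q
    using A[of k q] A[of "Suc k" q] A[of "Suc (Suc k)" q] that
    by (auto simp: rank_count_Suc of_bool_def split: if_splits)
  have "a i = c" using B[of i c] B[of i c'] i k wi c' by auto
  then show ?thesis
    using B[of "Suc k" c] B[of "Suc k" c'] B[of "Suc (Suc k)" c] B[of "Suc (Suc k)" c'] i k wi c'
      permutes_neq_Suc[OF w, of j] permutes_neq_Suc[OF bruhat_le_permutes(2)[OF a(1)], of j]
    by auto
qed

lemma bruhat_le_both_asc:
  assumes "bruhat_le n x y" "1 \<le> i" "i < n" "y i < y (Suc i)"
  shows "bruhat_le n (x \<circ> adj i) (y \<circ> adj i)"
  using assms rank_le_both_asc[of x y i] permutes_inj[of x] permutes_comp_adj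
  by (auto simp: bruhat_le_iff)

lemma bruhat_le_both_desc:
  assumes "bruhat_le n x y" "1 \<le> i" "i < n" "x (Suc i) < x i"
  shows "bruhat_le n (x \<circ> adj i) (y \<circ> adj i)"
  using assms rank_le_both_desc[of x y i] permutes_inj[of y] permutes_comp_adj
  by (auto simp: bruhat_le_iff)

text \<open>By \<open>interval_uniform\<close> every element of the interval has an ascent at
  \<open>j\<close>, and every element of the image interval a descent. So multiplication by
  \<open>adj j\<close> is a bijection of intervals that raises all lengths by one and preserves
  R-polynomials.\<close>

lemma KL_poly_move_row_asc:
  assumes vw: "bruhat_le n v w"
    and j: "1 \<le> j" "j < n" and i: "i = j \<or> i = Suc j" and vi: "v i = c" and wi: "w i = c"
    and f1: "rank_count v (j - 1) c = rank_count w (j - 1) c"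
    and f2: "rank_count v (Suc j) c = rank_count w (Suc j) c"
    and asc: "w j < w (Suc j)"
  shows "KL_poly n (v \<circ> adj j) (w \<circ> adj j) = KL_poly n v w"
proof -
  let ?s = "\<lambda>a. a \<circ> adj j"
  note v = bruhat_le_permutes(1)[OF vw] and w = bruhat_le_permutes(2)[OF vw]
  have vs: "?s v permutes {1..n}" and ws: "?s w permutes {1..n}"
    using v w j by (auto intro: permutes_comp_adj)
  have U: "a j < a (Suc j)" if "bruhat_le n v a" "bruhat_le n a w" for a
    using interval_uniform[OF v w j(1) i vi wi f1 f2 that] asc by simp
  have i': "adj j i = j \<or> adj j i = Suc j" using i by auto
  have "?s v (adj j i) = c" "?s w (adj j i) = c" using vi wi by auto
  moreover have "rank_count (?s v) (j - 1) c = rank_count (?s w) (j - 1) c"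
    "rank_count (?s v) (Suc j) c = rank_count (?s w) (Suc j) c"
    using f1 f2 j by (auto simp: rank_count_comp_adj)
  ultimately have U': "a (Suc j) < a j" if "bruhat_le n (?s v) a" "bruhat_le n a (?s w)" for a
    using interval_uniform[OF vs ws j(1) i' _ _ _ _ that] asc
      permutes_neq_Suc[OF bruhat_le_permutes(2)[OF that(1)], of j] by fastforce
  show ?thesis
  proof (rule KL_poly_transfer[where f = ?s and u = v and u' = "?s v"])
    show "bij_betw ?s {a. bruhat_le n v a \<and> bruhat_le n a w} {a. bruhat_le n (?s v) a \<and> bruhat_le n a (?s w)}"
    proof (rule bij_betwI[where g = ?s])
      show "?s \<in> {a. bruhat_le n v a \<and> bruhat_le n a w} \<rightarrow> {a. bruhat_le n (?s v) a \<and> bruhat_le n a (?s w)}"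
        using U j asc by (auto intro!: bruhat_le_both_asc)
      show "?s \<in> {a. bruhat_le n (?s v) a \<and> bruhat_le n a (?s w)} \<rightarrow> {a. bruhat_le n v a \<and> bruhat_le n a w}"
      proof
        fix a assume a: "a \<in> {a. bruhat_le n (?s v) a \<and> bruhat_le n a (?s w)}"
        have "bruhat_le n (?s (?s v)) (?s a)"
          using a j U[OF bruhat_le_refl[OF v] vw] by (intro bruhat_le_both_desc) auto
        moreover have "bruhat_le n (?s a) (?s (?s w))"
          using a j U' by (intro bruhat_le_both_desc) auto
        ultimately show "?s a \<in> {a. bruhat_le n v a \<and> bruhat_le n a w}" by simp
      qed
    qed (simp_all add: comp_assoc)
    show "R_poly n (?s a) (?s b) = R_poly n a b"
      if "a \<in> {a. bruhat_le n v a \<and> bruhat_le n a w}" "b \<in> {a. bruhat_le n v a \<and> bruhat_le n a w}" for a b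
      using that U[of a] U[of b] j R_poly_asc_comp[of "?s a" n b j] bruhat_le_permutes(1)[of n a w]
        bruhat_le_permutes(1)[of n b w] permutes_comp_adj[of a n j] by auto
    show "inversions n (?s w) + inversions n a = inversions n (?s a) + inversions n w"
      if "a \<in> {a. bruhat_le n v a \<and> bruhat_le n a w}" for a
      using that U[of a] asc j w bruhat_le_permutes(1)[of n a w] by (simp add: inversions_swap)
  qed (use w ws vw bruhat_le_refl[OF v] in auto)
qed

lemma KL_poly_move_row:
  assumes vw: "bruhat_le n v w"
    and j: "1 \<le> j" "j < n" and i: "i = j \<or> i = Suc j" and vi: "v i = c" and wi: "w i = c"
    and f1: "rank_count v (j - 1) c = rank_count w (j - 1) c"
    and f2: "rank_count v (Suc j) c = rank_count w (Suc j) c"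
  shows "KL_poly n (v \<circ> adj j) (w \<circ> adj j) = KL_poly n v w"
    and "bruhat_le n (v \<circ> adj j) (w \<circ> adj j)"
proof -
  note v = bruhat_le_permutes(1)[OF vw] and w = bruhat_le_permutes(2)[OF vw]
  have U: "v j < v (Suc j) \<longleftrightarrow> w j < w (Suc j)"
    using interval_uniform[OF v w j(1) i vi wi f1 f2 bruhat_le_refl[OF v] vw] .
  have *: "KL_poly n (v \<circ> adj j) (w \<circ> adj j) = KL_poly n v w \<and> bruhat_le n (v \<circ> adj j) (w \<circ> adj j)"
  proof (cases "w j < w (Suc j)")
    case True
    then show ?thesis using KL_poly_move_row_asc[OF assms] bruhat_le_both_asc[OF vw j] by simp
  next
    case False
    then have d: "w (Suc j) < w j" "v (Suc j) < v j"
      using U permutes_neq_Suc[OF v, of j] permutes_neq_Suc[OF w, of j] by auto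
    have le: "bruhat_le n (v \<circ> adj j) (w \<circ> adj j)" using d bruhat_le_both_desc[OF vw j] by simp
    have "KL_poly n (v \<circ> adj j \<circ> adj j) (w \<circ> adj j \<circ> adj j) = KL_poly n (v \<circ> adj j) (w \<circ> adj j)"
      using i vi wi f1 f2 d j
      by (intro KL_poly_move_row_asc[OF le j, of "adj j i" c]) (auto simp: rank_count_comp_adj)
    then show ?thesis using le by simp
  qed
  then show "KL_poly n (v \<circ> adj j) (w \<circ> adj j) = KL_poly n v w"
    and "bruhat_le n (v \<circ> adj j) (w \<circ> adj j)" by auto
qed

section \<open>Moving a common point to a corner\<close>

definition cyc_up :: "nat \<Rightarrow> nat \<Rightarrow> nat" where
  "cyc_up i k = (if k = 1 then i else if 2 \<le> k \<and> k \<le> i then k - 1 else k)"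

definition cyc_down :: "nat \<Rightarrow> nat \<Rightarrow> nat \<Rightarrow> nat" where
  "cyc_down n i k = (if k = n then i else if i \<le> k \<and> k < n then Suc k else k)"

text \<open>The common point climbs one row at a time; agreement of the ranks in its column from the
  top down to its row is what each swap requires.\<close>

lemma KL_poly_move_up:
  assumes "bruhat_le n v w" "1 \<le> i" "i \<le> n" "v i = c" "w i = c"
    and "\<And>p. p \<le> i \<Longrightarrow> rank_count v p c = rank_count w p c"
  shows "KL_poly n (v \<circ> cyc_up i) (w \<circ> cyc_up i) = KL_poly n v w \<and>
         bruhat_le n (v \<circ> cyc_up i) (w \<circ> cyc_up i)"
  using assms(2,1,3-)
proof (induction i arbitrary: v w rule: dec_induct)
  case base
  have "cyc_up 1 = id" by (auto simp: cyc_up_def fun_eq_iff)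
  then show ?case using base by simp
next
  case (step i)
  let ?s = "\<lambda>a. a \<circ> adj i"
  have f: "rank_count v (i - 1) c = rank_count w (i - 1) c"
    "rank_count v (Suc i) c = rank_count w (Suc i) c" using step.prems by auto
  have 1: "KL_poly n (?s v) (?s w) = KL_poly n v w" and le: "bruhat_le n (?s v) (?s w)"
    using KL_poly_move_row[OF step.prems(1), of i "Suc i" c] step f by auto
  \<comment> \<open>The swap changes the counts of row \<open>i\<close> only and puts the common
    point there, so both counts still agree.\<close>
  have "rank_count (?s v) p c = rank_count (?s w) p c" if "p \<le> i" for p
  proof (cases "p = i")
    case True
    obtain k where "i = Suc k" using step by (cases i) auto
    then show ?thesis
      using f True step.prems rank_count_comp_adj[of k i] by (simp add: rank_count_Suc)
  qed (use step that in \<open>simp add: rank_count_comp_adj\<close>)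
  then have "KL_poly n (?s v \<circ> cyc_up i) (?s w \<circ> cyc_up i) = KL_poly n (?s v) (?s w) \<and>
      bruhat_le n (?s v \<circ> cyc_up i) (?s w \<circ> cyc_up i)"
    using step.prems le by (intro step.IH) (auto simp: comp_def)
  moreover have "adj i \<circ> cyc_up i = cyc_up (Suc i)"
    using step by (auto simp: fun_eq_iff cyc_up_def transpose_def)
  ultimately have "KL_poly n (v \<circ> cyc_up (Suc i)) (w \<circ> cyc_up (Suc i)) = KL_poly n v w \<and>
      bruhat_le n (v \<circ> cyc_up (Suc i)) (w \<circ> cyc_up (Suc i))"
    using 1 by (simp add: comp_assoc)
  then show ?case by (simp add: comp_def)
qed

lemma KL_poly_move_down:
  assumes "bruhat_le n v w" "1 \<le> i" "i \<le> n" "v i = c" "w i = c"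
    and "\<And>p. i \<le> p \<Longrightarrow> rank_count v p c = rank_count w p c"
  shows "KL_poly n (v \<circ> cyc_down n i) (w \<circ> cyc_down n i) = KL_poly n v w \<and>
         bruhat_le n (v \<circ> cyc_down n i) (w \<circ> cyc_down n i)"
  using assms(3,1,2,4-)
proof (induction i arbitrary: v w rule: inc_induct)
  case base
  have "cyc_down n n = id" by (auto simp: cyc_down_def fun_eq_iff)
  then show ?case using base by simp
next
  case (step i)
  let ?s = "\<lambda>a. a \<circ> adj i"
  obtain k where k: "i = Suc k" using step by (cases i) auto
  have f: "rank_count v (i - 1) c = rank_count w (i - 1) c"
    "rank_count v (Suc i) c = rank_count w (Suc i) c"
    using step.prems(5)[of i] step.prems(5)[of "Suc i"] step.prems k by (auto simp: rank_count_Suc)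
  have 1: "KL_poly n (?s v) (?s w) = KL_poly n v w" and le: "bruhat_le n (?s v) (?s w)"
    using KL_poly_move_row[OF step.prems(1), of i i c] step f by auto
  have "rank_count (?s v) p c = rank_count (?s w) p c" if "Suc i \<le> p" for p
    using step that by (simp add: rank_count_comp_adj)
  then have "KL_poly n (?s v \<circ> cyc_down n (Suc i)) (?s w \<circ> cyc_down n (Suc i)) = KL_poly n (?s v) (?s w) \<and>
      bruhat_le n (?s v \<circ> cyc_down n (Suc i)) (?s w \<circ> cyc_down n (Suc i))"
    using step.prems le by (intro step.IH) (auto simp: comp_def)
  moreover have "adj i \<circ> cyc_down n (Suc i) = cyc_down n i"
    using step by (auto simp: fun_eq_iff cyc_down_def transpose_def)
  ultimately have "KL_poly n (v \<circ> cyc_down n i) (w \<circ> cyc_down n i) = KL_poly n v w \<and>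
      bruhat_le n (v \<circ> cyc_down n i) (w \<circ> cyc_down n i)"
    using 1 by (simp add: comp_assoc)
  then show ?case by (simp add: comp_def)
qed

definition icyc_up :: "nat \<Rightarrow> nat \<Rightarrow> nat" where
  "icyc_up c k = (if k = c then 1 else if 1 \<le> k \<and> k < c then Suc k else k)"

definition icyc_down :: "nat \<Rightarrow> nat \<Rightarrow> nat \<Rightarrow> nat" where
  "icyc_down n c k = (if k = c then n else if c < k \<and> k \<le> n then k - 1 else k)"

lemma inv_cyc_up: "1 \<le> c \<Longrightarrow> bij (cyc_up c) \<and> inv (cyc_up c) = icyc_up c"
proof -
  assume c: "1 \<le> c"
  have "icyc_up c \<circ> cyc_up c = id" "cyc_up c \<circ> icyc_up c = id"
    using c by (auto simp: fun_eq_iff cyc_up_def icyc_up_def)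
  then show ?thesis by (metis inv_unique_comp o_bij)
qed

lemma inv_cyc_down: "1 \<le> c \<Longrightarrow> c \<le> n \<Longrightarrow> bij (cyc_down n c) \<and> inv (cyc_down n c) = icyc_down n c"
proof -
  assume c: "1 \<le> c" "c \<le> n"
  have "icyc_down n c \<circ> cyc_down n c = id" "cyc_down n c \<circ> icyc_down n c = id"
    using c by (auto simp: fun_eq_iff cyc_down_def icyc_down_def)
  then show ?thesis by (metis inv_unique_comp o_bij)
qed

text \<open>Left multiplication is right multiplication of the inverses; in this way row moves also
  move columns.\<close>

lemma KL_poly_comp_inv:
  assumes "bruhat_le n (inv v \<circ> g) (inv w \<circ> g)" "bij g" "bruhat_le n v w"
    "KL_poly n (inv v \<circ> g) (inv w \<circ> g) = KL_poly n (inv v) (inv w)"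
  shows "KL_poly n (inv g \<circ> v) (inv g \<circ> w) = KL_poly n v w \<and> bruhat_le n (inv g \<circ> v) (inv g \<circ> w)"
proof -
  have e: "inv (inv x \<circ> g) = inv g \<circ> x" if "x permutes {1..n}" for x
    using that assms(2) permutes_bij[OF permutes_inv[OF that]] permutes_inv_inv[OF that]
    by (simp add: o_inv_distrib)
  note p = bruhat_le_permutes[OF assms(3)]
  show ?thesis
    using KL_poly_inv[OF bruhat_le_permutes[OF assms(1)]] bruhat_le_inv[OF assms(1)] assms(4)
      KL_poly_inv[OF p] by (simp add: e[OF p(1)] e[OF p(2)])
qed

lemma rank_count_last_row:
  assumes "w permutes {1..n}" "q \<le> n"
  shows "rank_count w n q = q"
proof -
  have "rank_count w n q = rank_count (inv w) q n" by (simp add: rank_count_inv[OF assms(1)])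
  also have "\<dots> = (\<Sum>i=1..q. 1)"
    unfolding rank_count_sum
  proof (intro sum.cong refl)
    fix i assume "i \<in> {1..q}"
    then have "inv w i \<in> {1..n}"
      using permutes_in_image[OF permutes_inv[OF assms(1)], of i] assms(2) by simp
    then show "of_bool (inv w i \<le> n) = (1 :: nat)" by simp
  qed
  finally show ?thesis by simp
qed

lemma rank_count_beyond:
  assumes "v permutes {1..n}" "w permutes {1..n}" "n \<le> p"
  shows "rank_count v p q = rank_count w p q"
proof (cases "q \<le> n")
  case True
  show ?thesis using assms(3)
  proof (induction p rule: dec_induct)
    case base
    then show ?case using rank_count_last_row assms True by simp
  next
    case (step k)
    then show ?case using assms(1,2) by (simp add: rank_count_Suc permutes_def)
  qed
next
  case False
  have "rank_count u p q = (\<Sum>i=1..p. of_bool (i \<le> q))" if "u permutes {1..n}" for u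
    unfolding rank_count_sum
  proof (intro sum.cong refl)
    fix i
    show "of_bool (u i \<le> q) = (of_bool (i \<le> q) :: nat)"
      using that False permutes_in_image[OF that, of i] permutes_not_in[OF that, of i]
      by (cases "i \<in> {1..n}") auto
  qed
  then show ?thesis using assms by simp
qed

text \<open>The point is first moved to the first or last row. There the ranks of both permutations
  agree in every column, so after inversion the condition for the second move, along the columns,
  holds automatically.\<close>

lemma KL_poly_corner:
  assumes vw: "bruhat_le n v w" and i: "1 \<le> i" "i \<le> n" and vi: "v i = c" and wi: "w i = c"
  shows "(\<And>p. p \<le> i \<Longrightarrow> rank_count v p c = rank_count w p c) \<Longrightarrow>
      KL_poly n (icyc_up c \<circ> v \<circ> cyc_up i) (icyc_up c \<circ> w \<circ> cyc_up i) = KL_poly n v w \<and>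
      bruhat_le n (icyc_up c \<circ> v \<circ> cyc_up i) (icyc_up c \<circ> w \<circ> cyc_up i)"
    and "(\<And>p. i \<le> p \<Longrightarrow> rank_count v p c = rank_count w p c) \<Longrightarrow>
      KL_poly n (icyc_down n c \<circ> v \<circ> cyc_down n i) (icyc_down n c \<circ> w \<circ> cyc_down n i) = KL_poly n v w \<and>
      bruhat_le n (icyc_down n c \<circ> v \<circ> cyc_down n i) (icyc_down n c \<circ> w \<circ> cyc_down n i)"
proof -
  have c: "1 \<le> c" "c \<le> n" using permutes_in_image[OF bruhat_le_permutes(2)[OF vw], of i] i wi by auto
  {
    assume f: "\<And>p. p \<le> i \<Longrightarrow> rank_count v p c = rank_count w p c"
    define v1 where "v1 = v \<circ> cyc_up i"
    define w1 where "w1 = w \<circ> cyc_up i"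
    have 1: "KL_poly n v1 w1 = KL_poly n v w" and le: "bruhat_le n v1 w1"
      using KL_poly_move_up[OF vw i vi wi f] by (auto simp: v1_def w1_def)
    note p = bruhat_le_permutes[OF le]
    have v11: "v1 1 = c" "w1 1 = c" using vi wi by (auto simp: v1_def w1_def cyc_up_def)
    then have ic: "inv v1 c = 1" "inv w1 c = 1" using permutes_inv_eq[OF p(1)] permutes_inv_eq[OF p(2)] by auto
    have r: "rank_count (inv v1) q 1 = rank_count (inv w1) q 1" for q
      using v11 rank_count_Suc[of v1 0 q] rank_count_Suc[of w1 0 q]
      by (simp add: rank_count_inv[OF p(1)] rank_count_inv[OF p(2)] One_nat_def)
    have "KL_poly n (inv v1 \<circ> cyc_up c) (inv w1 \<circ> cyc_up c) = KL_poly n (inv v1) (inv w1) \<and>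
        bruhat_le n (inv v1 \<circ> cyc_up c) (inv w1 \<circ> cyc_up c)"
      using bruhat_le_inv[OF le] c ic r by (intro KL_poly_move_up) auto
    then have "KL_poly n (inv (cyc_up c) \<circ> v1) (inv (cyc_up c) \<circ> w1) = KL_poly n v1 w1 \<and>
        bruhat_le n (inv (cyc_up c) \<circ> v1) (inv (cyc_up c) \<circ> w1)"
      using inv_cyc_up[OF c(1)] le by (intro KL_poly_comp_inv) auto
    then show "KL_poly n (icyc_up c \<circ> v \<circ> cyc_up i) (icyc_up c \<circ> w \<circ> cyc_up i) = KL_poly n v w \<and>
      bruhat_le n (icyc_up c \<circ> v \<circ> cyc_up i) (icyc_up c \<circ> w \<circ> cyc_up i)"
      using inv_cyc_up[OF c(1)] 1 by (simp add: v1_def w1_def comp_assoc)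
  next
    assume f: "\<And>p. i \<le> p \<Longrightarrow> rank_count v p c = rank_count w p c"
    define v1 where "v1 = v \<circ> cyc_down n i"
    define w1 where "w1 = w \<circ> cyc_down n i"
    have 1: "KL_poly n v1 w1 = KL_poly n v w" and le: "bruhat_le n v1 w1"
      using KL_poly_move_down[OF vw i vi wi f] by (auto simp: v1_def w1_def)
    note p = bruhat_le_permutes[OF le]
    have v11: "v1 n = c" "w1 n = c" using vi wi by (auto simp: v1_def w1_def cyc_down_def)
    then have ic: "inv v1 c = n" "inv w1 c = n" using permutes_inv_eq[OF p(1)] permutes_inv_eq[OF p(2)] by auto
    have r: "rank_count (inv v1) q n = rank_count (inv w1) q n" for q
      using rank_count_beyond[OF p, of n q] by (simp add: rank_count_inv[OF p(1)] rank_count_inv[OF p(2)])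
    have "KL_poly n (inv v1 \<circ> cyc_down n c) (inv w1 \<circ> cyc_down n c) = KL_poly n (inv v1) (inv w1) \<and>
        bruhat_le n (inv v1 \<circ> cyc_down n c) (inv w1 \<circ> cyc_down n c)"
      using bruhat_le_inv[OF le] c ic r by (intro KL_poly_move_down) auto
    then have "KL_poly n (inv (cyc_down n c) \<circ> v1) (inv (cyc_down n c) \<circ> w1) = KL_poly n v1 w1 \<and>
        bruhat_le n (inv (cyc_down n c) \<circ> v1) (inv (cyc_down n c) \<circ> w1)"
      using inv_cyc_down[OF c] le by (intro KL_poly_comp_inv) auto
    then show "KL_poly n (icyc_down n c \<circ> v \<circ> cyc_down n i) (icyc_down n c \<circ> w \<circ> cyc_down n i) = KL_poly n v w \<and>
      bruhat_le n (icyc_down n c \<circ> v \<circ> cyc_down n i) (icyc_down n c \<circ> w \<circ> cyc_down n i)"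
      using inv_cyc_down[OF c] 1 by (simp add: v1_def w1_def comp_assoc)
  }
qed

subsection \<open>Removing a corner\<close>

lemma permutes_Suc: "u permutes {1..n} \<Longrightarrow> u permutes {1..Suc n}"
  by (erule permutes_subset) auto

lemma inversions_restrict:
  assumes "u permutes {1..n}"
  shows "inversions (Suc n) u = inversions n u"
proof -
  have "{(i, j). i \<in> {1..Suc n} \<and> j \<in> {1..Suc n} \<and> i < j \<and> u j < u i} =
        {(i, j). i \<in> {1..n} \<and> j \<in> {1..n} \<and> i < j \<and> u j < u i}"
  proof -
    have un: "u (Suc n) = Suc n" using assms by (simp add: permutes_def)
    have ub: "u i \<le> n" if "i \<in> {1..n}" for i using permutes_in_image[OF assms, of i] that by auto
    have "j \<noteq> Suc n" if "i \<in> {1..Suc n}" "i < j" "u j < u i" for i j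
    proof
      assume "j = Suc n"
      then have "i \<in> {1..n}" using that by auto
      from ub[OF this] show False using \<open>j = Suc n\<close> that(3) un by simp
    qed
    then show ?thesis by (auto simp: le_Suc_eq)
  qed
  then show ?thesis unfolding inversions_alt by simp
qed

lemma bruhat_le_restrict:
  assumes "u permutes {1..n}" "w permutes {1..n}"
  shows "bruhat_le (Suc n) u w \<longleftrightarrow> bruhat_le n u w"
  using assms permutes_Suc by (auto simp: bruhat_le_iff)

text \<open>The R-polynomials of the larger group satisfy the recursion that characterises those of
  the smaller one.\<close>

lemma R_poly_restrict:
  assumes "u permutes {1..n}" "w permutes {1..n}"
  shows "R_poly (Suc n) u w = R_poly n u w"
proof -
  have "R_family n (R_poly (Suc n))"
    unfolding R_family_def Let_def
  proof (intro allI impI conjI)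
    fix u w assume u: "u permutes {1..n}" and w: "w permutes {1..n}"
    note u' = permutes_Suc[OF u] and w' = permutes_Suc[OF w]
    {
      assume "\<not> bruhat_le n u w"
      then show "R_poly (Suc n) u w = 0" using u w u' w' by (simp add: R_poly_zero bruhat_le_restrict)
    next
      assume "u = w"
      then show "R_poly (Suc n) u w = 1" using w' by simp
    next
      fix i assume "right_descent n w i"
      then have d: "desc (Suc n) w i" and i: "i < n" "1 \<le> i" using w by (auto simp: right_descent_iff desc_def)
      have "right_descent n u i \<longleftrightarrow> u (Suc i) < u i" using u i by (simp add: right_descent_iff)
      then show "R_poly (Suc n) u w = (if right_descent n u i then R_poly (Suc n) (u \<circ> adj i) (w \<circ> adj i)
        else [:0, 1:] * R_poly (Suc n) (u \<circ> adj i) (w \<circ> adj i) + [:- 1, 1:] * R_poly (Suc n) u (w \<circ> adj i))"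
        using R_poly_desc[OF w' u' d] by simp
    }
  qed
  from R_poly_unique[OF this assms(2,1)] show ?thesis by simp
qed

lemma KL_poly_restrict:
  assumes u: "u permutes {1..n}" and w: "w permutes {1..n}" and uw: "bruhat_le n u w"
  shows "KL_poly (Suc n) u w = KL_poly n u w"
proof -
  \<comment> \<open>The rank at \<open>(n, n)\<close> is \<open>n\<close> at both ends of the
    interval, hence throughout, which forces \<open>Suc n\<close> to be fixed.\<close>
  have pn: "a permutes {1..n}" if "bruhat_le (Suc n) u a" "bruhat_le (Suc n) a w" for a
  proof -
    have a: "a permutes {1..Suc n}" using that bruhat_le_permutes by blast
    have "rank_count a n n = n"
      using that rank_count_last_row[OF u order_refl] rank_count_last_row[OF w order_refl]
      by (auto simp: bruhat_le_iff rank_le_def intro!: order_antisym elim: allE[of _ n])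
        (metis order_trans)+
    moreover have "rank_count a (Suc n) n = n" using rank_count_last_row[OF a] by simp
    ultimately have "\<not> a (Suc n) \<le> n" by (auto simp: rank_count_Suc)
    moreover have "a (Suc n) \<in> {1..Suc n}" using permutes_in_image[OF a, of "Suc n"] by simp
    ultimately have "a (Suc n) = Suc n" by auto
    then show ?thesis
      using a by (intro permutes_superset[OF a]) (auto simp: le_Suc_eq)
  qed
  have "KL_poly (Suc n) (id u) (id w) = KL_poly n u w"
  proof (rule KL_poly_transfer[where f = id and u = u and u' = u])
    have "{a. bruhat_le n u a \<and> bruhat_le n a w} = {a. bruhat_le (Suc n) u a \<and> bruhat_le (Suc n) a w}"
      using pn bruhat_le_restrict u w bruhat_le_permutes by blast
    then show "bij_betw id {a. bruhat_le n u a \<and> bruhat_le n a w} {a. bruhat_le (Suc n) u a \<and> bruhat_le (Suc n) a (id w)}"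
      by simp
    show "R_poly (Suc n) (id a) (id b) = R_poly n a b"
      if "a \<in> {a. bruhat_le n u a \<and> bruhat_le n a w}" "b \<in> {a. bruhat_le n u a \<and> bruhat_le n a w}" for a b
      using that bruhat_le_permutes(1)[of n a w] bruhat_le_permutes(1)[of n b w] by (simp add: R_poly_restrict)
    show "inversions (Suc n) (id w) + inversions n a = inversions (Suc n) (id a) + inversions n w"
      if "a \<in> {a. bruhat_le n u a \<and> bruhat_le n a w}" for a
      using that w bruhat_le_permutes(1)[of n a w] by (simp add: inversions_restrict)
  qed (use u w uw permutes_Suc bruhat_le_refl in auto)
  then show ?thesis by simp
qed

text \<open>Inserts a fixed point 1 in front: a permutation of \<open>{1..n}\<close> fixes 0, so
  \<open>shift u\<close> maps 1 to 1.\<close>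

definition shift :: "(nat \<Rightarrow> nat) \<Rightarrow> nat \<Rightarrow> nat" where
  "shift u k = (case k of 0 \<Rightarrow> 0 | Suc k \<Rightarrow> Suc (u k))"

lemma shift_simps [simp]: "shift u 0 = 0" "shift u (Suc k) = Suc (u k)"
  by (auto simp: shift_def)

lemma permutes_0: "u permutes {1..n} \<Longrightarrow> u 0 = (0::nat)"
  using permutes_not_in[of u "{1..n}" 0] by (simp add: One_nat_def)

lemma permutesI_inj:
  assumes "finite S" "inj_on u S" "\<And>x. x \<in> S \<Longrightarrow> u x \<in> S" "\<And>x. x \<notin> S \<Longrightarrow> u x = x"
  shows "u permutes S"
proof (rule bij_imp_permutes)
  have "u ` S = S" using assms by (intro endo_inj_surj) auto
  then show "bij_betw u S S" using assms(2) by (simp add: bij_betw_def)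
qed (use assms in auto)

lemma shift_permutes:
  assumes "u permutes {1..n}"
  shows "shift u permutes {1..Suc n}"
proof (rule permutesI_inj)
  show "inj_on (shift u) {1..Suc n}"
  proof (rule inj_onI)
    fix a b assume "a \<in> {1..Suc n}" "b \<in> {1..Suc n}" "shift u a = shift u b"
    then show "a = b" using permutes_inj[OF assms] by (cases a; cases b) (auto simp: inj_eq)
  qed
  show "shift u x \<in> {1..Suc n}" if "x \<in> {1..Suc n}" for x
    using that permutes_in_image[OF assms, of "x - 1"] permutes_0[OF assms]
    by (cases x; cases "x = 1") (auto simp: One_nat_def)
  show "shift u x = x" if "x \<notin> {1..Suc n}" for x
    using that assms by (cases x) (auto simp: permutes_def)
qed simp

lemma shift_comp_adj: "u permutes {1..n} \<Longrightarrow> 1 \<le> i \<Longrightarrow> shift u \<circ> adj (Suc i) = shift (u \<circ> adj i)"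
  by (auto simp: fun_eq_iff shift_def transpose_def split: nat.splits)

lemma inversions_shift:
  assumes "u permutes {1..n}"
  shows "inversions (Suc n) (shift u) = inversions n u"
proof -
  have "bij_betw (\<lambda>(i, j). (Suc i, Suc j)) {(i, j). 1 \<le> i \<and> i < j \<and> j \<le> n \<and> u j < u i}
    {(i, j). 1 \<le> i \<and> i < j \<and> j \<le> Suc n \<and> shift u j < shift u i}"
  proof (rule bij_betwI[where g = "\<lambda>(i, j). (i - 1, j - 1)"])
    show "(\<lambda>(i, j). (i - 1, j - 1)) \<in> {(i, j). 1 \<le> i \<and> i < j \<and> j \<le> Suc n \<and> shift u j < shift u i} \<rightarrow>
      {(i, j). 1 \<le> i \<and> i < j \<and> j \<le> n \<and> u j < u i}"
    proof clarify
      fix i j assume "1 \<le> i" "i < j" "j \<le> Suc n" "shift u j < shift u i"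
      then show "1 \<le> i - 1 \<and> i - 1 < j - 1 \<and> j - 1 \<le> n \<and> u (j - 1) < u (i - 1)"
        using permutes_0[OF assms] by (cases i; cases j; cases "i = 1") (auto simp: One_nat_def Suc_le_eq)
    qed
  qed auto
  then show ?thesis unfolding inversions_def by (simp add: bij_betw_same_card)
qed

lemma rank_count_shift:
  assumes "u permutes {1..n}"
  shows "rank_count (shift u) (Suc p) (Suc q) = Suc (rank_count u p q)"
    and "rank_count (shift u) p 0 = 0"
proof -
  show "rank_count (shift u) (Suc p) (Suc q) = Suc (rank_count u p q)"
    by (induction p) (simp_all add: rank_count_Suc permutes_0[OF assms])
  show "rank_count (shift u) p 0 = 0"
    by (induction p) (simp_all add: rank_count_Suc)
qed

lemma bruhat_le_shift:
  assumes "u permutes {1..n}" "w permutes {1..n}"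
  shows "bruhat_le (Suc n) (shift u) (shift w) \<longleftrightarrow> bruhat_le n u w"
proof -
  have "rank_le (shift u) (shift w) \<longleftrightarrow> rank_le u w"
    unfolding rank_le_def
  proof
    assume *: "\<forall>p q. rank_count (shift w) p q \<le> rank_count (shift u) p q"
    show "\<forall>p q. rank_count w p q \<le> rank_count u p q"
    proof (intro allI)
      fix p q show "rank_count w p q \<le> rank_count u p q"
        using *[rule_format, of "Suc p" "Suc q"]
        by (simp add: rank_count_shift[OF assms(1)] rank_count_shift[OF assms(2)])
    qed
  next
    assume *: "\<forall>p q. rank_count w p q \<le> rank_count u p q"
    show "\<forall>p q. rank_count (shift w) p q \<le> rank_count (shift u) p q"
    proof (intro allI)
      fix p q show "rank_count (shift w) p q \<le> rank_count (shift u) p q"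
        using * by (cases p; cases q) (auto simp: rank_count_shift[OF assms(1)] rank_count_shift[OF assms(2)])
    qed
  qed
  then show ?thesis using assms shift_permutes by (auto simp: bruhat_le_iff)
qed

lemma R_poly_shift:
  assumes "u permutes {1..n}" "w permutes {1..n}"
  shows "R_poly (Suc n) (shift u) (shift w) = R_poly n u w"
proof -
  have "R_family n (\<lambda>u w. R_poly (Suc n) (shift u) (shift w))"
    unfolding R_family_def Let_def
  proof (intro allI impI conjI)
    fix u w assume u: "u permutes {1..n}" and w: "w permutes {1..n}"
    note u' = shift_permutes[OF u] and w' = shift_permutes[OF w]
    {
      assume "\<not> bruhat_le n u w"
      then show "R_poly (Suc n) (shift u) (shift w) = 0" using u w u' w' by (simp add: R_poly_zero bruhat_le_shift)
    next
      assume "u = w"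
      then show "R_poly (Suc n) (shift u) (shift w) = 1" using w' by simp
    next
      fix i assume "right_descent n w i"
      then have d: "desc (Suc n) (shift w) (Suc i)" and i: "i < n" "1 \<le> i" using w by (auto simp: right_descent_iff desc_def)
      have "right_descent n u i \<longleftrightarrow> shift u (Suc (Suc i)) < shift u (Suc i)" using u i by (simp add: right_descent_iff)
      then show "R_poly (Suc n) (shift u) (shift w) =
        (if right_descent n u i then R_poly (Suc n) (shift (u \<circ> adj i)) (shift (w \<circ> adj i))
        else [:0, 1:] * R_poly (Suc n) (shift (u \<circ> adj i)) (shift (w \<circ> adj i)) +
          [:- 1, 1:] * R_poly (Suc n) (shift u) (shift (w \<circ> adj i)))"
        using R_poly_desc[OF w' u' d] unfolding shift_comp_adj[OF u i(2)] shift_comp_adj[OF w i(2)] by simp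
    }
  qed
  from R_poly_unique[OF this assms(2,1)] show ?thesis by simp
qed

lemma KL_poly_shift:
  assumes u: "u permutes {1..n}" and w: "w permutes {1..n}" and uw: "bruhat_le n u w"
  shows "KL_poly (Suc n) (shift u) (shift w) = KL_poly n u w"
proof -
  define un where "un a k = a (Suc k) - 1" for a :: "nat \<Rightarrow> nat" and k
  \<comment> \<open>The rank of \<open>shift w\<close> at \<open>(1, 1)\<close> is 1, so every
    element of the interval fixes 1 and comes from a permutation of \<open>{1..n}\<close>.\<close>
  have un: "un a permutes {1..n} \<and> shift (un a) = a"
    if "bruhat_le (Suc n) (shift u) a" "bruhat_le (Suc n) a (shift w)" for a
  proof -
    have a: "a permutes {1..Suc n}" using that bruhat_le_permutes by blast
    have "rank_count a 1 1 \<ge> rank_count (shift w) 1 1"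
      using that by (auto simp: bruhat_le_iff rank_le_def)
    then have "a 1 \<le> 1" using permutes_0[OF w] by (auto simp: One_nat_def rank_count_Suc of_bool_def split: if_splits)
    moreover have "a 1 \<in> {1..Suc n}" using permutes_in_image[OF a, of 1] by simp
    ultimately have a1: "a 1 = 1" by auto
    have pos: "a (Suc k) \<ge> 1" for k
      using permutes_in_image[OF a, of "Suc k"] permutes_not_in[OF a, of "Suc k"] by (cases "Suc k \<in> {1..Suc n}") auto
    have sh: "shift (un a) = a"
    proof
      fix k show "shift (un a) k = a k"
        using pos[of "k - 1"] permutes_0[OF a] by (cases k) (auto simp: un_def)
    qed
    have "un a permutes {1..n}"
    proof (rule permutesI_inj)
      show "inj_on (un a) {1..n}"
    proof (rule inj_onI)
        fix x y assume "un a x = un a y"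
        then have "a (Suc x) = a (Suc y)" using pos[of x] pos[of y] by (simp add: un_def)
        then show "x = y" using permutes_inj[OF a] by (simp add: inj_eq)
      qed
      show "un a x \<in> {1..n}" if "x \<in> {1..n}" for x
      proof -
        have "a (Suc x) \<noteq> a 1" using that permutes_inj[OF a] by (auto simp: inj_eq)
        moreover have "a (Suc x) \<in> {1..Suc n}" using that permutes_in_image[OF a, of "Suc x"] by simp
        ultimately show ?thesis using a1 by (auto simp: un_def)
      qed
      show "un a x = x" if "x \<notin> {1..n}" for x
        using that a a1 by (cases x) (auto simp: un_def permutes_def One_nat_def)
    qed simp
    then show ?thesis using sh by simp
  qed
  have inj: "a = b" if "shift a = shift b" for a b
    using that by (metis ext nat.inject shift_simps(2))
  have bij: "bij_betw shift {a. bruhat_le n u a \<and> bruhat_le n a w} {a. bruhat_le (Suc n) (shift u) a \<and> bruhat_le (Suc n) a (shift w)}"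
  proof (rule bij_betwI[where g = un])
    show "shift \<in> {a. bruhat_le n u a \<and> bruhat_le n a w} \<rightarrow> {a. bruhat_le (Suc n) (shift u) a \<and> bruhat_le (Suc n) a (shift w)}"
    proof clarify
      fix a assume "bruhat_le n u a" "bruhat_le n a w"
      then show "bruhat_le (Suc n) (shift u) (shift a) \<and> bruhat_le (Suc n) (shift a) (shift w)"
        using bruhat_le_permutes(1)[of n a w] by (simp add: bruhat_le_shift u w)
    qed
    show "un \<in> {a. bruhat_le (Suc n) (shift u) a \<and> bruhat_le (Suc n) a (shift w)} \<rightarrow> {a. bruhat_le n u a \<and> bruhat_le n a w}"
    proof
      fix a assume "a \<in> {a. bruhat_le (Suc n) (shift u) a \<and> bruhat_le (Suc n) a (shift w)}"
      then show "un a \<in> {a. bruhat_le n u a \<and> bruhat_le n a w}"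
        using un[of a] bruhat_le_shift[OF u, of "un a"] bruhat_le_shift[OF _ w, of "un a"] by auto
    qed
    show "un (shift a) = a" for a by (simp add: un_def fun_eq_iff)
  qed (use un in auto)
  show ?thesis
  proof (rule KL_poly_transfer[OF w shift_permutes[OF w] bij])
    show "R_poly (Suc n) (shift a) (shift b) = R_poly n a b"
      if "a \<in> {a. bruhat_le n u a \<and> bruhat_le n a w}" "b \<in> {a. bruhat_le n u a \<and> bruhat_le n a w}" for a b
      using that bruhat_le_permutes(1)[of n a w] bruhat_le_permutes(1)[of n b w] by (simp add: R_poly_shift)
    show "inversions (Suc n) (shift w) + inversions n a = inversions (Suc n) (shift a) + inversions n w"
      if "a \<in> {a. bruhat_le n u a \<and> bruhat_le n a w}" for a
      using that w bruhat_le_permutes(1)[of n a w] by (simp add: inversions_shift)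
  qed (use u uw bruhat_le_refl in auto)
qed

subsection \<open>Deleting a point\<close>

text \<open>\<open>skip i\<close> enumerates the numbers other than \<open>i\<close> in increasing
  order, and \<open>squash i\<close> undoes it; \<open>del\<close> below is the standardised
  permutation without the point \<open>(i, c)\<close>.\<close>

definition skip :: "nat \<Rightarrow> nat \<Rightarrow> nat" where
  "skip i k = (if k < i then k else Suc k)"

definition squash :: "nat \<Rightarrow> nat \<Rightarrow> nat" where
  "squash c z = (if z < c then z else z - 1)"

definition del :: "nat \<Rightarrow> nat \<Rightarrow> nat \<Rightarrow> (nat \<Rightarrow> nat) \<Rightarrow> nat \<Rightarrow> nat" where
  "del n i c v k = (if 1 \<le> k \<and> k \<le> n then squash c (v (skip i k)) else k)"

lemma squash_le_iff: "y \<noteq> c \<Longrightarrow> z \<noteq> c \<Longrightarrow> squash c y \<le> squash c z \<longleftrightarrow> y \<le> z"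
  by (auto simp: squash_def)

lemma squash_less_iff: "y \<noteq> c \<Longrightarrow> z \<noteq> c \<Longrightarrow> squash c y < squash c z \<longleftrightarrow> y < z"
  by (auto simp: squash_def)

lemma squash_eq_iff: "y \<noteq> c \<Longrightarrow> z \<noteq> c \<Longrightarrow> squash c y = squash c z \<longleftrightarrow> y = z"
  by (auto simp: squash_def)

lemma skip_squash: "k \<noteq> i \<Longrightarrow> skip i (squash i k) = k"
  by (auto simp: skip_def squash_def)

lemma squash_skip: "squash i (skip i k) = k"
  by (auto simp: skip_def squash_def)

lemma skip_neq: "skip i k \<noteq> i"
  by (auto simp: skip_def)

lemma del_permutes:
  assumes "v permutes {1..Suc n}" "v i = c" "i \<in> {1..Suc n}"
  shows "del n i c v permutes {1..n}"
proof (rule permutesI_inj)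
  have ne: "v (skip i k) \<noteq> c" for k
    using assms(2) skip_neq permutes_inj[OF assms(1)] by (metis injD)
  have c: "c \<in> {1..Suc n}" using permutes_in_image[OF assms(1), of i] assms(2,3) by simp
  show "inj_on (del n i c v) {1..n}"
  proof (rule inj_onI)
    fix x y assume xy: "x \<in> {1..n}" "y \<in> {1..n}" "del n i c v x = del n i c v y"
    then have "v (skip i x) = v (skip i y)" using ne by (auto simp: del_def squash_eq_iff)
    then have "skip i x = skip i y" using permutes_inj[OF assms(1)] by (metis injD)
    then show "x = y" by (metis squash_skip)
  qed
  show "del n i c v x \<in> {1..n}" if "x \<in> {1..n}" for x
  proof -
    have "skip i x \<in> {1..Suc n}" using that assms(3) by (auto simp: skip_def)
    then have "v (skip i x) \<in> {1..Suc n}" using permutes_in_image[OF assms(1)] by blast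
    then show ?thesis using that ne[of x] c by (auto simp: del_def squash_def)
  qed
qed (auto simp: del_def)

text \<open>The deleted point gives the same correction for \<open>v\<close> and \<open>w\<close>,
  so minimality survives the deletion of a common point.\<close>

lemma rank_count_del:
  assumes "v permutes {1..Suc n}" "v i = c" "1 \<le> i" "q \<noteq> c" "k \<le> n"
  shows "rank_count (del n i c v) k (squash c q) + of_bool (i \<le> k \<and> c \<le> q) = rank_count v (skip i k) q"
  using assms(5)
proof (induction k)
  case (Suc k)
  have ne: "v (skip i k) \<noteq> c" for k
    using assms(2) skip_neq permutes_inj[OF assms(1)] by (metis injD)
  have e: "del n i c v (Suc k) \<le> squash c q \<longleftrightarrow> v (skip i (Suc k)) \<le> q"
    using Suc ne[of "Suc k"] assms(4) by (simp add: del_def squash_le_iff)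
  consider "Suc k < i" | "Suc k = i" | "i < Suc k" by linarith
  then show ?case
  proof cases
    case 2
    then have "skip i k = k" "skip i (Suc k) = Suc (Suc k)" by (auto simp: skip_def)
    then show ?thesis using Suc e assms(2) unfolding 2[symmetric] by (simp add: rank_count_Suc)
  qed (use Suc e in \<open>auto simp: rank_count_Suc skip_def\<close>)
qed (use assms in \<open>simp add: skip_def\<close>)

text \<open>According to the side on which the ranks agree, the point goes to the upper left or the
  lower right corner. There it is a first or last fixed point, which \<open>KL_poly_shift\<close> or
  \<open>KL_poly_restrict\<close> strips off.\<close>

lemma KL_poly_del:
  assumes vw: "bruhat_le (Suc n) v w" and i: "i \<in> {1..Suc n}" and vi: "v i = c" and wi: "w i = c"
    and f: "(\<forall>p\<le>i. rank_count v p c = rank_count w p c) \<or> (\<forall>p\<ge>i. rank_count v p c = rank_count w p c)"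
  shows "KL_poly (Suc n) v w = KL_poly n (del n i c v) (del n i c w)"
proof -
  note v = bruhat_le_permutes(1)[OF vw] and w = bruhat_le_permutes(2)[OF vw]
  have i1: "1 \<le> i" "i \<le> Suc n" using i by auto
  have c: "c \<in> {1..Suc n}" using i wi permutes_in_image[OF w] by blast
  have ne: "u (skip i k) \<noteq> c" if "u permutes {1..Suc n}" "u i = c" for u k
    using that skip_neq permutes_inj[OF that(1)] by (metis injD)
  have rng: "u (skip i k) \<in> {1..Suc n}" if "u permutes {1..Suc n}" "1 \<le> k" "k \<le> n" for u k
  proof -
    have "skip i k \<in> {1..Suc n}" using that i1 by (auto simp: skip_def)
    then show ?thesis using permutes_in_image[OF that(1)] by blast
  qed
  note dv = del_permutes[OF v vi i] and dw = del_permutes[OF w wi i]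
  from f show ?thesis
  proof
    assume "\<forall>p\<le>i. rank_count v p c = rank_count w p c"
    then have *: "KL_poly (Suc n) (icyc_up c \<circ> v \<circ> cyc_up i) (icyc_up c \<circ> w \<circ> cyc_up i) = KL_poly (Suc n) v w \<and>
      bruhat_le (Suc n) (icyc_up c \<circ> v \<circ> cyc_up i) (icyc_up c \<circ> w \<circ> cyc_up i)"
      using KL_poly_corner(1)[OF vw i1 vi wi] by blast
    have e: "icyc_up c \<circ> u \<circ> cyc_up i = shift (del n i c u)" if u: "u permutes {1..Suc n}" "u i = c" for u
    proof
      fix k
      consider "k = 0" | "k = 1" | k' where "k = Suc k'" "1 \<le> k'" "k' \<le> n" | k' where "k = Suc k'" "n < k'"
        by (metis One_nat_def Suc_leI less_eq_nat.simps(1) linorder_not_le not0_implies_Suc not_gr0)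
      then show "(icyc_up c \<circ> u \<circ> cyc_up i) k = shift (del n i c u) k"
      proof cases
        case 1
        then show ?thesis using permutes_0[OF u(1)] c by (auto simp: cyc_up_def icyc_up_def)
      next
        case 2
        then show ?thesis using u by (simp add: cyc_up_def icyc_up_def del_def One_nat_def)
      next
        case 3
        have "cyc_up i k = skip i k'" using 3 by (auto simp: cyc_up_def skip_def)
        moreover have "icyc_up c z = Suc (squash c z)" if "z \<noteq> c" "1 \<le> z" for z
          using that by (auto simp: icyc_up_def squash_def)
        ultimately show ?thesis using 3 ne[OF u, of k'] rng[OF u(1), of k'] by (simp add: del_def)
      next
        case 4
        then have "cyc_up i k = k" "u k = k" using i1 u(1) by (auto simp: cyc_up_def permutes_def)
        then show ?thesis using 4 c by (auto simp: icyc_up_def del_def)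
      qed
    qed
    have "bruhat_le n (del n i c v) (del n i c w)"
      using * by (simp add: e[OF v vi] e[OF w wi] bruhat_le_shift dv dw)
    then show ?thesis using * KL_poly_shift[OF dv dw] by (simp add: e[OF v vi] e[OF w wi])
  next
    assume "\<forall>p\<ge>i. rank_count v p c = rank_count w p c"
    then have *: "KL_poly (Suc n) (icyc_down (Suc n) c \<circ> v \<circ> cyc_down (Suc n) i) (icyc_down (Suc n) c \<circ> w \<circ> cyc_down (Suc n) i) =
      KL_poly (Suc n) v w \<and>
      bruhat_le (Suc n) (icyc_down (Suc n) c \<circ> v \<circ> cyc_down (Suc n) i) (icyc_down (Suc n) c \<circ> w \<circ> cyc_down (Suc n) i)"
      using KL_poly_corner(2)[OF vw i1 vi wi] by blast
    have e: "icyc_down (Suc n) c \<circ> u \<circ> cyc_down (Suc n) i = del n i c u" if u: "u permutes {1..Suc n}" "u i = c" for u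
    proof
      fix k
      consider "k = 0" | "k = Suc n" | "1 \<le> k" "k \<le> n" | "Suc n < k" by linarith
      then show "(icyc_down (Suc n) c \<circ> u \<circ> cyc_down (Suc n) i) k = del n i c u k"
      proof cases
        case 1
        then show ?thesis using permutes_0[OF u(1)] c i1 by (auto simp: cyc_down_def icyc_down_def del_def)
      next
        case 2
        then show ?thesis using u by (simp add: cyc_down_def icyc_down_def del_def)
      next
        case 3
        have "cyc_down (Suc n) i k = skip i k" using 3 by (auto simp: cyc_down_def skip_def)
        moreover have "icyc_down (Suc n) c z = squash c z" if "z \<noteq> c" "z \<le> Suc n" for z
          using that by (auto simp: icyc_down_def squash_def)
        ultimately show ?thesis using 3 ne[OF u, of k] rng[OF u(1), of k] by (simp add: del_def)
      next
        case 4
        then have "cyc_down (Suc n) i k = k" "u k = k" using u(1) by (auto simp: cyc_down_def permutes_def)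
        then show ?thesis using 4 c by (auto simp: icyc_down_def del_def)
      qed
    qed
    have "bruhat_le n (del n i c v) (del n i c w)"
      using * by (simp add: e[OF v vi] e[OF w wi] bruhat_le_restrict dv dw)
    then show ?thesis using * KL_poly_restrict[OF dv dw] by (simp add: e[OF v vi] e[OF w wi])
  qed
qed

text \<open>In every column \<open>r\<^sub>v - r\<^sub>w\<close> increases from \<open>0\<close> up to row \<open>T\<close> and decreases to \<open>0\<close> afterwards.
  So a point where it vanishes can be moved up or down without meeting the region where
  \<open>r\<^sub>v > r\<^sub>w\<close>.\<close>

lemma crossing_rank:
  assumes v: "v permutes {1..n}" and w: "w permutes {1..n}"
    and up: "\<And>i. i \<le> T \<Longrightarrow> v i \<le> w i" and down: "\<And>i. T < i \<Longrightarrow> w i \<le> v i"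
  shows "rank_le v w"
    and "rank_count v i q \<le> rank_count w i q \<Longrightarrow>
      (\<forall>p\<le>i. rank_count v p q = rank_count w p q) \<or> (\<forall>p\<ge>i. rank_count v p q = rank_count w p q)"
proof -
  have D1: "rank_count w p' q + rank_count v p q \<le> rank_count v p' q + rank_count w p q"
    if "p \<le> p'" "p' \<le> T" for p p' q
    using that
  proof (induction p' rule: dec_induct)
    case (step k)
    then show ?case using up[of "Suc k"] by (auto simp: rank_count_Suc of_bool_def)
  qed simp
  have D2: "rank_count v p' q + rank_count w p q \<le> rank_count w p' q + rank_count v p q"
    if "p \<le> p'" "T \<le> p" for p p' q
    using that
  proof (induction p' rule: dec_induct)
    case (step k)
    then show ?case using down[of "Suc k"] by (auto simp: rank_count_Suc of_bool_def)
  qed simp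
  have le: "rank_count w p q \<le> rank_count v p q" for p q
  proof (cases "p \<le> T")
    case True
    then show ?thesis using D1[of 0 p q] by simp
  next
    case False
    then show ?thesis using D2[of p "max n p" q] rank_count_beyond[OF v w, of "max n p" q] by simp
  qed
  then show "rank_le v w" by (simp add: rank_le_def)
  assume i: "rank_count v i q \<le> rank_count w i q"
  show "(\<forall>p\<le>i. rank_count v p q = rank_count w p q) \<or> (\<forall>p\<ge>i. rank_count v p q = rank_count w p q)"
  proof (cases "i \<le> T")
    case True
    then have "\<forall>p\<le>i. rank_count v p q = rank_count w p q"
    proof (intro allI impI)
      fix p assume "p \<le> i"
      from D1[OF this True, of q] i le[of p q] show "rank_count v p q = rank_count w p q" by linarith
    qed
    then show ?thesis ..
  next
    case False
    then have "\<forall>p\<ge>i. rank_count v p q = rank_count w p q"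
    proof (intro allI impI)
      fix p assume "i \<le> p"
      from D2[OF this, of q] False i le[of p q] show "rank_count v p q = rank_count w p q" by linarith
    qed
    then show ?thesis ..
  qed
qed

text \<open>Minimal configurations with patterns as functions. In this form the notion is stable
  under deletion: \<open>n\<close> drops while \<open>N\<close>, \<open>nu\<close> and
  \<open>om\<close> stay.\<close>

definition configuration ::
    "nat \<Rightarrow> nat \<Rightarrow> (nat \<Rightarrow> nat) \<Rightarrow> (nat \<Rightarrow> nat) \<Rightarrow> (nat \<Rightarrow> nat) \<Rightarrow> (nat \<Rightarrow> nat) \<Rightarrow>
     (nat \<Rightarrow> nat) \<Rightarrow> (nat \<Rightarrow> nat) \<Rightarrow> bool" where
  "configuration n N x y nu om v w \<longleftrightarrow>
     strict_mono_on {1..N} x \<and> strict_mono_on {1..N} y \<and> x ` {1..N} \<subseteq> {1..n} \<and> y ` {1..N} \<subseteq> {1..n} \<and>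
     v permutes {1..n} \<and> w permutes {1..n} \<and>
     (\<forall>a\<in>{1..N}. w (x a) = y (om a) \<and> v (x a) = y (nu a)) \<and>
     (\<forall>i\<in>{1..n} - x ` {1..N}. v i = w i \<and> rank_count v i (w i) \<le> rank_count w i (w i))"

lemma strict_mono_on_interval_id:
  fixes x :: "nat \<Rightarrow> nat"
  assumes "strict_mono_on {1..N} x" "x ` {1..N} = {1..n}"
  shows "N = n" and "a \<in> {1..N} \<Longrightarrow> x a = a"
proof -
  have "inj_on x {1..N}" using assms(1) by (rule strict_mono_on_imp_inj_on)
  then have "card {1..N} = card {1..n}" using assms(2) by (metis card_image)
  then show N: "N = n" by simp
  have ge: "a \<le> x a" if "1 \<le> a" "a \<le> N" for a
    using that
  proof (induction a rule: dec_induct)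
    case base
    then show ?case using assms(2) by auto
  next
    case (step k)
    then have "x k < x (Suc k)" using assms(1) by (auto simp: strict_mono_on_def)
    then show ?case using step by simp
  qed
  have le: "x a \<le> a" if "a \<le> N" "1 \<le> a" for a
    using that
  proof (induction a rule: inc_induct)
    case base
    then show ?case using assms(2) N by auto
  next
    case (step k)
    then have "x k < x (Suc k)" using assms(1) by (auto simp: strict_mono_on_def)
    then show ?case using step by simp
  qed
  show "a \<in> {1..N} \<Longrightarrow> x a = a" using ge[of a] le[of a] by auto
qed

text \<open>Points outside the configuration are deleted one by one. As \<open>v\<close> and
  \<open>w\<close> agree there, the sign change of the pattern at \<open>t\<close> becomes one of
  \<open>v\<close> and \<open>w\<close> at row \<open>x t\<close>, so \<open>crossing_rank\<close>
  clears a way to a corner.\<close>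

theorem KL_poly_configuration:
  assumes nu: "nu permutes {1..N}" and om: "om permutes {1..N}" and t: "1 \<le> t" "t \<le> N"
    and up: "\<And>a. a \<le> t \<Longrightarrow> nu a \<le> om a" and down: "\<And>a. t < a \<Longrightarrow> om a \<le> nu a"
    and "configuration n N x y nu om v w"
  shows "KL_poly n v w = KL_poly N nu om"
  using assms(7)
proof (induction n arbitrary: x y v w)
  case 0
  then have "{1..N} = {}" by (auto simp: configuration_def)
  then show ?case using t by auto
next
  case (Suc n)
  have cf: "strict_mono_on {1..N} x" "strict_mono_on {1..N} y" "x ` {1..N} \<subseteq> {1..Suc n}" "y ` {1..N} \<subseteq> {1..Suc n}"
    "v permutes {1..Suc n}" "w permutes {1..Suc n}"
    "\<And>a. a \<in> {1..N} \<Longrightarrow> w (x a) = y (om a) \<and> v (x a) = y (nu a)"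
    "\<And>i. i \<in> {1..Suc n} \<Longrightarrow> i \<notin> x ` {1..N} \<Longrightarrow> v i = w i \<and> rank_count v i (w i) \<le> rank_count w i (w i)"
    using Suc.prems by (auto simp: configuration_def)
  note v = cf(5) and w = cf(6)
  have omr: "om a \<in> {1..N}" "nu a \<in> {1..N}" if "a \<in> {1..N}" for a
    using permutes_in_image[OF om] permutes_in_image[OF nu] that by blast+
  have monox: "x a \<le> x b" if "a \<in> {1..N}" "b \<in> {1..N}" "a \<le> b" for a b
    using strict_mono_onD[OF cf(1)] that by (metis le_eq_less_or_eq)
  have monoy: "y a \<le> y b" if "a \<in> {1..N}" "b \<in> {1..N}" "a \<le> b" for a b
    using strict_mono_onD[OF cf(2)] that by (metis le_eq_less_or_eq)
  show ?case
  proof (cases "x ` {1..N} = {1..Suc n}")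
    case True
    note X = strict_mono_on_interval_id[OF cf(1) True]
    have "y ` {1..N} = {1..Suc n}"
    proof (rule card_subset_eq)
      show "card (y ` {1..N}) = card {1..Suc n}"
        using strict_mono_on_imp_inj_on[OF cf(2)] X(1) by (simp add: card_image)
    qed (use cf in auto)
    note Y = strict_mono_on_interval_id[OF cf(2) this]
    have "v a = nu a \<and> w a = om a" for a
    proof (cases "a \<in> {1..N}")
      case True
      then show ?thesis using cf(7)[OF True] X(2) Y(2) omr by metis
    next
      case False
      then show ?thesis using v w nu om X(1) by (simp add: permutes_def)
    qed
    then have "v = nu" "w = om" by auto
    then show ?thesis using X(1) by simp
  next
    case False
    then obtain i where i: "i \<in> {1..Suc n}" "i \<notin> x ` {1..N}" using cf(3) by blast
    define c where "c = w i"
    have vi: "v i = c" and wi: "w i = c" and ri: "rank_count v i c \<le> rank_count w i c"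
      using cf(8)[OF i] by (auto simp: c_def)
    have tN: "t \<in> {1..N}" using t by auto
    have upv: "v k \<le> w k" if "k \<le> x t" for k
    proof (cases "k \<in> x ` {1..N}")
      case True
      then obtain a where a: "a \<in> {1..N}" "k = x a" by blast
      then have "a \<le> t" using that strict_mono_onD[OF cf(1) tN a(1)] by (meson leD leI)
      then show ?thesis using a cf(7)[OF a(1)] up[of a] omr[OF a(1)] monoy by metis
    next
      case False
      then show ?thesis using cf(8)[of k] v w by (cases "k \<in> {1..Suc n}") (auto simp: permutes_def)
    qed
    have downv: "w k \<le> v k" if "x t < k" for k
    proof (cases "k \<in> x ` {1..N}")
      case True
      then obtain a where a: "a \<in> {1..N}" "k = x a" by blast
      then have "t < a" using that monox[OF a(1) tN] by (meson leD leI)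
      then show ?thesis using a cf(7)[OF a(1)] down[of a] omr[OF a(1)] monoy by metis
    next
      case False
      then show ?thesis using cf(8)[of k] v w by (cases "k \<in> {1..Suc n}") (auto simp: permutes_def)
    qed
    have vw: "bruhat_le (Suc n) v w" using crossing_rank(1)[OF v w upv downv] v w by (simp add: bruhat_le_iff)
    have KL: "KL_poly (Suc n) v w = KL_poly n (del n i c v) (del n i c w)"
      using crossing_rank(2)[OF v w upv downv ri] by (intro KL_poly_del vw i vi wi)
    have xi: "x a \<noteq> i" if "a \<in> {1..N}" for a using i that by blast
    have yc: "y a \<noteq> c" if a: "a \<in> {1..N}" for a
    proof
      assume "y a = c"
      have b: "inv om a \<in> {1..N}" using permutes_in_image[OF permutes_inv[OF om]] a by blast
      have "w (x (inv om a)) = y a" using cf(7)[OF b] permutes_inverses(1)[OF om] by simp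
      then have "w (x (inv om a)) = w i" using \<open>y a = c\<close> wi by simp
      then have "x (inv om a) = i" using permutes_inj[OF w] by (metis injD)
      then show False using xi[OF b] by simp
    qed
    have c: "c \<in> {1..Suc n}" using i wi permutes_in_image[OF w] by blast
    have sq: "squash d z \<in> {1..n}" if "z \<noteq> d" "z \<in> {1..Suc n}" "d \<in> {1..Suc n}" for d z
      using that by (auto simp: squash_def)
    have dx: "del n i c u (squash i (x a)) = squash c (u (x a))" if "a \<in> {1..N}" for u a
      using sq[OF xi[OF that], of] cf(3) that i(1) skip_squash[OF xi[OF that]] by (force simp: del_def)
    have "configuration n N (\<lambda>a. squash i (x a)) (\<lambda>a. squash c (y a)) nu om (del n i c v) (del n i c w)"
      unfolding configuration_def
    proof (intro conjI)
      show "strict_mono_on {1..N} (\<lambda>a. squash i (x a))"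
        using strict_mono_onD[OF cf(1)] xi by (auto simp: strict_mono_on_def squash_less_iff)
      show "strict_mono_on {1..N} (\<lambda>a. squash c (y a))"
        using strict_mono_onD[OF cf(2)] yc by (auto simp: strict_mono_on_def squash_less_iff)
      show "(\<lambda>a. squash i (x a)) ` {1..N} \<subseteq> {1..n}" using sq xi cf(3) i(1) by blast
      show "(\<lambda>a. squash c (y a)) ` {1..N} \<subseteq> {1..n}" using sq yc cf(4) c by blast
      show "del n i c v permutes {1..n}" using del_permutes[OF v vi i(1)] .
      show "del n i c w permutes {1..n}" using del_permutes[OF w wi i(1)] .
      show "\<forall>a\<in>{1..N}. del n i c w (squash i (x a)) = squash c (y (om a)) \<and>
          del n i c v (squash i (x a)) = squash c (y (nu a))"
        using dx cf(7) by simp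
      show "\<forall>k\<in>{1..n} - (\<lambda>a. squash i (x a)) ` {1..N}. del n i c v k = del n i c w k \<and>
          rank_count (del n i c v) k (del n i c w k) \<le> rank_count (del n i c w) k (del n i c w k)"
      proof
        fix k assume k: "k \<in> {1..n} - (\<lambda>a. squash i (x a)) ` {1..N}"
        have "skip i k \<in> {1..Suc n}" using k by (auto simp: skip_def)
        moreover have "skip i k \<notin> x ` {1..N}"
        proof
          assume "skip i k \<in> x ` {1..N}"
          then obtain a where "a \<in> {1..N}" "skip i k = x a" by blast
          then have "k = squash i (x a)" by (metis squash_skip)
          then show False using k \<open>a \<in> {1..N}\<close> by blast
        qed
        ultimately have *: "v (skip i k) = w (skip i k)"
          "rank_count v (skip i k) (w (skip i k)) \<le> rank_count w (skip i k) (w (skip i k))"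
          using cf(8) by blast+
        have ne: "w (skip i k) \<noteq> c" using wi skip_neq[of i k] permutes_inj[OF w] by (metis injD)
        have dk: "del n i c w k = squash c (w (skip i k))" "del n i c v k = squash c (v (skip i k))"
          using k by (auto simp: del_def)
        have "k \<le> n" "1 \<le> i" using k i by auto
        then show "del n i c v k = del n i c w k \<and>
          rank_count (del n i c v) k (del n i c w k) \<le> rank_count (del n i c w) k (del n i c w k)"
          using * rank_count_del[OF v vi _ ne] rank_count_del[OF w wi _ ne] unfolding dk
          by (metis add_le_cancel_right)
      qed
    qed
    then show ?thesis using Suc.IH KL by metis
  qed
qed

section \<open>Generating functions of inversions\<close>

definition qint :: "nat \<Rightarrow> int poly" where
  "qint k = (\<Sum>i<k. qX ^ i)"

primrec qfact :: "nat \<Rightarrow> int poly" where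
  "qfact 0 = 1"
| "qfact (Suc k) = qfact k * qint (Suc k)"

lemma qint_0 [simp]: "qint 0 = 0" and qint_Suc: "qint (Suc k) = qint k + qX ^ k"
  by (simp_all add: qint_def)

lemma qint_Suc': "qint (Suc k) = 1 + qX * qint k"
  unfolding qint_def by (subst sum.lessThan_Suc_shift) (simp add: sum_distrib_left)

section \<open>Inversions of words\<close>

primrec linv :: "nat list \<Rightarrow> nat" where
  "linv [] = 0"
| "linv (x # xs) = length (filter (\<lambda>y. y < x) xs) + linv xs"

definition cross :: "nat multiset \<Rightarrow> nat multiset \<Rightarrow> nat" where
  "cross A B = (\<Sum>a\<in>#A. size (filter_mset (\<lambda>b. b < a) B))"

lemma cross_empty [simp]: "cross {#} B = 0" "cross A {#} = 0"
  by (simp_all add: cross_def)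

lemma linv_append: "linv (xs @ ys) = linv xs + linv ys + cross (mset xs) (mset ys)"
proof (induction xs)
  case (Cons x xs)
  have "length (filter (\<lambda>y. y < x) ys) = size (filter_mset (\<lambda>b. b < x) (mset ys))"
    by (simp flip: mset_filter)
  then show ?case using Cons by (simp add: cross_def)
qed (simp add: cross_def)

lemma linv_map_upt:
  "linv (map a [k..<m]) = card {(i, j). k \<le> i \<and> i < j \<and> j < m \<and> a j < a i}"
proof (induction "m - k" arbitrary: k)
  case 0
  then have "{(i, j). k \<le> i \<and> i < j \<and> j < m \<and> a j < a i} = {}" by auto
  then show ?case using 0 by (simp only: card.empty) simp
next
  case (Suc d)
  then have km: "k < m" by simp
  let ?A = "{(i, j). Suc k \<le> i \<and> i < j \<and> j < m \<and> a j < a i}"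
  let ?B = "{j. Suc k \<le> j \<and> j < m \<and> a j < a k}"
  have "{(i, j). k \<le> i \<and> i < j \<and> j < m \<and> a j < a i} = Pair k ` ?B \<union> ?A"
    by (auto simp: Suc_le_eq le_less image_iff)
  moreover have "finite ?A" by (rule finite_subset[of _ "{..m} \<times> {..m}"]) auto
  moreover have "finite ?B" by (rule finite_subset[of _ "{..m}"]) auto
  moreover have "Pair k ` ?B \<inter> ?A = {}" by auto
  ultimately have "card {(i, j). k \<le> i \<and> i < j \<and> j < m \<and> a j < a i} = card ?B + card ?A"
    by (simp add: card_Un_disjoint card_image inj_on_def)
  moreover have "card ?B = length (filter (\<lambda>y. y < a k) (map a [Suc k..<m]))"
  proof -
    have "length (filter (\<lambda>y. y < a k) (map a [Suc k..<m])) = length (filter (\<lambda>j. a j < a k) [Suc k..<m])"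
      by (simp add: filter_map comp_def)
    also have "\<dots> = card (set (filter (\<lambda>j. a j < a k) [Suc k..<m]))"
      by (subst distinct_card) auto
    also have "set (filter (\<lambda>j. a j < a k) [Suc k..<m]) = ?B" by auto
    finally show ?thesis by simp
  qed
  moreover have "linv (map a [Suc k..<m]) = card ?A" using Suc by simp
  moreover have "[k..<m] = k # [Suc k..<m]" using km by (rule upt_conv_Cons)
  ultimately show ?case by simp
qed

lemma inversions_linv: "inversions n a = linv (map a [1..<Suc n])"
  unfolding linv_map_upt inversions_def by (rule arg_cong[of _ _ card]) auto

lemma bij_betw_perms_lists:
  "bij_betw (\<lambda>a. map a [1..<Suc n]) {a. a permutes {1..n}} (permutations_of_set {1..n})"
proof -
  let ?f = "\<lambda>a. map a [1..<Suc n] :: nat list"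
  have inj: "inj_on ?f {a. a permutes {1..n}}"
  proof (rule inj_onI)
    fix a b assume a: "a \<in> {a. a permutes {1..n}}" and b: "b \<in> {a. a permutes {1..n}}" and e: "?f a = ?f b"
    have "a i = b i" for i
    proof (cases "i \<in> {1..n}")
      case True
      then show ?thesis using e by (auto simp: map_eq_conv simp del: upt_Suc)
    next
      case False
      then show ?thesis using a b by (simp add: permutes_def)
    qed
    then show "a = b" by auto
  qed
  have sub: "?f ` {a. a permutes {1..n}} \<subseteq> permutations_of_set {1..n}"
  proof clarify
    fix a assume a: "a permutes {1..n}"
    have "set (?f a) = {1..n}"
      using permutes_image[OF a] by (simp add: atLeastLessThanSuc_atLeastAtMost del: upt_Suc)
    moreover have "distinct (?f a)"
      using permutes_inj[OF a] by (auto simp: distinct_map intro: inj_on_subset simp del: upt_Suc)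
    ultimately show "?f a \<in> permutations_of_set {1..n}" by (rule permutations_of_setI)
  qed
  have "card (?f ` {a. a permutes {1..n}}) = card (permutations_of_set {1..n})"
    using card_image[OF inj] by (simp add: card_permutations[OF refl])
  then have "?f ` {a. a permutes {1..n}} = permutations_of_set {1..n}"
    using sub by (intro card_subset_eq) auto
  then show ?thesis using inj by (simp add: bij_betw_def)
qed

lemma sum_permutations_of_multiset_Cons:
  assumes "M \<noteq> {#}"
  shows "(\<Sum>\<beta>\<in>permutations_of_multiset M. f \<beta>) =
    (\<Sum>b\<in>set_mset M. \<Sum>\<gamma>\<in>permutations_of_multiset (M - {#b#}). f (b # \<gamma>))"
  unfolding permutations_of_multiset_nonempty[OF assms]
  by (subst sum.UNION_disjoint) (auto simp: sum.reindex)

lemma sum_permutations_of_set_Cons: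
  assumes "V \<noteq> {}" "finite V"
  shows "(\<Sum>\<beta>\<in>permutations_of_set V. f \<beta>) =
    (\<Sum>b\<in>V. \<Sum>\<gamma>\<in>permutations_of_set (V - {b}). f (b # \<gamma>))"
  unfolding permutations_of_set_nonempty[OF assms(1)]
  using assms(2) by (subst sum.UNION_disjoint) (auto simp: sum.reindex)

lemma sum_power_rank:
  fixes A :: "nat set"
  assumes "finite A"
  shows "(\<Sum>x\<in>A. qX ^ card {y \<in> A. y < x}) = qint (card A)"
  using assms
proof (induction rule: finite_linorder_max_induct)
  case (insert b A)
  have "b \<notin> A" using insert by auto
  have "{y \<in> insert b A. y < b} = A" using insert by auto
  moreover have "{y \<in> insert b A. y < x} = {y \<in> A. y < x}" if "x \<in> A" for x using insert that by fastforce
  ultimately show ?case using insert \<open>b \<notin> A\<close> by (simp add: qint_Suc algebra_simps)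
qed simp

text \<open>The Poincare polynomial of the Young subgroup whose block sizes are the multiplicities
  in \<open>M\<close>. Three letters suffice for all patterns; with two blocks the letter 3 is
  absent.\<close>

definition qfacts :: "nat multiset \<Rightarrow> int poly" where
  "qfacts M = qfact (count M 1) * qfact (count M 2) * qfact (count M 3)"

lemma qfacts_remove:
  assumes "b \<in># M" "b \<in> {1, 2, 3}"
  shows "qfacts M = qfacts (M - {#b#}) * qint (count M b)"
proof -
  have "qfact (count M b) = qfact (count M b - 1) * qint (count M b)"
    using assms(1) by (cases "count M b") (auto simp: count_eq_zero_iff)
  then show ?thesis using assms(2) by (auto simp: qfacts_def One_nat_def)
qed

definition words_sum :: "nat multiset \<Rightarrow> (nat list \<Rightarrow> int poly) \<Rightarrow> int poly" where
  "words_sum M g = (\<Sum>\<beta>\<in>permutations_of_multiset M. qX ^ linv \<beta> * g \<beta>)"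

lemma words_sum_Cons:
  assumes "M \<noteq> {#}"
  shows "words_sum M g = (\<Sum>b\<in>set_mset M. qX ^ size (filter_mset (\<lambda>z. z < b) M) * words_sum (M - {#b#}) (\<lambda>\<gamma>. g (b # \<gamma>)))"
  unfolding words_sum_def sum_permutations_of_multiset_Cons[OF assms] sum_distrib_left
proof (intro sum.cong refl)
  fix b \<gamma> assume b: "b \<in># M" and "\<gamma> \<in> permutations_of_multiset (M - {#b#})"
  then have "mset \<gamma> = M - {#b#}" by (rule_tac permutations_of_multisetD)
  then have "length (filter (\<lambda>z. z < b) \<gamma>) = size (filter_mset (\<lambda>z. z < b) (M - {#b#}))"
    by (metis mset_filter size_mset)
  also have "filter_mset (\<lambda>z. z < b) (M - {#b#}) = filter_mset (\<lambda>z. z < b) M" by simp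
  finally show "qX ^ linv (b # \<gamma>) * g (b # \<gamma>) =
      qX ^ size (filter_mset (\<lambda>z. z < b) M) * (qX ^ linv \<gamma> * g (b # \<gamma>))"
    by (simp add: power_add mult.assoc del: mult_pCons_left)
qed

text \<open>Each permutation factors uniquely through the word of blocks of its values and a
  permutation inside every block; inversions add up.\<close>

lemma sum_permutations_words:
  fixes V :: "nat set" and \<chi> :: "nat \<Rightarrow> nat"
  assumes "finite V" "\<And>x y. x \<le> y \<Longrightarrow> \<chi> x \<le> \<chi> y" "\<And>x. \<chi> x \<in> {1, 2, 3}"
  shows "(\<Sum>xs\<in>permutations_of_set V. qX ^ linv xs * g (map \<chi> xs)) =
    qfacts (image_mset \<chi> (mset_set V)) * words_sum (image_mset \<chi> (mset_set V)) g"
  using assms(1)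
proof (induction "card V" arbitrary: V g)
  case 0
  then have "V = {}" by simp
  then show ?case by (simp add: qfacts_def words_sum_def)
next
  case (Suc d)
  then have V: "V \<noteq> {}" "finite V" by auto
  define M where "M = image_mset \<chi> (mset_set V)"
  have size: "size (filter_mset P M) = card {y \<in> V. P (\<chi> y)}" for P
    unfolding M_def using V(2) by (simp add: filter_mset_image_mset filter_mset_mset_set)
  have count: "count M b = card {y \<in> V. \<chi> y = b}" for b
    using size[of "\<lambda>z. z = b"] by (simp add: count_conv_size_mset)
  have setM: "set_mset M = \<chi> ` V" unfolding M_def using V(2) by simp
  have M: "M \<noteq> {#}" unfolding M_def using V by (simp add: mset_set_empty_iff)
  define G where "G b = words_sum (M - {#b#}) (\<lambda>\<gamma>. g (b # \<gamma>))" for b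
  have "(\<Sum>xs\<in>permutations_of_set V. qX ^ linv xs * g (map \<chi> xs)) =
      (\<Sum>x\<in>V. qX ^ card {y \<in> V. y < x} * (qfacts (M - {#\<chi> x#}) * G (\<chi> x)))"
    unfolding sum_permutations_of_set_Cons[OF V]
  proof (intro sum.cong refl)
    fix x assume x: "x \<in> V"
    have "(\<Sum>ys\<in>permutations_of_set (V - {x}). qX ^ linv (x # ys) * g (map \<chi> (x # ys))) =
        (\<Sum>ys\<in>permutations_of_set (V - {x}). qX ^ card {y \<in> V. y < x} * (qX ^ linv ys * g (\<chi> x # map \<chi> ys)))"
    proof (intro sum.cong refl)
      fix ys assume "ys \<in> permutations_of_set (V - {x})"
      then have ys: "set ys = V - {x}" "distinct ys" by (auto dest: permutations_of_setD)
      have "length (filter (\<lambda>y. y < x) ys) = card (set (filter (\<lambda>y. y < x) ys))"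
        using ys(2) by (subst distinct_card) auto
      also have "set (filter (\<lambda>y. y < x) ys) = {y \<in> V. y < x}" using ys(1) by auto
      finally show "qX ^ linv (x # ys) * g (map \<chi> (x # ys)) =
          qX ^ card {y \<in> V. y < x} * (qX ^ linv ys * g (\<chi> x # map \<chi> ys))"
        by (simp add: power_add mult.assoc del: mult_pCons_left)
    qed
    also have "\<dots> = qX ^ card {y \<in> V. y < x} *
        (\<Sum>ys\<in>permutations_of_set (V - {x}). qX ^ linv ys * g (\<chi> x # map \<chi> ys))"
      by (rule sum_distrib_left[symmetric])
    also have "(\<Sum>ys\<in>permutations_of_set (V - {x}). qX ^ linv ys * g (\<chi> x # map \<chi> ys)) =
        qfacts (image_mset \<chi> (mset_set (V - {x}))) * words_sum (image_mset \<chi> (mset_set (V - {x}))) (\<lambda>\<gamma>. g (\<chi> x # \<gamma>))"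
      using Suc(2) V(2) x by (intro Suc(1)) auto
    also have "image_mset \<chi> (mset_set (V - {x})) = M - {#\<chi> x#}"
      unfolding M_def using x V(2) by (simp add: mset_set_Diff image_mset_Diff)
    finally show "(\<Sum>ys\<in>permutations_of_set (V - {x}). qX ^ linv (x # ys) * g (map \<chi> (x # ys))) =
        qX ^ card {y \<in> V. y < x} * (qfacts (M - {#\<chi> x#}) * G (\<chi> x))" by (simp only: G_def)
  qed
  \<comment> \<open>First entries are grouped by block. The elements smaller than \<open>x\<close>
    lie in earlier blocks, which gives the power of q for the letter \<open>b\<close>, or below
    \<open>x\<close> in its own block; the latter powers sum to the q-integer that completes the
    q-factorial of the block.\<close>
  also have "\<dots> = (\<Sum>b\<in>\<chi> ` V. \<Sum>x\<in>{x \<in> V. \<chi> x = b}. qX ^ card {y \<in> V. y < x} * (qfacts (M - {#\<chi> x#}) * G (\<chi> x)))"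
    using V(2) by (rule sum.image_gen)
  also have "\<dots> = (\<Sum>b\<in>\<chi> ` V. qfacts M * (qX ^ size (filter_mset (\<lambda>z. z < b) M) * G b))"
  proof (intro sum.cong refl)
    fix b assume b: "b \<in> \<chi> ` V"
    let ?B = "{x \<in> V. \<chi> x = b}"
    have "(\<Sum>x\<in>?B. qX ^ card {y \<in> V. y < x} * (qfacts (M - {#\<chi> x#}) * G (\<chi> x))) =
        (\<Sum>x\<in>?B. qX ^ size (filter_mset (\<lambda>z. z < b) M) * qX ^ card {y \<in> ?B. y < x} * (qfacts (M - {#b#}) * G b))"
    proof (intro sum.cong refl)
      fix x assume x: "x \<in> ?B"
      have "{y \<in> V. y < x} = {y \<in> V. \<chi> y < b} \<union> {y \<in> ?B. y < x}"
      proof (intro set_eqI iffI)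
        fix y assume "y \<in> {y \<in> V. y < x}"
        then show "y \<in> {y \<in> V. \<chi> y < b} \<union> {y \<in> ?B. y < x}" using assms(2)[of y x] x by auto
      next
        fix y assume "y \<in> {y \<in> V. \<chi> y < b} \<union> {y \<in> ?B. y < x}"
        then show "y \<in> {y \<in> V. y < x}" using assms(2)[of x y] x by (cases "x \<le> y") auto
      qed
      moreover have "{y \<in> V. \<chi> y < b} \<inter> {y \<in> ?B. y < x} = {}" by auto
      ultimately have "card {y \<in> V. y < x} = card {y \<in> V. \<chi> y < b} + card {y \<in> ?B. y < x}"
        using V(2) by (simp add: card_Un_disjoint)
      then show "qX ^ card {y \<in> V. y < x} * (qfacts (M - {#\<chi> x#}) * G (\<chi> x)) =
          qX ^ size (filter_mset (\<lambda>z. z < b) M) * qX ^ card {y \<in> ?B. y < x} * (qfacts (M - {#b#}) * G b)"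
        using x by (simp add: size power_add del: mult_pCons_left)
    qed
    also have "\<dots> = qX ^ size (filter_mset (\<lambda>z. z < b) M) * (\<Sum>x\<in>?B. qX ^ card {y \<in> ?B. y < x}) * (qfacts (M - {#b#}) * G b)"
      by (simp only: sum_distrib_left sum_distrib_right)
    also have "(\<Sum>x\<in>?B. qX ^ card {y \<in> ?B. y < x}) = qint (count M b)"
      using V(2) sum_power_rank[of ?B] by (simp add: count)
    also have "qX ^ size (filter_mset (\<lambda>z. z < b) M) * qint (count M b) * (qfacts (M - {#b#}) * G b) =
        qfacts M * (qX ^ size (filter_mset (\<lambda>z. z < b) M) * G b)"
      using qfacts_remove[of b M] b setM assms(3) by (auto simp: algebra_simps simp del: mult_pCons_left)
    finally show "(\<Sum>x\<in>?B. qX ^ card {y \<in> V. y < x} * (qfacts (M - {#\<chi> x#}) * G (\<chi> x))) =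
        qfacts M * (qX ^ size (filter_mset (\<lambda>z. z < b) M) * G b)" .
  qed
  also have "\<dots> = qfacts M * words_sum M g"
    unfolding words_sum_Cons[OF M] setM G_def sum_distrib_left ..
  finally show ?case by (simp only: M_def)
qed

text \<open>The q-multinomial coefficient of the multiplicities in \<open>M\<close>, as the
  generating function of words by inversions.\<close>

definition qmult :: "nat multiset \<Rightarrow> int poly" where
  "qmult M = words_sum M (\<lambda>_. 1)"

lemma qmult_Cons:
  "M \<noteq> {#} \<Longrightarrow> qmult M = (\<Sum>b\<in>set_mset M. qX ^ size (filter_mset (\<lambda>z. z < b) M) * qmult (M - {#b#}))"
  unfolding qmult_def by (rule words_sum_Cons)

lemma qmult_empty [simp]: "qmult {#} = 1"
  by (simp add: qmult_def words_sum_def)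

lemma filter_replicate_mset: "filter_mset P (replicate_mset r b) = (if P b then replicate_mset r b else {#})"
  by (induction r) auto

lemma qmult_replicate [simp]: "qmult (replicate_mset r b) = 1"
proof (induction r)
  case (Suc r)
  have "qmult (replicate_mset (Suc r) b) =
      (\<Sum>x\<in>{b}. qX ^ size (filter_mset (\<lambda>z. z < x) (replicate_mset (Suc r) b)) * qmult (replicate_mset (Suc r) b - {#x#}))"
    by (subst qmult_Cons) (auto intro: sum.cong)
  then show ?case using Suc by (simp add: filter_replicate_mset)
qed simp

text \<open>The segments of the double cosets below have these contents only: equal letters, equal
  letters with one larger or one smaller letter, or both.\<close>

lemma qmult_one_large:
  assumes "a < b"
  shows "qmult (add_mset b (replicate_mset r a)) = qint (Suc r)"
proof (induction r)
  case 0
  then show ?case using qmult_replicate[of 1 b] by (simp add: qint_def One_nat_def)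
next
  case (Suc r)
  let ?M = "add_mset b (add_mset a (replicate_mset r a))"
  have "qmult ?M = (\<Sum>x\<in>{a, b}. qX ^ size (filter_mset (\<lambda>z. z < x) ?M) * qmult (?M - {#x#}))"
    by (subst qmult_Cons) (auto intro!: sum.cong)
  moreover have "?M - {#a#} = add_mset b (replicate_mset r a)" by (simp add: add_mset_commute)
  moreover have "qmult (?M - {#b#}) = 1" using qmult_replicate[of "Suc r" a] by simp
  ultimately show ?case
    using assms Suc by (simp add: filter_replicate_mset qint_Suc del: mult_pCons_left)
qed

lemma qmult_one_small:
  assumes "a < b"
  shows "qmult (add_mset a (replicate_mset r b)) = qint (Suc r)"
proof (induction r)
  case 0
  then show ?case using qmult_replicate[of 1 a] by (simp add: qint_def One_nat_def)
next
  case (Suc r)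
  let ?M = "add_mset a (add_mset b (replicate_mset r b))"
  have "qmult ?M = (\<Sum>x\<in>{a, b}. qX ^ size (filter_mset (\<lambda>z. z < x) ?M) * qmult (?M - {#x#}))"
    by (subst qmult_Cons) (auto intro!: sum.cong)
  moreover have "?M - {#b#} = add_mset a (replicate_mset r b)" by (simp add: add_mset_commute)
  moreover have "qmult (?M - {#a#}) = 1" using qmult_replicate[of "Suc r" b] by simp
  ultimately have "qmult ?M = 1 + qX * qint (Suc r)"
    using assms Suc by (simp add: filter_replicate_mset One_nat_def del: mult_pCons_left)
  then show ?case by (simp add: qint_Suc'[of "Suc r"])
qed

lemma qmult_small_large:
  assumes "a < b" "b < c"
  shows "qmult (add_mset a (add_mset c (replicate_mset r b))) = qint (Suc r) * qint (Suc (Suc r))"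
proof (induction r)
  case 0
  have "qmult {#a, c#} = (\<Sum>x\<in>{a, c}. qX ^ size (filter_mset (\<lambda>z. z < x) {#a, c#}) * qmult ({#a, c#} - {#x#}))"
    by (subst qmult_Cons) (auto intro!: sum.cong)
  moreover have "{#a, c#} - {#c#} = {#a#}" by (simp add: add_mset_commute)
  ultimately show ?case using assms qmult_replicate[of 1 a] qmult_replicate[of 1 c]
    by (simp add: qint_def One_nat_def)
next
  case (Suc r)
  let ?R = "replicate_mset r b"
  let ?M = "add_mset a (add_mset c (add_mset b ?R))"
  have "qmult ?M = (\<Sum>x\<in>{a, b, c}. qX ^ size (filter_mset (\<lambda>z. z < x) ?M) * qmult (?M - {#x#}))"
    by (subst qmult_Cons) (auto intro!: sum.cong)
  moreover have "?M - {#b#} = add_mset a (add_mset c ?R)" by (simp add: add_mset_commute)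
  moreover have "?M - {#c#} = add_mset a (replicate_mset (Suc r) b)" by (simp add: add_mset_commute)
  moreover have "?M - {#a#} = add_mset c (replicate_mset (Suc r) b)" by simp
  ultimately have "qmult ?M = qmult (add_mset c (replicate_mset (Suc r) b)) + qX * qmult (add_mset a (add_mset c ?R)) +
      qX ^ Suc (Suc r) * qmult (add_mset a (replicate_mset (Suc r) b))"
    using assms by (simp add: filter_replicate_mset One_nat_def del: mult_pCons_left replicate_mset_Suc)
  also have "\<dots> = qint (Suc (Suc r)) + qX * (qint (Suc r) * qint (Suc (Suc r))) + qX ^ Suc (Suc r) * qint (Suc (Suc r))"
    using assms Suc qmult_one_small[of a b "Suc r"] qmult_one_large[of b c "Suc r"] by simp
  also have "\<dots> = qint (Suc (Suc r)) * (1 + qX * qint (Suc r) + qX ^ Suc (Suc r))"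
    by (simp add: algebra_simps del: mult_pCons_left)
  also have "1 + qX * qint (Suc r) + qX ^ Suc (Suc r) = qint (Suc (Suc (Suc r)))"
    using qint_Suc'[of "Suc r"] qint_Suc[of "Suc (Suc r)"] by simp
  finally show ?case by simp
qed

text \<open>Inversions between two segments depend only on their contents and are counted by
  \<open>cross\<close>; those inside the segments give the three q-multinomials.\<close>

lemma words_sum_split:
  assumes "M = A + B + C"
  shows "words_sum M (\<lambda>\<beta>. of_bool (mset (take (size A) \<beta>) = A \<and> mset (take (size B) (drop (size A) \<beta>)) = B)) =
    qX ^ (cross A B + cross A C + cross B C) * qmult A * qmult B * qmult C"
proof -
  let ?P = "permutations_of_multiset"
  let ?D = "?P A \<times> ?P B \<times> ?P C"
  let ?f = "\<lambda>(x, y, z). x @ y @ z :: nat list"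
  let ?Q = "\<lambda>\<beta>. mset (take (size A) \<beta>) = A \<and> mset (take (size B) (drop (size A) \<beta>)) = B"
  have im: "{\<beta> \<in> ?P M. ?Q \<beta>} = ?f ` ?D"
  proof (intro set_eqI iffI)
    fix \<beta> assume "\<beta> \<in> {\<beta> \<in> ?P M. ?Q \<beta>}"
    then have b: "mset \<beta> = M" "mset (take (size A) \<beta>) = A" "mset (take (size B) (drop (size A) \<beta>)) = B"
      by (auto dest: permutations_of_multisetD)
    let ?x = "take (size A) \<beta>" and ?y = "take (size B) (drop (size A) \<beta>)" and ?z = "drop (size B) (drop (size A) \<beta>)"
    have e: "\<beta> = ?x @ ?y @ ?z" by (metis append_take_drop_id)
    then have "mset ?x + mset ?y + mset ?z = M" using b(1) by (metis mset_append union_assoc)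
    then have "mset ?z = C" using b assms by simp
    then have "(?x, ?y, ?z) \<in> ?D" using b by (auto intro: permutations_of_multisetI)
    then show "\<beta> \<in> ?f ` ?D" using e by (metis (mono_tags, lifting) case_prod_conv image_eqI)
  next
    fix \<beta> assume "\<beta> \<in> ?f ` ?D"
    then obtain x y z where "\<beta> = x @ y @ z" "mset x = A" "mset y = B" "mset z = C"
      by (auto dest: permutations_of_multisetD)
    moreover from this have "length x = size A" "length y = size B" by (metis size_mset)+
    ultimately show "\<beta> \<in> {\<beta> \<in> ?P M. ?Q \<beta>}" using assms by (auto intro: permutations_of_multisetI)
  qed
  have inj: "inj_on ?f ?D"
  proof (rule inj_onI)
    fix s t assume s: "s \<in> ?D" and t: "t \<in> ?D" and e: "?f s = ?f t"
    obtain x y z x' y' z' where st: "s = (x, y, z)" "t = (x', y', z')" by (metis prod_cases3)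
    have "length x = length x'" "length y = length y'"
      using s t st by (metis SigmaD1 SigmaD2 permutations_of_multisetD size_mset)+
    then show "s = t" using e st by simp
  qed
  have "words_sum M (\<lambda>\<beta>. of_bool (?Q \<beta>)) = (\<Sum>\<beta>\<in>{\<beta> \<in> ?P M. ?Q \<beta>}. qX ^ linv \<beta>)"
    unfolding words_sum_def by (rule sum.mono_neutral_cong_right) auto
  also have "\<dots> = (\<Sum>(x, y, z)\<in>?D. qX ^ linv (x @ y @ z))"
    unfolding im by (subst sum.reindex[OF inj]) (simp add: case_prod_unfold comp_def)
  also have "\<dots> = (\<Sum>(x, y, z)\<in>?D. qX ^ (cross A B + cross A C + cross B C) * (qX ^ linv x * (qX ^ linv y * qX ^ linv z)))"
  proof (intro sum.cong refl, clarify)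
    fix x y z assume "x \<in> ?P A" "y \<in> ?P B" "z \<in> ?P C"
    then have m: "mset x = A" "mset y = B" "mset z = C" by (auto dest: permutations_of_multisetD)
    have "cross A (B + C) = cross A B + cross A C" by (simp add: cross_def sum_mset.distrib)
    then show "qX ^ linv (x @ y @ z) = qX ^ (cross A B + cross A C + cross B C) * (qX ^ linv x * (qX ^ linv y * qX ^ linv z))"
      by (simp add: linv_append m power_add ac_simps del: mult_pCons_left)
  qed
  also have "\<dots> = qX ^ (cross A B + cross A C + cross B C) *
      ((\<Sum>x\<in>?P A. qX ^ linv x) * ((\<Sum>y\<in>?P B. qX ^ linv y) * (\<Sum>z\<in>?P C. qX ^ linv z)))"
    by (simp only: sum_distrib_left[symmetric] sum_product sum.cartesian_product[symmetric] case_prod_unfold)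
       (simp only: sum.cartesian_product' sum_distrib_left fst_conv snd_conv)
  finally show ?thesis by (simp add: qmult_def words_sum_def ac_simps del: mult_pCons_left)
qed

section \<open>Palindromic polynomials\<close>

definition palindromic :: "int poly \<Rightarrow> bool" where
  "palindromic p \<longleftrightarrow> coeff p 0 = 1 \<and> rv (degree p) p = p"

lemma palindromic_neq_0: "palindromic p \<Longrightarrow> p \<noteq> 0"
  by (auto simp: palindromic_def)

lemma palindromic_mult:
  assumes "palindromic p" "palindromic q"
  shows "palindromic (p * q)" and "degree (p * q) = degree p + degree q"
proof -
  show d: "degree (p * q) = degree p + degree q"
    using assms palindromic_neq_0 by (intro degree_mult_eq) auto
  have "rv (degree p + degree q) (p * q) = rv (degree p) p * rv (degree q) q"
    by (rule rv_mult) auto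
  then show "palindromic (p * q)"
    using assms d by (simp add: palindromic_def coeff_mult_0)
qed

lemma qX_power: "qX ^ k = monom 1 k"
  by (simp add: monom_altdef)

lemma coeff_qint: "coeff (qint k) i = of_bool (i < k)"
  unfolding qint_def qX_power by (auto simp: coeff_sum of_bool_def)

lemma degree_qint: "degree (qint (Suc k)) = k"
  by (rule antisym) (auto intro!: degree_le le_degree simp: coeff_qint)

lemma palindromic_qint: "palindromic (qint (Suc k))"
  unfolding palindromic_def degree_qint by (auto simp: coeff_qint poly_eq_iff coeff_rv)

lemma palindromic_qfact: "palindromic (qfact k)"
proof (induction k)
  case 0
  show ?case by (auto simp: palindromic_def poly_eq_iff coeff_rv coeff_1)
next
  case (Suc k)
  then show ?case using palindromic_mult(1)[OF Suc palindromic_qint] by simp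
qed

lemma palindromic_qfacts: "palindromic (qfacts M)"
  unfolding qfacts_def by (intro palindromic_mult palindromic_qfact)

text \<open>Reversal is multiplicative and \<open>Q\<close> is fixed and nonzero, so
  \<open>P + R\<close> is symmetric itself. Then \<open>R\<close> determines
  \<open>rv d P - P\<close>, and the degree bound identifies \<open>P\<close> with the guess
  \<open>P0\<close>.\<close>

lemma palindromic_quotient:
  assumes Q: "palindromic Q" and d: "1 \<le> d"
    and PR: "rv (degree Q + d) (Q * (P + R)) = Q * (P + R)"
    and P0: "rv d (P0 + R) = P0 + R" and R: "degree R \<le> d"
    and P: "2 * degree P \<le> d - 1" and dP0: "2 * degree P0 \<le> d - 1"
  shows "P = P0"
proof -
  have "degree (P + R) \<le> d" using P R by (intro degree_add_le) auto
  then have "rv (degree Q + d) (Q * (P + R)) = rv (degree Q) Q * rv d (P + R)" by (intro rv_mult) auto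
  then have "Q * (P + R) = rv (degree Q) Q * rv d (P + R)" unfolding PR .
  also have "rv (degree Q) Q = Q" using Q by (simp add: palindromic_def)
  finally have PR': "P + R = rv d (P + R)" using palindromic_neq_0[OF Q] by (metis mult_left_cancel)
  have "rv d P - P = R - rv d R" using PR' unfolding rv_add by (simp add: algebra_simps)
  moreover have "rv d P0 - P0 = R - rv d R" using P0 unfolding rv_add by (simp add: algebra_simps)
  ultimately have "rv d P - P = rv d P0 - P0" by simp
  then show ?thesis using rv_low_degree_unique d P dP0 by blast
qed

section \<open>Generating functions of double cosets\<close>

definition block :: "nat \<Rightarrow> nat \<Rightarrow> nat \<Rightarrow> nat" where
  "block c d v = (if v \<le> c then 1 else if v \<le> d then 2 else 3)"

text \<open>The same cuts \<open>c\<close> and \<open>d\<close> divide values into blocks and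
  positions into segments. A double coset of the Young subgroup is given by the contents of the
  segments; the third content is forced by the other two.\<close>

definition in_class :: "nat \<Rightarrow> nat \<Rightarrow> nat \<Rightarrow> nat multiset \<Rightarrow> nat multiset \<Rightarrow> (nat \<Rightarrow> nat) \<Rightarrow> bool" where
  "in_class n c d A B a \<longleftrightarrow>
     mset (take (size A) (map (block c d \<circ> a) [1..<Suc n])) = A \<and>
     mset (take (size B) (drop (size A) (map (block c d \<circ> a) [1..<Suc n]))) = B"

lemma blocks_multiset:
  assumes "c \<le> d" "d \<le> n"
  shows "image_mset (block c d) (mset_set {1..n}) =
    replicate_mset c 1 + replicate_mset (d - c) 2 + replicate_mset (n - d) 3"
proof (rule multiset_eqI)
  fix b
  have "count (image_mset (block c d) (mset_set {1..n})) b = card {y \<in> {1..n}. block c d y = b}"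
    by (simp add: count_conv_size_mset filter_mset_image_mset filter_mset_mset_set)
  also have "{y \<in> {1..n}. block c d y = b} =
      (if b = 1 then {1..c} else if b = 2 then {Suc c..d} else if b = 3 then {Suc d..n} else {})"
    using assms by (auto simp: block_def split: if_splits)
  finally show "count (image_mset (block c d) (mset_set {1..n})) b =
      count (replicate_mset c 1 + replicate_mset (d - c) 2 + replicate_mset (n - d) 3) b"
    using assms by auto
qed

lemma class_sum:
  assumes "c \<le> d" "d \<le> n" and M: "M = replicate_mset c 1 + replicate_mset (d - c) 2 + replicate_mset (n - d) 3"
    and ABC: "M = A + B + C"
  shows "(\<Sum>a | a permutes {1..n}. qX ^ inversions n a * of_bool (in_class n c d A B a)) =
    qfacts M * (qX ^ (cross A B + cross A C + cross B C) * qmult A * qmult B * qmult C)"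
proof -
  let ?g = "\<lambda>\<beta>. of_bool (mset (take (size A) \<beta>) = A \<and> mset (take (size B) (drop (size A) \<beta>)) = B) :: int poly"
  have "(\<Sum>a | a permutes {1..n}. qX ^ inversions n a * of_bool (in_class n c d A B a)) =
      (\<Sum>a | a permutes {1..n}. (\<lambda>xs. qX ^ linv xs * ?g (map (block c d) xs)) (map a [1..<Suc n]))"
    unfolding inversions_linv in_class_def map_map ..
  also have "\<dots> = (\<Sum>xs\<in>permutations_of_set {1..n}. qX ^ linv xs * ?g (map (block c d) xs))"
    by (rule sum.reindex_bij_betw[OF bij_betw_perms_lists])
  also have "\<dots> = qfacts M * words_sum M ?g"
    using assms(1) unfolding M blocks_multiset[OF assms(1,2), symmetric]
    by (intro sum_permutations_words) (auto simp: block_def)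
  also have "words_sum M ?g = qX ^ (cross A B + cross A C + cross B C) * qmult A * qmult B * qmult C"
    by (rule words_sum_split[OF ABC])
  finally show ?thesis .
qed

lemma multiset_eq_123:
  fixes X Y :: "nat multiset"
  assumes "set_mset X \<subseteq> {1, 2, 3}" "set_mset Y \<subseteq> {1, 2, 3}" "size X = size Y"
    "count X 1 = count Y 1" "count X 3 = count Y 3"
  shows "X = Y"
proof (rule multiset_eqI)
  have s: "size Z = count Z 1 + count Z 2 + count Z 3" if "set_mset Z \<subseteq> {1, 2, 3}" for Z :: "nat multiset"
  proof -
    have "size Z = (\<Sum>x\<in>{1, 2, 3}. count Z x)"
      unfolding size_multiset_overloaded_eq using that
      by (intro sum.mono_neutral_left) (auto simp: not_in_iff)
    then show ?thesis by simp
  qed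
  fix b
  have "count X 2 = count Y 2" using s[OF assms(1)] s[OF assms(2)] assms(3-) by simp
  moreover have "count X b = 0 \<and> count Y b = 0" if "b \<notin> {1, 2, 3}"
    using that assms(1,2) by (auto simp: not_in_iff[symmetric])
  ultimately show "count X b = count Y b" using assms(4,5) by (cases "b \<in> {1, 2, 3}") auto
qed

lemma rank_count_word:
  assumes "c \<le> d"
  shows "count (mset (map (block c d \<circ> a) [1..<Suc x])) 1 = rank_count a x c"
    and "count (mset (map (block c d \<circ> a) [1..<Suc x])) 3 + rank_count a x d = x"
  using assms by (induction x) (auto simp: rank_count_Suc block_def One_nat_def)

text \<open>Letters 1 and 3 of the prefixes are counted by the ranks at the four block corners, and
  letters 2 are forced by the sizes. This links the generating functions with the Bruhat
  order.\<close>

lemma in_class_iff: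
  assumes "size A = c" "size A + size B = d" "d \<le> n" "set_mset A \<subseteq> {1, 2, 3}" "set_mset B \<subseteq> {1, 2, 3}"
  shows "in_class n c d A B a \<longleftrightarrow>
    rank_count a c c = count A 1 \<and> rank_count a c d + count A 3 = c \<and>
    rank_count a d c = count A 1 + count B 1 \<and> rank_count a d d + (count A 3 + count B 3) = d"
proof -
  let ?w = "map (block c d \<circ> a) [1..<Suc n]"
  have cd: "c \<le> d" using assms by simp
  have set123: "set xs \<subseteq> {1, 2, 3}" if "set xs \<subseteq> set ?w" for xs
    using that by (auto simp: block_def)
  have pre: "take x ?w = map (block c d \<circ> a) [1..<Suc x]" if "x \<le> n" for x
    using that by (simp add: take_map take_upt plus_1_eq_Suc del: upt_Suc)
  have d': "take d ?w = take c ?w @ take (size B) (drop c ?w)"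
    using assms by (metis take_add)
  have c1: "count (mset (take c ?w)) 1 = rank_count a c c" "count (mset (take c ?w)) 3 + rank_count a c d = c"
    using pre[of c] rank_count_word[OF cd, of a c] cd assms(3) by simp_all
  have c2: "count (mset (take d ?w)) 1 = rank_count a d c" "count (mset (take d ?w)) 3 + rank_count a d d = d"
    using pre[of d] rank_count_word[OF cd, of a d] assms(3) by simp_all
  have iff: "X = Y \<longleftrightarrow> count X 1 = count Y 1 \<and> count X 3 = count Y 3"
    if "set_mset X \<subseteq> {1, 2, 3}" "set_mset Y \<subseteq> {1, 2, 3}" "size X = size Y" for X Y :: "nat multiset"
    using multiset_eq_123[OF that] by blast
  have len: "length ?w = n" by simp
  have "mset (take c ?w) = A \<longleftrightarrow> count (mset (take c ?w)) 1 = count A 1 \<and> count (mset (take c ?w)) 3 = count A 3"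
  proof (rule iff[OF _ assms(4)])
    show "set_mset (mset (take c ?w)) \<subseteq> {1, 2, 3}"
      using set123[OF set_take_subset] unfolding set_mset_mset .
    show "size (mset (take c ?w)) = size A"
      unfolding size_mset length_take len using assms(1,3) cd by simp
  qed
  moreover have "mset (take (size B) (drop c ?w)) = B \<longleftrightarrow>
      count (mset (take (size B) (drop c ?w))) 1 = count B 1 \<and> count (mset (take (size B) (drop c ?w))) 3 = count B 3"
  proof (rule iff[OF _ assms(5)])
    have "set (take (size B) (drop c ?w)) \<subseteq> set ?w"
      using set_take_subset set_drop_subset by (rule order_trans)
    then show "set_mset (mset (take (size B) (drop c ?w))) \<subseteq> {1, 2, 3}"
      unfolding set_mset_mset by (rule set123)
    show "size (mset (take (size B) (drop c ?w))) = size B"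
      unfolding size_mset length_take length_drop len using assms(1-3) by simp
  qed
  ultimately have "in_class n c d A B a \<longleftrightarrow>
      count (mset (take c ?w)) 1 = count A 1 \<and> count (mset (take c ?w)) 3 = count A 3 \<and>
      count (mset (take (size B) (drop c ?w))) 1 = count B 1 \<and> count (mset (take (size B) (drop c ?w))) 3 = count B 3"
    unfolding in_class_def assms(1) by blast
  moreover have "count (mset (take d ?w)) b = count (mset (take c ?w)) b + count (mset (take (size B) (drop c ?w))) b" for b
    unfolding d' by simp
  ultimately show ?thesis using c1 c2 by (auto simp del: upt_Suc) 
qed

section \<open>Maximal elements of double cosets\<close>

text \<open>In a decreasing run the values above \<open>q\<close> come first. So the count in column
  \<open>q\<close> is first constant and then grows by one in every row.\<close>

lemma block_row:
  assumes "\<And>i. k < i \<Longrightarrow> i < k' \<Longrightarrow> a (Suc i) < a i" "k \<le> i" "i \<le> k'"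
  shows "rank_count a i q = rank_count a k q \<or> rank_count a k' q = rank_count a i q + (k' - i)"
proof (cases "\<exists>j. k < j \<and> j \<le> i \<and> a j \<le> q")
  case True
  then obtain j where j: "k < j" "j \<le> i" "a j \<le> q" by blast
  have le: "a j' \<le> q" if "j \<le> j'" "j' \<le> k'" for j'
    using that
  proof (induction j' rule: dec_induct)
    case (step m)
    then show ?case using assms(1)[of m] j by simp
  qed (use j in simp)
  have "rank_count a i' q = rank_count a i q + (i' - i)" if "i \<le> i'" "i' \<le> k'" for i'
    using that
  proof (induction i' rule: dec_induct)
    case (step m)
    then show ?case using le[of "Suc m"] j by (simp add: rank_count_Suc)
  qed simp
  from this[of k'] show ?thesis using assms(2,3) by simp
next
  case False
  have "rank_count a i' q = rank_count a k q" if "k \<le> i'" "i' \<le> i" for i'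
    using that
  proof (induction i' rule: dec_induct)
    case (step m)
    then have "\<not> a (Suc m) \<le> q" using False by auto
    then show ?case using step by (simp add: rank_count_Suc)
  qed simp
  from this[of i] show ?thesis using assms(2,3) by simp
qed

lemma rank_count_mono: "k \<le> i \<Longrightarrow> rank_count b k q \<le> rank_count b i q"
  and rank_count_Lipschitz: "k \<le> i \<Longrightarrow> rank_count b i q \<le> rank_count b k q + (i - k)"
  by (induction i rule: dec_induct) (auto simp: rank_count_Suc)

text \<open>Inside a block the count for \<open>w\<close> either still has its value at the start of
  the block, and counts are monotone, or grows at full rate to the end of the block, and no count
  grows faster.\<close>

lemma rank_le_rows:
  assumes u: "u permutes {1..n}" and w: "w permutes {1..n}" and K: "K \<subseteq> {1..<n}"
    and desc: "\<And>i. 1 \<le> i \<Longrightarrow> i < n \<Longrightarrow> i \<notin> K \<Longrightarrow> w (Suc i) < w i"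
    and le: "\<And>k. k \<in> K \<Longrightarrow> rank_count w k q \<le> rank_count u k q"
  shows "rank_count w i q \<le> rank_count u i q"
proof (cases "i \<le> n")
  case False
  then show ?thesis using rank_count_beyond[OF u w] by simp
next
  case True
  define A where "A = {k \<in> insert 0 K. k \<le> i}"
  define B where "B = {k \<in> insert n K. i \<le> k}"
  have fin: "finite K" using K by (rule finite_subset) simp
  have A: "finite A" "0 \<in> A" and B: "finite B" "n \<in> B"
    using fin True by (auto simp: A_def B_def)
  define k where "k = Max A"
  define k' where "k' = Min B"
  have "k \<in> A" "k' \<in> B" unfolding k_def k'_def using A B by (auto intro!: Max_in Min_in)
  then have k: "k \<in> insert 0 K" "k \<le> i" and k': "k' \<in> insert n K" "i \<le> k'" by (auto simp: A_def B_def)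
  have kn: "k' \<le> n" using k' K by auto
  have "w (Suc j) < w j" if "k < j" "j < k'" for j
  proof (rule desc)
    show "j \<notin> K"
    proof
      assume "j \<in> K"
      then have "j \<in> A \<or> j \<in> B" by (auto simp: A_def B_def)
      then show False using that Max_ge[OF A(1), of j] Min_le[OF B(1), of j] by (auto simp: k_def k'_def)
    qed
  qed (use that kn in auto)
  then consider "rank_count w i q = rank_count w k q" | "rank_count w k' q = rank_count w i q + (k' - i)"
    using block_row[of k k' w i q] k k' by blast
  then show ?thesis
  proof cases
    case 1
    then show ?thesis using le[of k] k rank_count_mono[of k i u q] by auto
  next
    case 2
    have "rank_count w k' q \<le> rank_count u k' q"
      using le[of k'] k' rank_count_beyond[OF u w, of n q] by auto
    then show ?thesis using 2 rank_count_Lipschitz[of i k' u q] k' by simp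
  qed
qed

text \<open>\<open>K\<close> holds the block ends other than \<open>n\<close>: \<open>w\<close> is
  the longest element of its double coset for the Young subgroup generated by the
  \<open>adj i\<close> with \<open>i \<notin> K\<close>.\<close>

definition double_max :: "nat \<Rightarrow> nat set \<Rightarrow> (nat \<Rightarrow> nat) \<Rightarrow> bool" where
  "double_max n K w \<longleftrightarrow> w permutes {1..n} \<and> (\<forall>i. 1 \<le> i \<and> i < n \<and> i \<notin> K \<longrightarrow> desc n w i \<and> desc n (inv w) i)"

text \<open>\<open>rank_le_rows\<close> is used twice: on the inverses it passes from the corners to
  all columns of the rows in \<open>K\<close>, then from these rows to all rows.\<close>

lemma rank_le_corners:
  assumes u: "u permutes {1..n}" and w: "double_max n K w" and K: "K \<subseteq> {1..<n}"
    and le: "\<And>k l. k \<in> K \<Longrightarrow> l \<in> K \<Longrightarrow> rank_count w k l \<le> rank_count u k l"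
  shows "rank_le u w"
proof -
  have pw: "w permutes {1..n}" using w by (simp add: double_max_def)
  note iu = permutes_inv[OF u] and iw = permutes_inv[OF pw]
  have cols: "rank_count w k q \<le> rank_count u k q" if "k \<in> K" for k q
  proof -
    have "rank_count (inv w) q k \<le> rank_count (inv u) q k"
    proof (rule rank_le_rows[OF iu iw K])
      show "inv w (Suc i) < inv w i" if "1 \<le> i" "i < n" "i \<notin> K" for i
        using w that unfolding double_max_def desc_def by blast
      show "rank_count (inv w) l k \<le> rank_count (inv u) l k" if "l \<in> K" for l
        using le[OF \<open>k \<in> K\<close> that] unfolding rank_count_inv[OF u] rank_count_inv[OF pw] .
    qed
    then show ?thesis by (simp add: rank_count_inv[OF u] rank_count_inv[OF pw])
  qed
  have "rank_count w i q \<le> rank_count u i q" for i q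
  proof (rule rank_le_rows[OF u pw K _ cols])
    show "w (Suc i) < w i" if "1 \<le> i" "i < n" "i \<notin> K" for i
      using w that unfolding double_max_def desc_def by blast
  qed
  then show ?thesis by (simp add: rank_le_def)
qed

text \<open>As long as there is an ascent outside \<open>K\<close>, on the right or on the left,
  multiplication there gives a longer element. The polynomial stays because \<open>w\<close> has a
  descent there, and the corner ranks stay because \<open>i\<close> is no block end.\<close>

lemma KL_poly_class_max:
  assumes w: "double_max n K w" and K: "K \<subseteq> {1..<n}" and "u permutes {1..n}"
  shows "\<exists>z. double_max n K z \<and> KL_poly n z w = KL_poly n u w \<and>
    (\<forall>k\<in>K. \<forall>l\<in>K. rank_count z k l = rank_count u k l)"
  using assms(3)
proof (induction "n * n - inversions n u" arbitrary: u rule: less_induct)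
  case less
  note u = less.prems
  have pw: "w permutes {1..n}" using w by (simp add: double_max_def)
  have inv_le: "inversions n v \<le> n * n" for v
  proof -
    have "inversions n v \<le> card ({1..n} \<times> {1..n})"
      unfolding inversions_def by (rule card_mono) auto
    then show ?thesis by (simp add: card_cartesian_product)
  qed
  show ?case
  proof (cases "double_max n K u")
    case False
    then obtain i where i: "1 \<le> i" "i < n" "i \<notin> K" "\<not> desc n u i \<or> \<not> desc n (inv u) i"
      using u by (auto simp: double_max_def)
    have dw: "desc n w i" "desc n (inv w) i" using w i by (auto simp: double_max_def)
    note iu = permutes_inv[OF u]
    show ?thesis
    proof (cases "desc n u i")
      case False
      define u' where "u' = u \<circ> adj i"
      have u': "u' permutes {1..n}" unfolding u'_def using i u by (intro permutes_comp_adj)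
      have "inversions n u' = Suc (inversions n u)"
        unfolding u'_def using False i u permutes_neq_Suc[OF u, of i]
        by (intro inversions_swap) (auto simp: desc_def)
      then obtain z where z: "double_max n K z" "KL_poly n z w = KL_poly n u' w"
        "\<forall>k\<in>K. \<forall>l\<in>K. rank_count z k l = rank_count u' k l"
        using less.hyps[of u'] u' inv_le[of u'] by fastforce
      moreover have "rank_count u' k l = rank_count u k l" if "k \<in> K" for k l
        unfolding u'_def using that i by (intro rank_count_comp_adj) auto
      moreover have "KL_poly n u' w = KL_poly n u w"
        unfolding u'_def by (rule KL_poly_comp_desc[OF pw dw(1) u])
      ultimately show ?thesis by auto
    next
      case True
      then have F: "\<not> desc n (inv u) i" using i by simp
      define u' where "u' = adj i \<circ> u"
      have u': "u' permutes {1..n}" unfolding u'_def using i u by (intro adj_comp_permutes)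
      have iu': "inv u' = inv u \<circ> adj i" unfolding u'_def using permutes_bij[OF u] by (rule inv_adj_comp)
      have "inversions n (inv u') = Suc (inversions n (inv u))"
        unfolding iu' using F i iu permutes_neq_Suc[OF iu, of i]
        by (intro inversions_swap) (auto simp: desc_def)
      then have "inversions n u' = Suc (inversions n u)" using inversions_inv u u' by simp
      then obtain z where z: "double_max n K z" "KL_poly n z w = KL_poly n u' w"
        "\<forall>k\<in>K. \<forall>l\<in>K. rank_count z k l = rank_count u' k l"
        using less.hyps[of u'] u' inv_le[of u'] by fastforce
      moreover have "rank_count u' k l = rank_count u k l" if "l \<in> K" for k l
      proof -
        have "rank_count (inv u') l k = rank_count (inv u) l k"
          unfolding iu' using that i by (intro rank_count_comp_adj) auto
        then show ?thesis by (simp add: rank_count_inv[OF u] rank_count_inv[OF u'])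
      qed
      moreover have "KL_poly n u' w = KL_poly n u w"
        unfolding u'_def by (rule KL_poly_left_comp_desc[OF pw dw(2) u])
      ultimately show ?thesis by auto
    qed
  qed auto
qed

text \<open>Corner ranks determine the maximal element, by \<open>rank_le_corners\<close> in both
  directions.\<close>

lemma KL_poly_corners:
  assumes w: "double_max n K w" and z: "double_max n K z" and K: "K \<subseteq> {1..<n}" and u: "u permutes {1..n}"
    and eq: "\<And>k l. k \<in> K \<Longrightarrow> l \<in> K \<Longrightarrow> rank_count u k l = rank_count z k l"
  shows "KL_poly n u w = KL_poly n z w"
proof -
  obtain z' where z': "double_max n K z'" "KL_poly n z' w = KL_poly n u w"
    "\<forall>k\<in>K. \<forall>l\<in>K. rank_count z' k l = rank_count u k l"
    using KL_poly_class_max[OF w K u] by blast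
  have "z' permutes {1..n}" "z permutes {1..n}" using z z' by (auto simp: double_max_def)
  moreover from this have "rank_le z' z" "rank_le z z'"
    using z' eq by (auto intro!: rank_le_corners[OF _ z K] rank_le_corners[OF _ z'(1) K])
  ultimately have "z' = z" by (rule rank_le_antisym)
  then show ?thesis using z' by simp
qed

text \<open>The members of a double coset are below its maximal element, so the length of that element
  is the degree of the generating function.\<close>

lemma degree_class_sum:
  assumes z: "double_max n K z" and K: "K \<subseteq> {1..<n}" and C: "C z"
    and eq: "\<And>a k l. a permutes {1..n} \<Longrightarrow> C a \<Longrightarrow> k \<in> K \<Longrightarrow> l \<in> K \<Longrightarrow> rank_count a k l = rank_count z k l"
  shows "degree (\<Sum>a | a permutes {1..n}. qX ^ inversions n a * of_bool (C a)) = inversions n z"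
proof -
  let ?S = "\<Sum>a | a permutes {1..n}. qX ^ inversions n a * of_bool (C a)"
  have pz: "z permutes {1..n}" using z by (simp add: double_max_def)
  have lt: "inversions n a < inversions n z" if "a permutes {1..n}" "C a" "a \<noteq> z" for a
  proof -
    have "rank_le a z" using that eq by (intro rank_le_corners[OF _ z K]) auto
    then have "bruhat_le n a z" using that pz by (simp add: bruhat_le_iff)
    then show ?thesis using that bruhat_le_inversions(2) by blast
  qed
  have co: "coeff ?S k = (\<Sum>a | a permutes {1..n}. of_bool (C a \<and> inversions n a = k))" for k
    unfolding coeff_sum qX_power by (intro sum.cong) auto
  have "coeff ?S k = 0" if "inversions n z < k" for k
    unfolding co using lt that by (intro sum.neutral) fastforce
  moreover have "coeff ?S (inversions n z) = (\<Sum>a | a permutes {1..n}. of_bool (a = z))"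
    unfolding co
  proof (intro sum.cong refl)
    fix a assume "a \<in> {a. a permutes {1..n}}"
    then have "(C a \<and> inversions n a = inversions n z) \<longleftrightarrow> a = z" using lt[of a] C by (metis less_irrefl mem_Collect_eq)
    then show "of_bool (C a \<and> inversions n a = inversions n z) = (of_bool (a = z) :: int)" by simp
  qed
  then have "coeff ?S (inversions n z) = 1" using pz finite_perms[of n] by (simp add: of_bool_def)
  ultimately show ?thesis by (intro antisym degree_le le_degree) auto
qed

section \<open>The three types of configurations\<close>

text \<open>The patterns and the intermediate maximal elements are involutions, so left and right
  descents coincide.\<close>

lemma involution_double_max:
  assumes inv: "\<And>i. w (w i) = i" and out: "\<And>i. i \<notin> {1..n} \<Longrightarrow> w i = i"
    and desc: "\<And>i. 1 \<le> i \<Longrightarrow> i < n \<Longrightarrow> i \<notin> K \<Longrightarrow> w (Suc i) < w i"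
  shows "double_max n K w \<and> inv w = w"
proof -
  have i: "inv w = w" using inv by (intro inv_unique_comp) (auto simp: fun_eq_iff)
  have "w permutes {1..n}"
    unfolding permutes_def using inv out by metis
  then show ?thesis using desc by (auto simp: double_max_def desc_def i)
qed

lemma rank_count_full:
  assumes "\<And>i. 1 \<le> i \<Longrightarrow> i \<le> x \<Longrightarrow> w i \<le> q"
  shows "rank_count w x q = x"
  using assms by (simp add: rank_count_sum)

lemma rank_count_but_one:
  assumes "1 \<le> j" "j \<le> x" "q < w j" "\<And>i. 1 \<le> i \<Longrightarrow> i \<le> x \<Longrightarrow> i \<noteq> j \<Longrightarrow> w i \<le> q"
  shows "Suc (rank_count w x q) = x"
proof -
  have "rank_count w x q = (\<Sum>i\<in>{1..x} - {j}. of_bool (w i \<le> q))"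
    unfolding rank_count_sum using assms(1-3) by (subst sum.remove[where x = j]) auto
  also have "\<dots> = (\<Sum>i\<in>{1..x} - {j}. 1)" using assms(4) by (intro sum.cong) auto
  finally show ?thesis using assms(1,2) by simp
qed

lemma rank_count_le_row: "rank_count w x q \<le> x"
  using rank_count_Lipschitz[of 0 x w q] by simp

lemma rank_count_le_col: "w permutes {1..n} \<Longrightarrow> rank_count w x q \<le> q"
  using rank_count_le_row[of "inv w" q x] by (simp add: rank_count_inv)

lemma rank_count_involution:
  assumes "w permutes {1..n}" "inv w = w"
  shows "rank_count w x q = rank_count w q x"
  using rank_count_inv[OF assms(1), of x q] assms(2) by simp

lemma cross_add [simp]: "cross (add_mset a A) B = size (filter_mset (\<lambda>b. b < a) B) + cross A B"
  by (simp add: cross_def)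

lemma cross_replicate [simp]: "cross (replicate_mset r a) B = r * size (filter_mset (\<lambda>b. b < a) B)"
  by (induction r) (auto simp: cross_def)

lemma rv_monom: "a \<le> d \<Longrightarrow> rv d (monom c a) = monom c (d - a)"
  by (rule poly_eqI) (auto simp: coeff_rv)

lemma rv_palindromic: "palindromic p \<Longrightarrow> degree p = d \<Longrightarrow> rv d p = p"
  by (simp add: palindromic_def)

subsection \<open>Type 4231\<close>

text \<open>Blocks of sizes \<open>p = l + 1\<close> and \<open>m\<close> (the paper's \<open>m + 1\<close>).\<close>

definition omA :: "nat \<Rightarrow> nat \<Rightarrow> nat \<Rightarrow> nat" where
  "omA p m i = (if i = 0 then 0 else if i = 1 then p + m else if i \<le> p then p + 2 - i
     else if i < p + m then 2 * p + m - i else if i = p + m then 1 else i)"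

definition nuA :: "nat \<Rightarrow> nat \<Rightarrow> nat \<Rightarrow> nat" where
  "nuA p m i = (if i = 0 then 0 else if i \<le> p then p + 1 - i
     else if i \<le> p + m then 2 * p + m + 1 - i else i)"

lemma omA_props:
  assumes "1 \<le> p" "1 \<le> m"
  shows "double_max (p + m) {p} (omA p m)" "inv (omA p m) = omA p m"
    "Suc (rank_count (omA p m) p p) = p"
proof -
  have "omA p m (omA p m i) = i" for i using assms by (auto simp: omA_def)
  moreover have "omA p m i = i" if "i \<notin> {1..p + m}" for i using assms that by (auto simp: omA_def)
  moreover have "omA p m (Suc i) < omA p m i" if "1 \<le> i" "i < p + m" "i \<notin> {p}" for i
    using assms that by (auto simp: omA_def)
  ultimately have "double_max (p + m) {p} (omA p m) \<and> inv (omA p m) = omA p m"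
    by (rule involution_double_max)
  then show "double_max (p + m) {p} (omA p m)" "inv (omA p m) = omA p m" by auto
  show "Suc (rank_count (omA p m) p p) = p"
    using assms by (intro rank_count_but_one[of 1]) (auto simp: omA_def)
qed

lemma nuA_props:
  assumes "1 \<le> p" "1 \<le> m"
  shows "double_max (p + m) {p} (nuA p m)" "inv (nuA p m) = nuA p m"
    "rank_count (nuA p m) p p = p"
proof -
  have "nuA p m (nuA p m i) = i" for i using assms by (auto simp: nuA_def)
  moreover have "nuA p m i = i" if "i \<notin> {1..p + m}" for i using assms that by (auto simp: nuA_def)
  moreover have "nuA p m (Suc i) < nuA p m i" if "1 \<le> i" "i < p + m" "i \<notin> {p}" for i
    using assms that by (auto simp: nuA_def)
  ultimately have "double_max (p + m) {p} (nuA p m) \<and> inv (nuA p m) = nuA p m"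
    by (rule involution_double_max)
  then show "double_max (p + m) {p} (nuA p m)" "inv (nuA p m) = nuA p m" by auto
  show "rank_count (nuA p m) p p = p"
    by (intro rank_count_full) (auto simp: nuA_def)
qed

text \<open>Only two double cosets lie below \<open>omA\<close>; they have rank \<open>p\<close> or
  \<open>p - 1\<close> at the corner \<open>(p, p)\<close>. Writing [k] for \<open>qint k\<close>,
  their generating functions are Q and Q q [p] [m], so R = q [p] [m] and d = p + m - 1.\<close>

lemma KL_poly_typeA:
  assumes p: "1 \<le> p" and m: "1 \<le> m"
  shows "KL_poly (p + m) (nuA p m) (omA p m) = qint (min p m)"
proof -
  let ?n = "p + m" and ?om = "omA p m" and ?nu = "nuA p m"
  note om = omA_props[OF p m] and nu = nuA_props[OF p m]
  have K: "{p} \<subseteq> {1..<?n}" using p m by auto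
  have pom: "?om permutes {1..?n}" and pnu: "?nu permutes {1..?n}"
    using om(1) nu(1) by (auto simp: double_max_def)
  obtain p' where p': "p = Suc p'" using p by (cases p) auto
  obtain m' where m': "m = Suc m'" using m by (cases m) auto
  \<comment> \<open>In the class of \<open>nuA\<close> each segment keeps its own letters; in the
    class of \<open>omA\<close> one letter 1 and one letter 2 have changed places.\<close>
  define A0 B0 A1 B1 :: "nat multiset" where "A0 = replicate_mset p 1" and "B0 = replicate_mset m 2"
    and "A1 = add_mset 2 (replicate_mset p' 1)" and "B1 = add_mset 1 (replicate_mset m' 2)"
  define M where "M = replicate_mset p 1 + replicate_mset m (2::nat)"
  define Q where "Q = qfacts M"
  \<comment> \<open>The second cut is placed at \<open>?n\<close>: the third block is empty and only
    the corner \<open>(p, p)\<close> has a variable rank.\<close>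
  have corner: "rank_count a p ?n = p" "rank_count a ?n p = p" "rank_count a ?n ?n = ?n"
    if "a permutes {1..?n}" for a
    using rank_count_last_row[OF that, of p] rank_count_last_row[OF that, of ?n]
      rank_count_last_row[OF permutes_inv[OF that], of p] by (auto simp: rank_count_inv[OF that])
  have c0: "in_class ?n p ?n A0 B0 a \<longleftrightarrow> rank_count a p p = p" if "a permutes {1..?n}" for a
    by (subst in_class_iff) (auto simp: A0_def B0_def corner[OF that])
  have e: "r = p' \<longleftrightarrow> Suc r = p" for r using p' by auto
  have c1: "in_class ?n p ?n A1 B1 a \<longleftrightarrow> Suc (rank_count a p p) = p" if "a permutes {1..?n}" for a
    by (subst in_class_iff) (auto simp: A1_def B1_def corner[OF that] p'[symmetric] m'[symmetric] e)
  have bounds: "p \<le> ?n" "?n \<le> ?n" by auto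
  have M: "M = replicate_mset p 1 + replicate_mset (?n - p) 2 + replicate_mset (?n - ?n) 3"
    by (simp add: M_def)
  have M0: "M = A0 + B0 + {#}" by (simp add: M_def A0_def B0_def)
  have M1: "M = A1 + B1 + {#}" by (simp add: M_def A1_def B1_def p' m')
  have "cross A0 B0 = 0" "qmult A0 = 1" "qmult B0 = 1"
    by (simp_all add: A0_def B0_def filter_replicate_mset)
  then have s0: "(\<Sum>a | a permutes {1..?n}. qX ^ inversions ?n a * of_bool (in_class ?n p ?n A0 B0 a)) = Q"
    unfolding class_sum[OF bounds M M0] by (simp add: Q_def)
  have "cross A1 B1 = 1" by (simp add: A1_def B1_def filter_replicate_mset One_nat_def)
  moreover have "qmult A1 = qint p" "qmult B1 = qint m"
    using qmult_one_large[of 1 2 p'] qmult_one_small[of 1 2 m'] by (simp_all add: A1_def B1_def p' m')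
  ultimately have s1: "(\<Sum>a | a permutes {1..?n}. qX ^ inversions ?n a * of_bool (in_class ?n p ?n A1 B1 a)) =
      Q * (qX * qint p * qint m)"
    unfolding class_sum[OF bounds M M1] by (simp add: Q_def del: mult_pCons_left)
  have KL: "KL_poly ?n a ?om = of_bool (in_class ?n p ?n A0 B0 a) * KL_poly ?n ?nu ?om + of_bool (in_class ?n p ?n A1 B1 a)"
    if a: "a permutes {1..?n}" for a
  proof -
    consider "rank_count a p p = p" | "Suc (rank_count a p p) = p" | "Suc (rank_count a p p) < p"
      using rank_count_le_row[of a p p] by linarith
    then show ?thesis
    proof cases
      case 1
      then have "KL_poly ?n a ?om = KL_poly ?n ?nu ?om"
        using nu by (intro KL_poly_corners[OF om(1) nu(1) K a]) auto
      then show ?thesis using 1 by (simp add: c0[OF a] c1[OF a])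
    next
      case 2
      then have "KL_poly ?n a ?om = KL_poly ?n ?om ?om"
        using om by (intro KL_poly_corners[OF om(1) om(1) K a]) auto
      then show ?thesis using 2 KL_poly_refl[OF pom] by (simp add: c0[OF a] c1[OF a])
    next
      case 3
      have "\<not> rank_le a ?om"
      proof
        assume "rank_le a ?om"
        then have "rank_count ?om p p \<le> rank_count a p p" by (simp add: rank_le_def)
        then show False using 3 om(3) by simp
      qed
      then have "KL_poly ?n a ?om = 0" using KL_poly_zero[OF a pom] by (simp add: bruhat_le_iff)
      then show ?thesis using 3 by (simp add: c0[OF a] c1[OF a])
    qed
  qed
  define P where "P = KL_poly ?n ?nu ?om"
  define R where "R = qX * qint p * qint m"
  have T: "(\<Sum>a | a permutes {1..?n}. qX ^ inversions ?n a * KL_poly ?n a ?om) = Q * (P + R)"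
  proof -
    have "(\<Sum>a | a permutes {1..?n}. qX ^ inversions ?n a * KL_poly ?n a ?om) =
      (\<Sum>a | a permutes {1..?n}. qX ^ inversions ?n a * of_bool (in_class ?n p ?n A0 B0 a) * P +
        qX ^ inversions ?n a * of_bool (in_class ?n p ?n A1 B1 a))"
      by (intro sum.cong refl) (use KL in \<open>simp add: P_def algebra_simps\<close>)
    also have "\<dots> = Q * P + Q * R"
      unfolding sum.distrib sum_distrib_right[symmetric] s0 s1 R_def ..
    finally show ?thesis by (simp add: algebra_simps)
  qed
  have palQ: "palindromic Q" unfolding Q_def by (rule palindromic_qfacts)
  have degX: "degree qX = 1" "qX \<noteq> 0" by auto
  have degR: "degree R = p + m - 1"
    unfolding R_def p' m' using palindromic_neq_0[OF palindromic_qint] degX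
    by (simp add: degree_mult_eq degree_qint del: mult_pCons_left)
  \<comment> \<open>Both lengths are obtained as degrees of class sums, which avoids counting the
    inversions of the patterns.\<close>
  have dnu: "degree Q = inversions ?n ?nu"
    unfolding s0[symmetric]
    by (rule degree_class_sum[OF nu(1) K]) (use c0 pnu nu(3) in auto)
  have "degree (Q * R) = inversions ?n ?om"
    unfolding R_def s1[symmetric]
    by (rule degree_class_sum[OF om(1) K]) (use c1 pom om(3) in auto)
  moreover have "R \<noteq> 0"
    unfolding R_def p' m' using palindromic_neq_0[OF palindromic_qint] degX by (simp del: mult_pCons_left)
  ultimately have dom: "inversions ?n ?om = degree Q + (p + m - 1)"
    using palindromic_neq_0[OF palQ] degR by (simp add: degree_mult_eq)
  have le: "bruhat_le ?n ?nu ?om" "?nu \<noteq> ?om"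
  proof -
    have "rank_le ?nu ?om" using om(3) nu(3) by (intro rank_le_corners[OF pnu om(1) K]) auto
    then show "bruhat_le ?n ?nu ?om" using pnu pom by (simp add: bruhat_le_iff)
    show "?nu \<noteq> ?om" using om(3) nu(3) by auto
  qed
  have "P = qint (min p m)"
  proof (rule palindromic_quotient[OF palQ])
    show "1 \<le> p + m - 1" "degree R \<le> p + m - 1" using p degR m by auto
    show "rv (degree Q + (p + m - 1)) (Q * (P + R)) = Q * (P + R)"
      using KL_poly_sum_palindromic[OF pom] unfolding T dom .
    show "2 * degree P \<le> p + m - 1 - 1"
      using KL_poly_degree[OF le] unfolding P_def dom dnu by simp
    show "2 * degree (qint (min p m)) \<le> p + m - 1 - 1"
      by (cases "p \<le> m") (auto simp: p' m' degree_qint)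
    \<comment> \<open>The guess completes a product: [p] + q [p] [m] = [p] [m + 1] if
      \<open>p \<le> m\<close>, and [m] [p + 1] arises in the same way otherwise.\<close>
    show "rv (p + m - 1) (qint (min p m) + R) = qint (min p m) + R"
    proof (cases "p \<le> m")
      case True
      then have "qint (min p m) + R = qint (Suc p') * qint (Suc m)"
        unfolding qint_Suc'[of m] R_def p'[symmetric] by (simp add: algebra_simps del: mult_pCons_left)
      then show ?thesis
        using palindromic_mult[OF palindromic_qint palindromic_qint, of p' m]
        by (simp add: rv_palindromic degree_qint p')
    next
      case False
      then have "qint (min p m) + R = qint (Suc m') * qint (Suc p)"
        unfolding qint_Suc'[of p] R_def m'[symmetric] by (simp add: algebra_simps del: mult_pCons_left)
      then show ?thesis
        using palindromic_mult[OF palindromic_qint palindromic_qint, of m' p]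
        by (simp add: rv_palindromic degree_qint m')
    qed
  qed
  then show ?thesis by (simp add: P_def)
qed

lemma KL_poly_configurationA:
  assumes "1 \<le> p" "1 \<le> m" "configuration n (p + m) x y (nuA p m) (omA p m) v w"
  shows "KL_poly n v w = qint (min p m)"
proof -
  have "nuA p m permutes {1..p + m}" "omA p m permutes {1..p + m}"
    using omA_props(1)[OF assms(1,2)] nuA_props(1)[OF assms(1,2)] by (auto simp: double_max_def)
  moreover have "nuA p m a \<le> omA p m a" if "a \<le> p" for a using that assms(1,2) by (auto simp: nuA_def omA_def)
  moreover have "omA p m a \<le> nuA p m a" if "p < a" for a using that assms(1,2) by (auto simp: nuA_def omA_def)
  ultimately have "KL_poly n v w = KL_poly (p + m) (nuA p m) (omA p m)"
    using assms by (intro KL_poly_configuration[where t = p and x = x and y = y]) auto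
  then show ?thesis using KL_poly_typeA[OF assms(1,2)] by simp
qed

subsection \<open>Types \<open>34*12\<close> and \<open>34\<emptyset>12\<close>\<close>

text \<open>Both types have the same shape, with blocks of sizes \<open>p\<close>, \<open>k\<close>, \<open>m\<close>: the first one is
  \<open>p = m = 1\<close>, \<open>k = l + 2\<close> and the second one is \<open>k = 2\<close>.\<close>

definition omB :: "nat \<Rightarrow> nat \<Rightarrow> nat \<Rightarrow> nat \<Rightarrow> nat" where
  "omB p k m i = (if i = 0 then 0 else if i = 1 then p + k else if i \<le> p then p + 2 - i
     else if i = p + 1 then p + k + m else if i < p + k then 2 * p + k + 1 - i else if i = p + k then 1
     else if i < p + k + m then 2 * p + 2 * k + m - i else if i = p + k + m then p + 1 else i)"

definition nuB :: "nat \<Rightarrow> nat \<Rightarrow> nat \<Rightarrow> nat \<Rightarrow> nat" where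
  "nuB p k m i = (if i = 0 then 0 else if i \<le> p then p + 1 - i
     else if i \<le> p + k then 2 * p + k + 1 - i else if i \<le> p + k + m then 2 * p + 2 * k + m + 1 - i else i)"

text \<open>The maximal elements of the two double cosets strictly between those of \<open>nuB\<close> and \<open>omB\<close>.\<close>

definition upperB :: "nat \<Rightarrow> nat \<Rightarrow> nat \<Rightarrow> nat \<Rightarrow> nat" where
  "upperB p k m i = (if i = 0 then 0 else if i = 1 then p + k else if i \<le> p then p + 2 - i
     else if i < p + k then 2 * p + k - i else if i = p + k then 1
     else if i \<le> p + k + m then 2 * p + 2 * k + m + 1 - i else i)"

definition lowerB :: "nat \<Rightarrow> nat \<Rightarrow> nat \<Rightarrow> nat \<Rightarrow> nat" where
  "lowerB p k m i = (if i = 0 then 0 else if i \<le> p then p + 1 - i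
     else if i = p + 1 then p + k + m else if i \<le> p + k then 2 * p + k + 2 - i
     else if i < p + k + m then 2 * p + 2 * k + m - i else if i = p + k + m then p + 1 else i)"

lemma omB_props:
  assumes "1 \<le> p" "2 \<le> k" "1 \<le> m"
  shows "double_max (p + k + m) {p, p + k} (omB p k m)" "inv (omB p k m) = omB p k m"
    "Suc (rank_count (omB p k m) p p) = p" "rank_count (omB p k m) p (p + k) = p"
    "Suc (rank_count (omB p k m) (p + k) (p + k)) = p + k"
proof -
  have "omB p k m (omB p k m i) = i" for i
  proof -
    consider "i = 0" | "i = 1" | "2 \<le> i" "i \<le> p" | "i = p + 1" | "p + 1 < i" "i < p + k" | "i = p + k" | "p + k < i" "i < p + k + m" | "i = p + k + m" | "p + k + m < i"
      by linarith
    then show ?thesis using assms by cases (simp_all add: omB_def, arith+)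
  qed
  moreover have "omB p k m i = i" if "i \<notin> {1..p + k + m}" for i using assms that by (auto simp: omB_def)
  moreover have "omB p k m (Suc i) < omB p k m i" if "1 \<le> i" "i < p + k + m" "i \<notin> {p, p + k}" for i
    using assms that by (auto simp: omB_def)
  ultimately have "double_max (p + k + m) {p, p + k} (omB p k m) \<and> inv (omB p k m) = omB p k m"
    by (rule involution_double_max)
  then show "double_max (p + k + m) {p, p + k} (omB p k m)" "inv (omB p k m) = omB p k m" by auto
  show "Suc (rank_count (omB p k m) p p) = p"
    using assms by (intro rank_count_but_one[of 1]) (auto simp: omB_def)
  show "rank_count (omB p k m) p (p + k) = p"
    using assms by (intro rank_count_full) (auto simp: omB_def)
  show "Suc (rank_count (omB p k m) (p + k) (p + k)) = p + k"
    using assms by (intro rank_count_but_one[of "p + 1"]) (auto simp: omB_def)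
qed

lemma nuB_props:
  assumes "1 \<le> p" "2 \<le> k" "1 \<le> m"
  shows "double_max (p + k + m) {p, p + k} (nuB p k m)" "inv (nuB p k m) = nuB p k m"
    "rank_count (nuB p k m) p p = p" "rank_count (nuB p k m) p (p + k) = p"
    "rank_count (nuB p k m) (p + k) (p + k) = p + k"
proof -
  have "nuB p k m (nuB p k m i) = i" for i
  proof -
    consider "i = 0" | "1 \<le> i" "i \<le> p" | "p < i" "i \<le> p + k" | "p + k < i" "i \<le> p + k + m" | "p + k + m < i"
      by linarith
    then show ?thesis using assms by cases (simp_all add: nuB_def, arith+)
  qed
  moreover have "nuB p k m i = i" if "i \<notin> {1..p + k + m}" for i using assms that by (auto simp: nuB_def)
  moreover have "nuB p k m (Suc i) < nuB p k m i" if "1 \<le> i" "i < p + k + m" "i \<notin> {p, p + k}" for i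
    using assms that by (auto simp: nuB_def)
  ultimately have "double_max (p + k + m) {p, p + k} (nuB p k m) \<and> inv (nuB p k m) = nuB p k m"
    by (rule involution_double_max)
  then show "double_max (p + k + m) {p, p + k} (nuB p k m)" "inv (nuB p k m) = nuB p k m" by auto
  show "rank_count (nuB p k m) p p = p" "rank_count (nuB p k m) p (p + k) = p"
    "rank_count (nuB p k m) (p + k) (p + k) = p + k"
    using assms by (intro rank_count_full; auto simp: nuB_def)+
qed

lemma upperB_props:
  assumes "1 \<le> p" "2 \<le> k" "1 \<le> m"
  shows "double_max (p + k + m) {p, p + k} (upperB p k m)" "inv (upperB p k m) = upperB p k m"
    "Suc (rank_count (upperB p k m) p p) = p" "rank_count (upperB p k m) p (p + k) = p"
    "rank_count (upperB p k m) (p + k) (p + k) = p + k"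
proof -
  have "upperB p k m (upperB p k m i) = i" for i
  proof -
    consider "i = 0" | "i = 1" | "2 \<le> i" "i \<le> p" | "p < i" "i < p + k" | "i = p + k" | "p + k < i" "i \<le> p + k + m" | "p + k + m < i"
      by linarith
    then show ?thesis using assms by cases (simp_all add: upperB_def, arith+)
  qed
  moreover have "upperB p k m i = i" if "i \<notin> {1..p + k + m}" for i using assms that by (auto simp: upperB_def)
  moreover have "upperB p k m (Suc i) < upperB p k m i" if "1 \<le> i" "i < p + k + m" "i \<notin> {p, p + k}" for i
    using assms that by (auto simp: upperB_def)
  ultimately have "double_max (p + k + m) {p, p + k} (upperB p k m) \<and> inv (upperB p k m) = upperB p k m"
    by (rule involution_double_max)
  then show "double_max (p + k + m) {p, p + k} (upperB p k m)" "inv (upperB p k m) = upperB p k m" by auto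
  show "Suc (rank_count (upperB p k m) p p) = p"
    using assms by (intro rank_count_but_one[of 1]) (auto simp: upperB_def)
  show "rank_count (upperB p k m) p (p + k) = p" "rank_count (upperB p k m) (p + k) (p + k) = p + k"
    using assms by (intro rank_count_full; auto simp: upperB_def)+
qed

lemma lowerB_props:
  assumes "1 \<le> p" "2 \<le> k" "1 \<le> m"
  shows "double_max (p + k + m) {p, p + k} (lowerB p k m)" "inv (lowerB p k m) = lowerB p k m"
    "rank_count (lowerB p k m) p p = p" "rank_count (lowerB p k m) p (p + k) = p"
    "Suc (rank_count (lowerB p k m) (p + k) (p + k)) = p + k"
proof -
  have "lowerB p k m (lowerB p k m i) = i" for i
  proof -
    consider "i = 0" | "1 \<le> i" "i \<le> p" | "i = p + 1" | "p + 1 < i" "i \<le> p + k" | "p + k < i" "i < p + k + m" | "i = p + k + m" | "p + k + m < i"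
      by linarith
    then show ?thesis using assms by cases (simp_all add: lowerB_def, arith+)
  qed
  moreover have "lowerB p k m i = i" if "i \<notin> {1..p + k + m}" for i using assms that by (auto simp: lowerB_def)
  moreover have "lowerB p k m (Suc i) < lowerB p k m i" if "1 \<le> i" "i < p + k + m" "i \<notin> {p, p + k}" for i
    using assms that by (auto simp: lowerB_def)
  ultimately have "double_max (p + k + m) {p, p + k} (lowerB p k m) \<and> inv (lowerB p k m) = lowerB p k m"
    by (rule involution_double_max)
  then show "double_max (p + k + m) {p, p + k} (lowerB p k m)" "inv (lowerB p k m) = lowerB p k m" by auto
  show "rank_count (lowerB p k m) p p = p" "rank_count (lowerB p k m) p (p + k) = p"
    using assms by (intro rank_count_full; auto simp: lowerB_def)+
  show "Suc (rank_count (lowerB p k m) (p + k) (p + k)) = p + k"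
    using assms by (intro rank_count_but_one[of "p + 1"]) (auto simp: lowerB_def)
qed

lemma rank_count_cong_below:
  assumes v: "v permutes {1..n}" and w: "w permutes {1..n}" and "i \<le> n" "\<And>j. i < j \<Longrightarrow> v j = w j"
  shows "rank_count v i q = rank_count w i q"
  using assms(3,4)
proof (induction i rule: inc_induct)
  case base
  show ?case using rank_count_beyond[OF v w] by simp
next
  case (step i)
  then have "rank_count v (Suc i) q = rank_count w (Suc i) q" by simp
  then show ?case using step.prems[of "Suc i"] by (simp add: rank_count_Suc)
qed

text \<open>\<open>upperB\<close> and \<open>omB\<close> form a 4231 configuration with block sizes
  \<open>k - 1\<close> and \<open>m\<close>. The common points are those in the first
  \<open>p\<close> rows and \<open>(p + k, 1)\<close>, and the ranks agree at all of them.\<close>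

lemma KL_poly_upperB:
  assumes "1 \<le> p" "2 \<le> k" "1 \<le> m"
  shows "KL_poly (p + k + m) (upperB p k m) (omB p k m) = qint (min (k - 1) m)"
proof -
  let ?n = "p + k + m" and ?v = "upperB p k m" and ?w = "omB p k m"
  define x where "x a = (if a < k then p + a else p + a + 1)" for a
  have v: "?v permutes {1..?n}" and w: "?w permutes {1..?n}"
    using upperB_props(1)[OF assms] omB_props(1)[OF assms] by (auto simp: double_max_def)
  have r: "rank_count ?v i q = rank_count ?w i q" if "i \<le> p" for i q
    using that assms by (intro rank_count_cong) (auto simp: upperB_def omB_def)
  have "configuration ?n (k - 1 + m) x x (nuA (k - 1) m) (omA (k - 1) m) ?v ?w"
    unfolding configuration_def
  proof (intro conjI ballI)
    show "strict_mono_on {1..k - 1 + m} x" by (auto simp: strict_mono_on_def x_def)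
    then show "strict_mono_on {1..k - 1 + m} x" .
    show "x ` {1..k - 1 + m} \<subseteq> {1..?n}" using assms by (auto simp: x_def)
    then show "x ` {1..k - 1 + m} \<subseteq> {1..?n}" .
    show "?w (x a) = x (omA (k - 1) m a)" if "a \<in> {1..k - 1 + m}" for a
      using that assms by (auto simp: x_def omB_def omA_def)
    show "?v (x a) = x (nuA (k - 1) m a)" if "a \<in> {1..k - 1 + m}" for a
      using that assms by (auto simp: x_def upperB_def nuA_def)
    fix i assume i: "i \<in> {1..?n} - x ` {1..k - 1 + m}"
    have "i \<le> p \<or> i = p + k"
    proof (rule ccontr)
      assume "\<not> (i \<le> p \<or> i = p + k)"
      then consider "p < i" "i < p + k" | "p + k < i" by linarith
      then show False
      proof cases
        case 1
        then have "i = x (i - p)" "i - p \<in> {1..k - 1 + m}" by (auto simp: x_def)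
        then show False using i by blast
      next
        case 2
        then have "i = x (i - p - 1)" "i - p - 1 \<in> {1..k - 1 + m}" using i assms by (auto simp: x_def)
        then show False using i by blast
      qed
    qed
    then show "?v i = ?w i" using assms by (auto simp: upperB_def omB_def)
    show "rank_count ?v i (?w i) \<le> rank_count ?w i (?w i)"
    proof (cases "i \<le> p")
      case False
      then have "i = p + k" "?w i = 1" using \<open>i \<le> p \<or> i = p + k\<close> assms by (auto simp: omB_def)
      \<comment> \<open>Both are involutions, so column 1 of the rank function equals row 1, one of
        the rows where they agree.\<close>
      moreover have "rank_count ?v (p + k) 1 = rank_count ?w (p + k) 1"
        using r[of 1 "p + k"] assms rank_count_involution[OF v upperB_props(2)[OF assms]]
          rank_count_involution[OF w omB_props(2)[OF assms]] by metis
      ultimately show ?thesis by simp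
    qed (use r in simp)
  qed (use v w in auto)
  then show ?thesis using assms by (intro KL_poly_configurationA) auto
qed

text \<open>Here the 4231 configuration has block sizes \<open>p\<close> and \<open>k - 1\<close>;
  the common points lie in row \<open>p + 1\<close> and in the rows after
  \<open>p + k\<close>.\<close>

lemma KL_poly_lowerB:
  assumes "1 \<le> p" "2 \<le> k" "1 \<le> m"
  shows "KL_poly (p + k + m) (lowerB p k m) (omB p k m) = qint (min p (k - 1))"
proof -
  let ?n = "p + k + m" and ?v = "lowerB p k m" and ?w = "omB p k m"
  define x where "x a = (if a \<le> p then a else a + 1)" for a
  have v: "?v permutes {1..?n}" and w: "?w permutes {1..?n}"
    using lowerB_props(1)[OF assms] omB_props(1)[OF assms] by (auto simp: double_max_def)
  have r: "rank_count ?v i q = rank_count ?w i q" if "p + k \<le> i" "i \<le> ?n" for i q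
    using that assms by (intro rank_count_cong_below[OF v w]) (auto simp: lowerB_def omB_def)
  have "configuration ?n (p + (k - 1)) x x (nuA p (k - 1)) (omA p (k - 1)) ?v ?w"
    unfolding configuration_def
  proof (intro conjI ballI)
    show "strict_mono_on {1..p + (k - 1)} x" by (auto simp: strict_mono_on_def x_def)
    then show "strict_mono_on {1..p + (k - 1)} x" .
    show "x ` {1..p + (k - 1)} \<subseteq> {1..?n}" using assms by (auto simp: x_def)
    then show "x ` {1..p + (k - 1)} \<subseteq> {1..?n}" .
    show "?w (x a) = x (omA p (k - 1) a)" if "a \<in> {1..p + (k - 1)}" for a
      using that assms by (auto simp: x_def omB_def omA_def)
    show "?v (x a) = x (nuA p (k - 1) a)" if "a \<in> {1..p + (k - 1)}" for a
      using that assms by (auto simp: x_def lowerB_def nuA_def)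
    fix i assume i: "i \<in> {1..?n} - x ` {1..p + (k - 1)}"
    have "i = p + 1 \<or> p + k < i"
    proof (rule ccontr)
      assume "\<not> (i = p + 1 \<or> p + k < i)"
      then consider "i \<le> p" | "p + 1 < i" "i \<le> p + k" by linarith
      then show False
      proof cases
        case 1
        then have "i = x i" "i \<in> {1..p + (k - 1)}" using i by (auto simp: x_def)
        then show False using i by blast
      next
        case 2
        then have "i = x (i - 1)" "i - 1 \<in> {1..p + (k - 1)}" using i assms by (auto simp: x_def)
        then show False using i by blast
      qed
    qed
    then show "?v i = ?w i" using assms by (auto simp: lowerB_def omB_def)
    show "rank_count ?v i (?w i) \<le> rank_count ?w i (?w i)"
    proof (cases "i = p + 1")
      case True
      then have "?w i = ?n" using assms by (auto simp: omB_def)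
      moreover have "rank_count ?v (p + 1) ?n = rank_count ?w (p + 1) ?n"
        using r[of ?n "p + 1"] assms rank_count_involution[OF v lowerB_props(2)[OF assms]]
          rank_count_involution[OF w omB_props(2)[OF assms]] by (metis le_add1 order_refl)
      ultimately show ?thesis using True by simp
    qed (use r i \<open>i = p + 1 \<or> p + k < i\<close> in simp)
  qed (use v w in auto)
  then show ?thesis using assms by (intro KL_poly_configurationA) auto
qed


text \<open>Four double cosets lie below \<open>omB\<close>: the ranks at \<open>(p, p)\<close> and
  \<open>(p + k, p + k)\<close> may each drop by one, while those at the two other corners must be
  \<open>p\<close>. The condition \<open>special\<close> says exactly that both intermediate
  polynomials, \<open>qint (min (k - 1) m)\<close> and \<open>qint (min p (k - 1))\<close>, are
  1.\<close>

lemma KL_poly_typeB: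
  assumes p: "1 \<le> p" and k: "2 \<le> k" and m: "1 \<le> m" and special: "k = 2 \<or> (p = 1 \<and> m = 1)"
  shows "KL_poly (p + k + m) (nuB p k m) (omB p k m) = 1 + monom 1 (k - 1)"
proof -
  let ?n = "p + k + m" and ?d = "p + k" and ?om = "omB p k m" and ?nu = "nuB p k m"
  let ?up = "upperB p k m" and ?lo = "lowerB p k m"
  note om = omB_props[OF p k m] and nu = nuB_props[OF p k m]
    and up = upperB_props[OF p k m] and lo = lowerB_props[OF p k m]
  have K: "{p, ?d} \<subseteq> {1..<?n}" using p k m by auto
  have pom: "?om permutes {1..?n}" and pnu: "?nu permutes {1..?n}"
    and pup: "?up permutes {1..?n}" and plo: "?lo permutes {1..?n}"
    using om(1) nu(1) up(1) lo(1) by (auto simp: double_max_def)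
  have om': "rank_count ?om ?d p = p" and nu': "rank_count ?nu ?d p = p"
    and up': "rank_count ?up ?d p = p" and lo': "rank_count ?lo ?d p = p"
    using rank_count_involution[OF pom om(2), of ?d p] rank_count_involution[OF pnu nu(2), of ?d p]
      rank_count_involution[OF pup up(2), of ?d p] rank_count_involution[OF plo lo(2), of ?d p]
      om(4) nu(4) up(4) lo(4) by simp_all
  obtain p' where p': "p = Suc p'" using p by (cases p) auto
  obtain k' where k': "k = Suc (Suc k')" using k by (metis One_nat_def Suc_le_D Suc_le_mono numeral_2_eq_2)
  obtain m' where m': "m = Suc m'" using m by (cases m) auto
  \<comment> \<open>Index 1 in \<open>A\<close> or \<open>C\<close> means that one own letter has
    been exchanged for a 2; the indices of \<open>B\<close> say whether it received a 1 and a 3 in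
    return.\<close>
  define A0 A1 C0 C1 B00 B10 B01 B11 :: "nat multiset" where
    "A0 = replicate_mset p 1" and "A1 = add_mset 2 (replicate_mset p' 1)" and
    "C0 = replicate_mset m 3" and "C1 = add_mset 2 (replicate_mset m' 3)" and
    "B00 = replicate_mset k 2" and "B10 = add_mset 1 (replicate_mset (Suc k') 2)" and
    "B01 = add_mset 3 (replicate_mset (Suc k') 2)" and "B11 = add_mset 1 (add_mset 3 (replicate_mset k' 2))"
  define M where "M = replicate_mset p 1 + replicate_mset k 2 + replicate_mset m (3::nat)"
  define Q where "Q = qfacts M"
  have bounds: "p \<le> ?d" "?d \<le> ?n" by auto
  have M: "M = replicate_mset p 1 + replicate_mset (?d - p) 2 + replicate_mset (?n - ?d) 3"
    by (simp add: M_def)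
  note defs = A0_def A1_def C0_def C1_def B00_def B10_def B01_def B11_def
  have M00: "M = A0 + B00 + C0" and M10: "M = A1 + B10 + C0" and M01: "M = A0 + B01 + C1"
    and M11: "M = A1 + B11 + C1"
    by (simp_all add: M_def defs p' k' m')
  let ?C = "\<lambda>A B. in_class ?n p ?d A B"
  let ?S = "\<lambda>A B. \<Sum>a | a permutes {1..?n}. qX ^ inversions ?n a * of_bool (?C A B a)"
  have e: "r = p' \<longleftrightarrow> Suc r = p" for r using p' by auto
  have c00: "?C A0 B00 a \<longleftrightarrow> rank_count a p p = p \<and> rank_count a p ?d = p \<and> rank_count a ?d p = p \<and> rank_count a ?d ?d = ?d" for a
    by (subst in_class_iff) (auto simp: defs)
  have c10: "?C A1 B10 a \<longleftrightarrow> Suc (rank_count a p p) = p \<and> rank_count a p ?d = p \<and> rank_count a ?d p = p \<and> rank_count a ?d ?d = ?d" for a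
  proof -
    have "size A1 = p" "size A1 + size B10 = ?d" "count A1 1 = p'" "count A1 3 = 0" "count B10 1 = 1" "count B10 3 = 0"
      "set_mset A1 \<subseteq> {1, 2, 3}" "set_mset B10 \<subseteq> {1, 2, 3}"
      by (auto simp: defs p' k')
    then show ?thesis by (subst in_class_iff) (auto simp: p')
  qed
  have c01: "?C A0 B01 a \<longleftrightarrow> rank_count a p p = p \<and> rank_count a p ?d = p \<and> rank_count a ?d p = p \<and> Suc (rank_count a ?d ?d) = ?d" for a
  proof -
    have "size A0 = p" "size A0 + size B01 = ?d" "count A0 1 = p" "count A0 3 = 0" "count B01 1 = 0" "count B01 3 = 1"
      "set_mset A0 \<subseteq> {1, 2, 3}" "set_mset B01 \<subseteq> {1, 2, 3}"
      by (auto simp: defs k')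
    then show ?thesis by (subst in_class_iff) auto
  qed
  have c11: "?C A1 B11 a \<longleftrightarrow> Suc (rank_count a p p) = p \<and> rank_count a p ?d = p \<and> rank_count a ?d p = p \<and> Suc (rank_count a ?d ?d) = ?d" for a
  proof -
    have "size A1 = p" "size A1 + size B11 = ?d" "count A1 1 = p'" "count A1 3 = 0" "count B11 1 = 1" "count B11 3 = 1"
      "set_mset A1 \<subseteq> {1, 2, 3}" "set_mset B11 \<subseteq> {1, 2, 3}"
      by (auto simp: defs p' k')
    then show ?thesis by (subst in_class_iff) (auto simp: p')
  qed
  have q: "qmult A0 = 1" "qmult B00 = 1" "qmult C0 = 1" "qmult A1 = qint p" "qmult B10 = qint k"
    "qmult B01 = qint k" "qmult B11 = qint (k - 1) * qint k" "qmult C1 = qint m"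
    using qmult_one_large[of 1 2 p'] qmult_one_small[of 1 2 "Suc k'"] qmult_one_large[of 2 3 "Suc k'"]
      qmult_small_large[of 1 2 3 k'] qmult_one_small[of 2 3 m']
    by (simp_all add: defs p' k' m' del: replicate_mset_Suc)
  have cr: "cross A0 B00 = 0" "cross A0 C0 = 0" "cross B00 C0 = 0"
    "cross A1 B10 = 1" "cross A1 C0 = 0" "cross B10 C0 = 0"
    "cross A0 B01 = 0" "cross A0 C1 = 0" "cross B01 C1 = 1"
    "cross A1 B11 = 1" "cross A1 C1 = 0" "cross B11 C1 = 1"
    by (simp_all add: defs filter_replicate_mset One_nat_def)
  have s00: "?S A0 B00 = Q"
    unfolding class_sum[OF bounds M M00] cr q by (simp add: Q_def)
  have s10: "?S A1 B10 = Q * (qX * qint p * qint k)"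
    unfolding class_sum[OF bounds M M10] cr q by (simp add: Q_def del: mult_pCons_left)
  have s01: "?S A0 B01 = Q * (qX * qint k * qint m)"
    unfolding class_sum[OF bounds M M01] cr q by (simp add: Q_def del: mult_pCons_left)
  have s11: "?S A1 B11 = Q * (qX * qX * qint p * (qint (k - 1) * qint k) * qint m)"
    unfolding class_sum[OF bounds M M11] cr q
    by (simp add: Q_def power2_eq_square algebra_simps del: mult_pCons_left mult_pCons_right)
  have one: "qint 1 = 1" using qint_Suc[of 0] by (simp add: One_nat_def)
  have KLup: "KL_poly ?n ?up ?om = 1"
  proof -
    have "min (k - 1) m = 1" using special k m by auto
    then show ?thesis using KL_poly_upperB[OF p k m] one by simp
  qed
  have KLlo: "KL_poly ?n ?lo ?om = 1"
  proof -
    have "min p (k - 1) = 1" using special k p by auto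
    then show ?thesis using KL_poly_lowerB[OF p k m] one by simp
  qed
  define P where "P = KL_poly ?n ?nu ?om"
  have KL: "KL_poly ?n a ?om = of_bool (?C A0 B00 a) * P + of_bool (?C A1 B10 a) + of_bool (?C A0 B01 a) + of_bool (?C A1 B11 a)"
    if a: "a permutes {1..?n}" for a
  proof -
    let ?low = "p \<le> Suc (rank_count a p p) \<and> rank_count a p ?d = p \<and> rank_count a ?d p = p \<and> ?d \<le> Suc (rank_count a ?d ?d)"
    show ?thesis
    proof (cases ?low)
      case True
      consider "rank_count a p p = p" "rank_count a ?d ?d = ?d" | "Suc (rank_count a p p) = p" "rank_count a ?d ?d = ?d"
        | "rank_count a p p = p" "Suc (rank_count a ?d ?d) = ?d" | "Suc (rank_count a p p) = p" "Suc (rank_count a ?d ?d) = ?d"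
        using True rank_count_le_row[of a p p] rank_count_le_row[of a ?d ?d] by linarith
      then show ?thesis
      proof cases
        case 1
        then have "KL_poly ?n a ?om = P"
          unfolding P_def using nu nu' True by (intro KL_poly_corners[OF om(1) nu(1) K a]) auto
        then show ?thesis using 1 True by (simp add: c00 c10 c01 c11)
      next
        case 2
        then have "KL_poly ?n a ?om = KL_poly ?n ?up ?om"
          using up up' True by (intro KL_poly_corners[OF om(1) up(1) K a]) auto
        then show ?thesis using 2 True KLup by (simp add: c00 c10 c01 c11)
      next
        case 3
        then have "KL_poly ?n a ?om = KL_poly ?n ?lo ?om"
          using lo lo' True by (intro KL_poly_corners[OF om(1) lo(1) K a]) auto
        then show ?thesis using 3 True KLlo by (simp add: c00 c10 c01 c11)
      next
        case 4
        then have "KL_poly ?n a ?om = KL_poly ?n ?om ?om"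
          using om om' True by (intro KL_poly_corners[OF om(1) om(1) K a]) auto
        then show ?thesis using 4 True KL_poly_refl[OF pom] by (simp add: c00 c10 c01 c11)
      qed
    next
      case False
      \<comment> \<open>Outside the four classes one of the corner inequalities fails; at
        \<open>(p, p + k)\<close> and \<open>(p + k, p)\<close> no rank exceeds
        \<open>p\<close>.\<close>
      have "\<not> rank_le a ?om"
      proof
        assume "rank_le a ?om"
        then have "rank_count ?om x y \<le> rank_count a x y" for x y by (simp add: rank_le_def)
        from this[of p p] this[of p ?d] this[of ?d p] this[of ?d ?d] False om om'
          rank_count_le_row[of a p ?d] rank_count_le_col[OF a, of ?d p]
        show False by auto
      qed
      then have "KL_poly ?n a ?om = 0" using KL_poly_zero[OF a pom] by (simp add: bruhat_le_iff)
      then show ?thesis using False by (auto simp: c00 c10 c01 c11)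
    qed
  qed
  define R where "R = qX * qint p * qint k + qX * qint k * qint m + qX * qX * qint p * (qint (k - 1) * qint k) * qint m"
  have T: "(\<Sum>a | a permutes {1..?n}. qX ^ inversions ?n a * KL_poly ?n a ?om) = Q * (P + R)"
  proof -
    have "(\<Sum>a | a permutes {1..?n}. qX ^ inversions ?n a * KL_poly ?n a ?om) =
      (\<Sum>a | a permutes {1..?n}. qX ^ inversions ?n a * of_bool (?C A0 B00 a) * P +
        qX ^ inversions ?n a * of_bool (?C A1 B10 a) + qX ^ inversions ?n a * of_bool (?C A0 B01 a) +
        qX ^ inversions ?n a * of_bool (?C A1 B11 a))"
      by (intro sum.cong refl) (use KL in \<open>simp add: algebra_simps\<close>)
    also have "\<dots> = Q * P + Q * (qX * qint p * qint k) + Q * (qX * qint k * qint m) +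
        Q * (qX * qX * qint p * (qint (k - 1) * qint k) * qint m)"
      unfolding sum.distrib sum_distrib_right[symmetric] s00 s10 s01 s11 ..
    finally show ?thesis unfolding R_def by (simp add: algebra_simps del: mult_pCons_left)
  qed
  have palQ: "palindromic Q" unfolding Q_def by (rule palindromic_qfacts)
  \<comment> \<open>The degree of the last summand of \<open>R\<close>, which belongs to the double
    coset of \<open>omB\<close>; hence the length difference.\<close>
  define d where "d = p + 2 * k + m - 3"
  have dk: "k - 1 = Suc k'" using k' by simp
  have qn: "qint (Suc j) \<noteq> 0" for j using palindromic_neq_0[OF palindromic_qint] .
  have degX: "degree qX = 1" "qX \<noteq> 0" by auto
  have degs: "degree (qX * qint p * qint k) = p + k - 1" "degree (qX * qint k * qint m) = k + m - 1"
    "degree (qX * qX * qint p * (qint (k - 1) * qint k) * qint m) = d"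
    "qX * qX * qint p * (qint (k - 1) * qint k) * qint m \<noteq> 0"
    unfolding dk unfolding p' k' m' d_def using qn degX
    by (simp_all add: degree_mult_eq degree_qint del: mult_pCons_left)
  have degR: "degree R \<le> d"
    unfolding R_def using degs p k m by (intro degree_add_le) (auto simp: d_def simp del: mult_pCons_left)
  have dnu: "degree Q = inversions ?n ?nu"
    unfolding s00[symmetric]
    by (rule degree_class_sum[OF nu(1) K]) (use c00 pnu nu nu' in auto)
  have "degree (Q * (qX * qX * qint p * (qint (k - 1) * qint k) * qint m)) = inversions ?n ?om"
    unfolding s11[symmetric]
    by (rule degree_class_sum[OF om(1) K]) (use c11 pom om om' in auto)
  then have dom: "inversions ?n ?om = degree Q + d"
    using palindromic_neq_0[OF palQ] degs by (simp add: degree_mult_eq del: mult_pCons_left)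
  have le: "bruhat_le ?n ?nu ?om" "?nu \<noteq> ?om"
  proof -
    have "rank_le ?nu ?om" using om om' nu nu' by (intro rank_le_corners[OF pnu om(1) K]) auto
    then show "bruhat_le ?n ?nu ?om" using pnu pom by (simp add: bruhat_le_iff)
    show "?nu \<noteq> ?om" using om(3) nu(3) by auto
  qed
  have mX: "monom 1 1 = qX" using qX_power[of 1] by simp
  have "P = 1 + monom 1 (k - 1)"
  proof (rule palindromic_quotient[OF palQ])
    show "1 \<le> d" using p k m by (auto simp: d_def)
    show "rv (degree Q + d) (Q * (P + R)) = Q * (P + R)"
      using KL_poly_sum_palindromic[OF pom] unfolding T dom .
    show "degree R \<le> d" by (rule degR)
    show "2 * degree P \<le> d - 1"
      using KL_poly_degree[OF le] unfolding P_def dom dnu by simp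
    have "degree (1 + monom 1 (k - 1) :: int poly) \<le> k - 1"
      by (intro degree_add_le) (auto simp: degree_monom_le)
    then show "2 * degree (1 + monom 1 (k - 1) :: int poly) \<le> d - 1"
      using p k m by (auto simp: d_def)
    show "rv d (1 + monom 1 (k - 1) + R) = 1 + monom 1 (k - 1) + R"
    \<comment> \<open>With [k] for \<open>qint k\<close>: for \<open>k = 2\<close> the sum is the
      product [2] [p + 1] [m + 1]. For \<open>p = m = 1\<close> it is [k + 1] [k] plus q^(k - 1) +
      q^k, and both parts are symmetric about d/2 since d = 2k - 1.\<close>
    proof (cases "k = 2")
      case True
      have "qint 2 = 1 + qX" using qint_Suc'[of 1] one by (simp add: numeral_2_eq_2 One_nat_def)
      then have "1 + monom 1 (k - 1) + R = qint (Suc 1) * (qint (Suc p) * qint (Suc m))"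
        using True one mX unfolding R_def qint_Suc'[of p] qint_Suc'[of m]
        by (simp add: algebra_simps del: mult_pCons_left add: numeral_2_eq_2 One_nat_def)
      moreover have "palindromic (qint (Suc 1) * (qint (Suc p) * qint (Suc m)))"
        by (intro palindromic_mult palindromic_qint)
      moreover have "degree (qint (Suc 1) * (qint (Suc p) * qint (Suc m))) = d"
        unfolding palindromic_mult(2)[OF palindromic_qint palindromic_mult(1)[OF palindromic_qint palindromic_qint]]
          palindromic_mult(2)[OF palindromic_qint palindromic_qint] degree_qint
        using True by (simp add: d_def)
      ultimately show ?thesis by (simp add: rv_palindromic)
    next
      case False
      then have pm: "p = 1" "m = 1" using special by auto
      then have d: "d = 2 * k - 1" using k by (simp add: d_def)
      define X where "X = qX"
      define h where "h = qint k"
      have Xk: "X ^ k = 1 + X * h - h" using qint_Suc'[of k] qint_Suc[of k] by (simp add: X_def h_def)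
      have "h = 1 + X * qint (k - 1)" using qint_Suc'[of "k - 1"] k by (simp add: X_def h_def)
      then have hX: "X * qint (k - 1) = h - 1" by simp
      have "R = X * h + X * h + X * (X * qint (k - 1)) * h"
        unfolding R_def pm one X_def h_def by (simp only: mult_1 mult_1_right ac_simps)
      from this[unfolded hX] have "1 + monom 1 (k - 1) + R = (1 + X * h) * h + (monom 1 (k - 1) + X ^ k)"
        unfolding Xk by (simp add: algebra_simps)
      then have E: "1 + monom 1 (k - 1) + R = qint (Suc k) * qint k + (monom 1 (k - 1) + monom 1 k)"
        unfolding qint_Suc'[of k] X_def h_def qX_power .
      have F: "rv d (qint (Suc k) * qint k) = qint (Suc k) * qint k"
      proof (rule rv_palindromic)
        show "palindromic (qint (Suc k) * qint k)" unfolding k' by (intro palindromic_mult palindromic_qint)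
        show "degree (qint (Suc k) * qint k) = d"
          unfolding d k' using qn by (simp add: degree_mult_eq degree_qint)
      qed
      have G: "rv d (monom 1 (k - 1) + monom 1 k) = (monom 1 (k - 1) + monom 1 k :: int poly)"
      proof -
        have "d - (k - 1) = k" "d - k = k - 1" "k - 1 \<le> d" "k \<le> d" using d k by auto
        then show ?thesis by (simp add: rv_add rv_monom add.commute)
      qed
      show ?thesis unfolding E by (subst rv_add) (simp only: F G)
    qed
  qed
  then show ?thesis by (simp add: P_def)
qed

lemma KL_poly_configurationB:
  assumes "1 \<le> p" "2 \<le> k" "1 \<le> m" "k = 2 \<or> (p = 1 \<and> m = 1)"
    "configuration n (p + k + m) x y (nuB p k m) (omB p k m) v w"
  shows "KL_poly n v w = 1 + monom 1 (k - 1)"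
proof -
  have "nuB p k m permutes {1..p + k + m}" "omB p k m permutes {1..p + k + m}"
    using omB_props(1)[OF assms(1-3)] nuB_props(1)[OF assms(1-3)] by (auto simp: double_max_def)
  \<comment> \<open>Both patterns agree on the rows from \<open>p + 2\<close> to
    \<open>p + k - 1\<close>, and \<open>omB\<close> drops to 1 in row \<open>p + k\<close>; so row
    \<open>p + k - 1\<close> can serve as the crossing row.\<close>
  moreover have "nuB p k m a \<le> omB p k m a" if "a \<le> p + k - 1" for a
    using that assms(1-3) by (auto simp: nuB_def omB_def)
  moreover have "omB p k m a \<le> nuB p k m a" if "p + k - 1 < a" for a
    using that assms(1-3) by (auto simp: nuB_def omB_def)
  ultimately have "KL_poly n v w = KL_poly (p + k + m) (nuB p k m) (omB p k m)"
    using assms by (intro KL_poly_configuration[where t = "p + k - 1" and x = x and y = y]) auto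
  then show ?thesis using KL_poly_typeB[OF assms(1-4)] by simp
qed

section \<open>From one-line notation to the patterns\<close>

lemma minimal_configuration_imp:
  assumes "minimal_configuration n \<omega> \<nu> v w" "v permutes {1..n}" "w permutes {1..n}" "length \<omega> = N"
    "\<And>a. a \<in> {1..N} \<Longrightarrow> \<omega> ! (a - 1) = om a" "\<And>a. a \<in> {1..N} \<Longrightarrow> \<nu> ! (a - 1) = nu a"
  obtains x y where "configuration n N x y nu om v w"
proof -
  obtain x y where xy: "strict_mono_on {1..N} x" "strict_mono_on {1..N} y"
      "x ` {1..N} \<subseteq> {1..n}" "y ` {1..N} \<subseteq> {1..n}"
      "\<forall>a\<in>{1..N}. w (x a) = y (\<omega> ! (a - 1))" "\<forall>a\<in>{1..N}. v (x a) = y (\<nu> ! (a - 1))"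
      "\<forall>i. i \<notin> x ` {1..N} \<longrightarrow> v i = w i"
      "\<forall>i\<in>{1..n} - x ` {1..N}. \<not> rank_count w i (w i) < rank_count v i (w i)"
    using assms(1) unfolding minimal_configuration_def Let_def assms(4) by blast
  then have "configuration n N x y nu om v w"
    using assms(2,3,5,6) by (auto simp: configuration_def not_less)
  then show ?thesis by (rule that)
qed

lemma nth_rev_upt: "i < b - a \<Longrightarrow> rev [a..<b] ! i = b - 1 - i"
  by (simp add: rev_nth)

lemma pattern_4231:
  assumes "a \<in> {1..l + m + 2}"
  shows "omega4231 l m ! (a - 1) = omA (l + 1) (m + 1) a" "nu4231 l m ! (a - 1) = nuA (l + 1) (m + 1) a"
  using assms by (auto simp: omega4231_def nu4231_def omA_def nuA_def Let_def nth_append nth_Cons' nth_rev_upt simp del: upt_Suc)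

lemma pattern_34star12:
  assumes "a \<in> {1..l + 4}"
  shows "omega34star12 l ! (a - 1) = omB 1 (l + 2) 1 a" "nu34star12 l ! (a - 1) = nuB 1 (l + 2) 1 a"
  using assms by (auto simp: omega34star12_def nu34star12_def omB_def nuB_def Let_def nth_append nth_Cons' nth_rev_upt simp del: upt_Suc)

lemma pattern_34empty12:
  assumes "a \<in> {1..l + m + 4}"
  shows "omega34empty12 l m ! (a - 1) = omB (l + 1) 2 (m + 1) a" "nu34empty12 l m ! (a - 1) = nuB (l + 1) 2 (m + 1) a"
  using assms by (auto simp: omega34empty12_def nu34empty12_def omB_def nuB_def Let_def nth_append nth_Cons' nth_rev_upt simp del: upt_Suc)

theorem mainTheorem2:
  fixes n :: nat
    and V :: "nat \<Rightarrow> (nat \<Rightarrow> 'k::{alg_closed_field, field_char_0}) set"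
    and v w :: "nat \<Rightarrow> nat"
  assumes "V \<in> complete_flags n"
    and "v permutes {1..n}"
    and "w permutes {1..n}"
    and "irreducible_component n (singular_locus n (schubert n V w)) (schubert n V v)"
  shows "(\<forall>l m. 0 < l \<longrightarrow> 0 < m \<longrightarrow>
            minimal_configuration n (omega4231 l m) (nu4231 l m) v w \<longrightarrow>
            KL_poly n v w = (\<Sum>i\<le>min l m. monom 1 i)) \<and>
         (\<forall>l. minimal_configuration n (omega34star12 l) (nu34star12 l) v w \<longrightarrow>
            KL_poly n v w = 1 + monom 1 (l + 1)) \<and>
         (\<forall>l m. minimal_configuration n (omega34empty12 l m) (nu34empty12 l m) v w \<longrightarrow>
            KL_poly n v w = 1 + monom 1 1)"
proof (intro conjI allI impI)
  fix l m assume min: "minimal_configuration n (omega4231 l m) (nu4231 l m) v w"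
  have len: "length (omega4231 l m) = l + m + 2"
    by (simp add: omega4231_def Let_def del: upt_Suc)
  obtain x y where "configuration n (l + m + 2) x y (nuA (l + 1) (m + 1)) (omA (l + 1) (m + 1)) v w"
    using minimal_configuration_imp[OF min assms(2,3) len pattern_4231] .
  \<comment> \<open>The block sizes are \<open>l + 1\<close> and \<open>m + 1\<close>, so the
    q-integer has \<open>min l m + 1\<close> terms.\<close>
  then have "KL_poly n v w = qint (min (l + 1) (m + 1))"
    by (intro KL_poly_configurationA[where x = x and y = y]) (simp_all add: algebra_simps One_nat_def)
  also have "\<dots> = (\<Sum>i\<le>min l m. monom 1 i)"
  proof -
    have "min (l + 1) (m + 1) = Suc (min l m)" by simp
    then show ?thesis by (simp only: qint_def qX_power lessThan_Suc_atMost)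
  qed
  finally show "KL_poly n v w = (\<Sum>i\<le>min l m. monom 1 i)" .
next
  fix l assume min: "minimal_configuration n (omega34star12 l) (nu34star12 l) v w"
  have len: "length (omega34star12 l) = l + 4"
    by (simp add: omega34star12_def Let_def del: upt_Suc)
  obtain x y where "configuration n (l + 4) x y (nuB 1 (l + 2) 1) (omB 1 (l + 2) 1) v w"
    using minimal_configuration_imp[OF min assms(2,3) len pattern_34star12] .
  then have "KL_poly n v w = 1 + monom 1 (l + 2 - 1)"
    by (intro KL_poly_configurationB[where p = 1 and m = 1 and x = x and y = y])
      (simp_all add: algebra_simps One_nat_def numeral_eq_Suc)
  then show "KL_poly n v w = 1 + monom 1 (l + 1)" by (simp add: One_nat_def)
next
  fix l m assume min: "minimal_configuration n (omega34empty12 l m) (nu34empty12 l m) v w"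
  have len: "length (omega34empty12 l m) = l + m + 4"
    by (simp add: omega34empty12_def Let_def del: upt_Suc)
  obtain x y where "configuration n (l + m + 4) x y (nuB (l + 1) 2 (m + 1)) (omB (l + 1) 2 (m + 1)) v w"
    using minimal_configuration_imp[OF min assms(2,3) len pattern_34empty12] .
  moreover have "l + m + 4 = (l + 1) + 2 + (m + 1)" by simp
  ultimately have "configuration n ((l + 1) + 2 + (m + 1)) x y (nuB (l + 1) 2 (m + 1)) (omB (l + 1) 2 (m + 1)) v w"
    by (simp only:)
  then have "KL_poly n v w = 1 + monom 1 (2 - 1)"
    by (intro KL_poly_configurationB[where p = "l + 1" and m = "m + 1" and x = x and y = y]) simp_all
  then show "KL_poly n v w = 1 + monom 1 1" by (simp add: One_nat_def)
qed

end
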